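(* Let $N\ge 1$ and $0<\theta\le 2$. Let $f\in C^1(0,\infty)\cap C[0,\infty)$ satisfy $f(u)>0$ for $u>0$, $f'(u)\ge 0$ for $u\ge 0$ (wherever $f'$ is defined), $F(u):=\int_u^\infty \frac{dt}{f(t)}<\infty$ for large $u>0$, and suppose that the limit $q:=\lim_{u\to\infty}f'(u)F(u)$ exists and $q>1$. For a nonnegative measurable function $\phi$ on $\mathbb{R}^N$ consider the Cauchy problem $$\partial_t u+(-\Delta)^{\theta/2}u=f(u)\ \text{ in } \mathbb{R}^N\times(0,T),\qquad u(x,0)=\phi(x)\ \text{ in }\mathbb{R}^N. \qquad (P)$$ Then the following hold. (i-1) Assume that $r>N/\theta$ and $r>q-1$. If $\phi\ge 0$ and $F(\phi)^{-r}\in L^1_{\mathrm{ul},\rho}(\mathbb{R}^N)$, then (P) has a local-in-time (integral) solution. (i-2) Assume that $r>N/\theta$ and $r\ge q-1$ and that $f'(u)F(u)\le q$ for large $u>0$. If $\phi\ge 0$ and $F(\phi)^{-r}\in L^1_{\mathrm{ul},\rho}(\mathbb{R}^N)$, then (P) has a local-in-time (integral) solution. (ii) Assume that $f$ is convex. For any $r\in(0,N/\theta)$ there is $\phi\ge 0$ such that $F(\phi)^{-r}\in L^1_{\mathrm{ul},\rho}(\mathbb{R}^N)$ and (P) has no local-in-time nonnegative (integral) solution.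
   Context: Uniformly local space: for a fixed $\rho>0$, $L^1_{\mathrm{ul},\rho}(\mathbb{R}^N)$ is the set of $u\in L^1_{\mathrm{loc}}(\mathbb{R}^N)$ with $\sup_{y\in\mathbb{R}^N}\int_{B_y(\rho)}|u(x)|\,dx<\infty$, where $B_y(\rho)=\{x:|x-y|<\rho\}$. Function $F$: $F$ is finite and strictly decreasing on $(0,\infty)$, with $0<F(0)\le\infty$. $F(\phi)^{-r}$ means $1/F(\phi(x))^{r}$ (with value $0$ where $F(\phi(x))=\infty$). Semigroup: $G(x,t)=(2\pi)^{-N}\int_{\mathbb{R}^N}e^{ix\cdot\xi-t|\xi|^\theta}d\xi$ is the fundamental solution of $\partial_tu+(-\Delta)^{\theta/2}u=0$ (a positive function with $\int_{\mathbb{R}^N} G(x,t)dx=1$), and $S(t)[\psi](x)=\int_{\mathbb{R}^N}G(x-y,t)\psi(y)\,dy$; for nonnegative measurable $\psi$ this takes values in $[0,\infty]$. Integral solution: a nonnegative measurable function $u$ on $\mathbb{R}^N\times(0,T)$ is a solution of (P) on $(0,T)$ if $$\infty>u(t)=S(t)\phi+\int_0^tS(t-s)f(u(s))\,ds\quad\text{a.e. } x\in\mathbb{R}^N,\ 0<t<T.$$ (P) has a local-in-time solution if such a $u$ exists for some $T>0$. *)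

theory Defs
  imports "HOL-Analysis.Analysis"
begin

text \<open>
  \<open>F u\<close> is the integral of \<open>1 / f\<close> over \<open>[u, \<infinity>)\<close>. If \<open>f 0 = 0\<close>, the HOL convention
  \<open>1 / 0 = 0\<close> only affects the integrand of \<open>F 0\<close> at a single point.
\<close>

definition tail_int :: "(real \<Rightarrow> real) \<Rightarrow> real \<Rightarrow> ennreal" where
  "tail_int f u = (\<integral>\<^sup>+t\<in>{u..}. ennreal (1 / f t) \<partial>lebesgue)"

definition tail_int_neg_powr :: "(real \<Rightarrow> real) \<Rightarrow> real \<Rightarrow> real \<Rightarrow> real" where
  "tail_int_neg_powr f r v =
     (if tail_int f v = \<infinity> then 0 else 1 / enn2real (tail_int f v) powr r)"

definition L1_loc :: "('a::euclidean_space \<Rightarrow> real) set" where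
  "L1_loc = {u \<in> borel_measurable lebesgue. \<forall>K. compact K \<longrightarrow> set_integrable lebesgue K u}"

definition L1_ul :: "real \<Rightarrow> ('a::euclidean_space \<Rightarrow> real) set" where
  "L1_ul \<rho> = {u \<in> L1_loc. (SUP y. \<integral>\<^sup>+x\<in>ball y \<rho>. ennreal \<bar>u x\<bar> \<partial>lebesgue) < \<infinity>}"

text \<open>
  The fundamental solution of \<open>\<partial>\<^sub>t u + (-\<Delta>)\<close>\<open>\<^sup>\<theta>\<^sup>/\<^sup>2\<close>\<open> u = 0\<close>. The Fourier integral is
  real by symmetry, so taking the real part only adjusts the type.
\<close>

definition frac_heat_kernel :: "real \<Rightarrow> real ^ 'n \<Rightarrow> real \<Rightarrow> real" where
  "frac_heat_kernel \<theta> x t =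
     Re (complex_of_real (1 / (2 * pi) ^ CARD('n)) *
         (LINT \<xi>|lebesgue.
            exp (\<i> * complex_of_real (x \<bullet> \<xi>) - complex_of_real (t * norm \<xi> powr \<theta>))))"

text \<open>
  Only applied to nonnegative \<open>\<psi>\<close>, hence with values in \<open>[0, \<infinity>]\<close>. The kernel is positive
  for \<open>0 < \<theta> \<le> 2\<close> and \<open>t > 0\<close>, so \<open>ennreal\<close> does not truncate it.
\<close>

definition frac_heat_semigroup ::
    "real \<Rightarrow> real \<Rightarrow> (real ^ 'n \<Rightarrow> ennreal) \<Rightarrow> real ^ 'n \<Rightarrow> ennreal" where
  "frac_heat_semigroup \<theta> t \<psi> x =
     (\<integral>\<^sup>+y. ennreal (frac_heat_kernel \<theta> (x - y) t) * \<psi> y \<partial>lebesgue)"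

text \<open>
  Since \<open>u\<close> is real-valued, the equation in \<open>ennreal\<close> includes the finiteness of the
  right-hand side for almost every \<open>x\<close>, for each \<open>t \<in> (0, T)\<close>.
\<close>

definition integral_solution ::
    "real \<Rightarrow> (real \<Rightarrow> real) \<Rightarrow> (real ^ 'n \<Rightarrow> real) \<Rightarrow> real \<Rightarrow> (real ^ 'n \<Rightarrow> real \<Rightarrow> real) \<Rightarrow> bool" where
  "integral_solution \<theta> f \<phi> T u \<longleftrightarrow>
     (\<lambda>(x, t). u x t) \<in> borel_measurable (lebesgue_on (UNIV \<times> {0<..<T})) \<and>
     (\<forall>x. \<forall>t\<in>{0<..<T}. 0 \<le> u x t) \<and>
     (\<forall>t\<in>{0<..<T}. AE x in lebesgue.
        ennreal (u x t) =
          frac_heat_semigroup \<theta> t (\<lambda>y. ennreal (\<phi> y)) x +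
          (\<integral>\<^sup>+s\<in>{0<..<t}. frac_heat_semigroup \<theta> (t - s) (\<lambda>y. ennreal (f (u y s))) x \<partial>lebesgue))"

definition has_local_solution ::
    "real \<Rightarrow> (real \<Rightarrow> real) \<Rightarrow> (real ^ 'n \<Rightarrow> real) \<Rightarrow> bool" where
  "has_local_solution \<theta> f \<phi> \<longleftrightarrow> (\<exists>T>0. \<exists>u. integral_solution \<theta> f \<phi> T u)"

end

theory Submission
  imports Defs "HOL-Complex_Analysis.Cauchy_Integral_Formula"
begin

text \<open>
  All estimates compare the kernel with the profile \<open>t max (|x|, t\<^sup>1\<^sup>/\<^sup>\<theta>)\<close> to the power \<open>- N - \<theta>\<close>. For the upper
  bound, an \<open>m\<close>-fold finite difference of the symbol \<open>exp (- t |\<xi>|\<^sup>\<theta>)\<close> with step \<open>h = \<pi> x / |x|\<^sup>2\<close> multiplies the Fourier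
  integral at \<open>x\<close> by \<open>(-2)\<^sup>m\<close>, so the decay of the kernel is the size of the differences in \<open>L\<^sup>1\<close>. Close to the
  origin the symbol is \<open>1 + O(t |\<xi>|\<^sup>\<theta>)\<close>; away from it the symbol extends holomorphically to discs in complex lines, and
  Cauchy's inequality bounds the differences (\<open>frac_heat_kernel_le_stable_profile\<close>). Convolution with the profile is a
  semigroup up to a constant (\<open>profile_conv_comp_le\<close>) and maps uniformly locally integrable functions to
  bounded ones at the rate \<open>t\<close> to the power \<open>- N / \<theta>\<close> (\<open>profile_conv_uniformly_local_bound\<close>).

  Existence: both sets of hypotheses on \<open>r\<close> give \<open>f' F \<le> r + 1\<close> near infinity, which says that \<open>F\<^sup>-\<^sup>r\<close> is convex there.
  The supersolution is a multiple of the convolution \<open>W t\<close> of the datum, shifted by a large constant, with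
  the profile. Jensen's inequality bounds \<open>F (W t)\<^sup>-\<^sup>r\<close> by the convolution of a uniformly locally integrable
  function, hence by a multiple of \<open>t\<close> to the power \<open>- N / \<theta>\<close>. As \<open>f u\<close> is at most a multiple of
  \<open>u / F u\<close>, the reaction acts on \<open>W t\<close> as a linear potential of size \<open>t\<close> to the power \<open>- N / (r \<theta>)\<close>, which is integrable
  in time for \<open>r > N / \<theta>\<close>. For a short time the Duhamel integral is therefore at most half of the
  supersolution, and a monotone iteration gives the solution (\<open>solution_below_supersolution\<close>).

  Nonexistence: for \<open>\<theta> < \<alpha> < N / r\<close> the datum with \<open>F (\<phi> x) = |x|\<^sup>\<alpha>\<close> near the origin is admissible. Up to
  the diffusive time \<open>R\<^sup>\<theta>\<close> of a ball of radius \<open>R\<close> the kernel keeps a fixed part of its mass in the ball. There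
  the solution is at least a multiple of the value of the datum at distance \<open>R\<close>, and then the reaction
  doubles it again and again within a total time of order \<open>R\<^sup>\<alpha>\<close>, much shorter than the diffusive time
  (\<open>integral_solution_blow_up\<close>).
\<close>



section \<open>Integrals of powers of the norm\<close>

lemma nn_integral_norm_powr_shell:
  fixes a R :: real
  assumes "0 < R"
  shows "(\<integral>\<^sup>+x\<in>{x::'a::euclidean_space. R \<le> norm x \<and> norm x < 2 * R}. ennreal (norm x powr a) \<partial>lborel)
    \<le> ennreal (2 powr \<bar>a\<bar> * unit_ball_vol DIM('a) * 2 ^ DIM('a) * R powr (DIM('a) + a))"
proof -
  have bound: "norm x powr a \<le> 2 powr \<bar>a\<bar> * R powr a" if "R \<le> norm x" "norm x < 2 * R" for x :: 'a
  proof (cases "0 \<le> a")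
    case True
    then have "norm x powr a \<le> (2 * R) powr a" using that assms by (intro powr_mono2) auto
    then show ?thesis using True assms by (simp add: powr_mult)
  next
    case False
    then have "norm x powr a \<le> R powr a" using that assms by (intro powr_mono2') auto
    also have "\<dots> \<le> 2 powr \<bar>a\<bar> * R powr a"
      using mult_right_mono[OF ge_one_powr_ge_zero[of 2 "\<bar>a\<bar>"], of "R powr a"] by simp
    finally show ?thesis .
  qed
  have "(\<integral>\<^sup>+x\<in>{x::'a. R \<le> norm x \<and> norm x < 2 * R}. ennreal (norm x powr a) \<partial>lborel)
      \<le> (\<integral>\<^sup>+x. ennreal (2 powr \<bar>a\<bar> * R powr a) * indicator (ball 0 (2 * R)) (x::'a) \<partial>lborel)"
    by (intro nn_integral_mono) (auto simp: indicator_def bound intro!: ennreal_leI)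
  also have "\<dots> = ennreal (2 powr \<bar>a\<bar> * R powr a) * ennreal (unit_ball_vol DIM('a) * (2 * R) ^ DIM('a))"
    using assms by (simp add: nn_integral_cmult_indicator emeasure_ball)
  also have "\<dots> = ennreal (2 powr \<bar>a\<bar> * unit_ball_vol DIM('a) * 2 ^ DIM('a) * R powr (DIM('a) + a))"
    using assms by (simp add: ennreal_mult' [symmetric] powr_add powr_realpow power_mult_distrib mult_ac)
  finally show ?thesis .
qed

lemma nn_integral_UN_le:
  fixes S :: "nat \<Rightarrow> 'a set" and g :: "'a \<Rightarrow> ennreal"
  assumes [measurable]: "g \<in> borel_measurable M" "\<And>k. S k \<in> sets M" and "A \<subseteq> (\<Union>k. S k)"
  shows "(\<integral>\<^sup>+x\<in>A. g x \<partial>M) \<le> (\<Sum>k. \<integral>\<^sup>+x\<in>S k. g x \<partial>M)"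
proof -
  have "g x * indicator A x \<le> (\<Sum>k. g x * indicator (S k) x)" for x
  proof (cases "x \<in> A")
    case True
    then obtain k where "x \<in> S k" using assms(3) by auto
    then have "g x * indicator A x = (\<Sum>j\<in>{k}. g x * indicator (S j) x)" using True by simp
    also have "\<dots> \<le> (\<Sum>k. g x * indicator (S k) x)" by (intro sum_le_suminf) auto
    finally show ?thesis .
  qed simp
  then have "(\<integral>\<^sup>+x\<in>A. g x \<partial>M) \<le> (\<integral>\<^sup>+x. (\<Sum>k. g x * indicator (S k) x) \<partial>M)"
    by (intro nn_integral_mono)
  also have "\<dots> = (\<Sum>k. \<integral>\<^sup>+x\<in>S k. g x \<partial>M)" by (intro nn_integral_suminf) measurable
  finally show ?thesis .
qed

text \<open>
  On dyadic shells the integrals form a geometric series. The ratio \<open>b = 2\<close> serves the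
  complement of a ball and \<open>b = 1/2\<close> a punctured ball.
\<close>

lemma nn_integral_norm_powr_shells:
  fixes a b R :: real
  assumes "0 < R" "0 < b" and b: "b powr (DIM('a) + a) < 1"
    and sub: "A \<subseteq> (\<Union>k::nat. {x::'a::euclidean_space. R * b ^ k \<le> norm x \<and> norm x < 2 * (R * b ^ k)})"
  shows "(\<integral>\<^sup>+x\<in>A. ennreal (norm x powr a) \<partial>lborel)
    \<le> ennreal (2 powr \<bar>a\<bar> * unit_ball_vol DIM('a) * 2 ^ DIM('a) / (1 - b powr (DIM('a) + a)) * R powr (DIM('a) + a))"
proof -
  let ?c = "2 powr \<bar>a\<bar> * unit_ball_vol DIM('a) * 2 ^ DIM('a)"
  let ?e = "DIM('a) + a"
  have "(\<integral>\<^sup>+x\<in>A. ennreal (norm x powr a) \<partial>lborel)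
      \<le> (\<Sum>k. \<integral>\<^sup>+x\<in>{x::'a. R * b ^ k \<le> norm x \<and> norm x < 2 * (R * b ^ k)}. ennreal (norm x powr a) \<partial>lborel)"
    by (rule nn_integral_UN_le[OF _ _ sub]) measurable
  also have "\<dots> \<le> (\<Sum>k. ennreal (?c * (R * b ^ k) powr ?e))"
    by (intro suminf_le allI nn_integral_norm_powr_shell) (use assms in auto)
  also have "\<dots> = (\<Sum>k. ennreal (?c * R powr ?e * (b powr ?e) ^ k))"
    using assms by (simp add: powr_mult powr_powr powr_realpow[symmetric] mult_ac)
  also have "\<dots> = ennreal (\<Sum>k. ?c * R powr ?e * (b powr ?e) ^ k)"
    by (intro suminf_ennreal2) (use assms in \<open>auto intro!: summable_mult summable_geometric\<close>)
  also have "(\<Sum>k. ?c * R powr ?e * (b powr ?e) ^ k) = ?c * R powr ?e * (1 / (1 - b powr ?e))"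
    using assms by (subst suminf_mult) (auto intro!: summable_geometric simp: suminf_geometric)
  finally show ?thesis by (simp add: mult_ac)
qed

lemma nn_integral_norm_powr_outside_ball:
  fixes a :: real
  assumes "a < - real DIM('a::euclidean_space)"
  obtains C where "0 \<le> C"
    "\<And>R. 0 < R \<Longrightarrow> (\<integral>\<^sup>+x\<in>{x::'a. R \<le> norm x}. ennreal (norm x powr a) \<partial>lborel) \<le> ennreal (C * R powr (DIM('a) + a))"
proof
  let ?e = "DIM('a) + a"
  let ?C = "2 powr \<bar>a\<bar> * unit_ball_vol DIM('a) * 2 ^ DIM('a) / (1 - 2 powr ?e)"
  have b: "2 powr ?e < 1" using assms by (simp add: powr_less_one)
  then show "0 \<le> ?C" by (auto intro!: divide_nonneg_pos mult_nonneg_nonneg)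
  fix R :: real assume R: "0 < R"
  have "\<exists>k::nat. R * 2 ^ k \<le> norm x \<and> norm x < 2 * (R * 2 ^ k)" if "R \<le> norm x" for x :: 'a
  proof -
    let ?k = "nat \<lfloor>log 2 (norm x / R)\<rfloor>"
    have q: "1 \<le> norm x / R" using that R by simp
    have k: "real ?k \<le> log 2 (norm x / R)" "log 2 (norm x / R) < real ?k + 1" using q by auto
    have "2 powr real ?k \<le> norm x / R" "norm x / R < 2 powr (real ?k + 1)"
      using k q by (auto simp: powr_le_iff less_powr_iff)
    then show ?thesis using R by (intro exI[of _ ?k]) (auto simp: powr_realpow powr_add field_simps)
  qed
  then show "(\<integral>\<^sup>+x\<in>{x::'a. R \<le> norm x}. ennreal (norm x powr a) \<partial>lborel) \<le> ennreal (?C * R powr ?e)"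
    by (intro nn_integral_norm_powr_shells[OF R _ b]) auto
qed

lemma nn_integral_norm_powr_ball:
  fixes a :: real
  assumes "- real DIM('a::euclidean_space) < a"
  obtains C where "0 \<le> C"
    "\<And>R. 0 < R \<Longrightarrow> (\<integral>\<^sup>+x\<in>{x::'a. x \<noteq> 0 \<and> norm x < R}. ennreal (norm x powr a) \<partial>lborel) \<le> ennreal (C * R powr (DIM('a) + a))"
proof
  let ?e = "DIM('a) + a"
  let ?C = "2 powr \<bar>a\<bar> * unit_ball_vol DIM('a) * 2 ^ DIM('a) / (1 - (1/2) powr ?e) * (1/2) powr ?e"
  have b: "(1/2) powr ?e < 1"
    using assms powr_less_mono'[of "1/2" 0 ?e] by simp
  then show "0 \<le> ?C" by (auto intro!: divide_nonneg_pos mult_nonneg_nonneg)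
  fix R :: real assume R: "0 < R"
  have "\<exists>k::nat. R/2 * (1/2) ^ k \<le> norm x \<and> norm x < 2 * (R/2 * (1/2) ^ k)" if "norm x < R" "x \<noteq> 0" for x :: 'a
  proof -
    let ?k = "nat \<lceil>log 2 (R / norm x)\<rceil> - 1"
    have q: "1 < R / norm x" using that R by simp
    have "0 < log 2 (R / norm x)" using q by simp
    then have k: "real ?k < log 2 (R / norm x)" "log 2 (R / norm x) \<le> real ?k + 1"
      by linarith+
    have "2 powr real ?k < R / norm x" "R / norm x \<le> 2 powr (real ?k + 1)"
      using k q by (auto simp: powr_less_iff le_powr_iff)
    then show ?thesis using R that by (intro exI[of _ ?k]) (auto simp: powr_realpow powr_add field_simps)
  qed
  then have "(\<integral>\<^sup>+x\<in>{x::'a. x \<noteq> 0 \<and> norm x < R}. ennreal (norm x powr a) \<partial>lborel)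
    \<le> ennreal (2 powr \<bar>a\<bar> * unit_ball_vol DIM('a) * 2 ^ DIM('a) / (1 - (1/2) powr ?e) * (R/2) powr ?e)"
    by (intro nn_integral_norm_powr_shells[OF _ _ b]) (use R in auto)
  then show "(\<integral>\<^sup>+x\<in>{x::'a. x \<noteq> 0 \<and> norm x < R}. ennreal (norm x powr a) \<partial>lborel) \<le> ennreal (?C * R powr ?e)"
    using R by (simp add: powr_mult[of _ "1/2", symmetric] mult.assoc mult.commute[of "(1/2) powr ?e"])
qed

lemma nn_integral_inside_outside_bound:
  fixes e :: real
  assumes "e < - real DIM('a::euclidean_space)"
  obtains C where "0 \<le> C" "\<And>(g :: 'a \<Rightarrow> real) a b R. 0 < R \<Longrightarrow> 0 \<le> a \<Longrightarrow> 0 \<le> b \<Longrightarrow>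
    \<forall>x. norm x < R \<longrightarrow> g x \<le> a \<Longrightarrow> \<forall>x. R \<le> norm x \<longrightarrow> g x \<le> b * norm x powr e \<Longrightarrow>
    (\<integral>\<^sup>+x. ennreal (g x) \<partial>lborel) \<le> ennreal (a * (unit_ball_vol DIM('a) * R ^ DIM('a)) + b * (C * R powr (DIM('a) + e)))"
proof -
  let ?n = "DIM('a)"
  obtain C where C: "0 \<le> C" "\<And>R. 0 < R \<Longrightarrow> (\<integral>\<^sup>+x\<in>{x::'a. R \<le> norm x}. ennreal (norm x powr e) \<partial>lborel) \<le> ennreal (C * R powr (?n + e))"
    by (rule nn_integral_norm_powr_outside_ball[OF assms], rule that)
  show ?thesis
  proof (rule that[OF C(1)])
    fix g :: "'a \<Rightarrow> real" and a b R :: real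
    assume R: "0 < R" and a: "0 \<le> a" and b: "0 \<le> b"
      and g: "\<forall>x. norm x < R \<longrightarrow> g x \<le> a" "\<forall>x. R \<le> norm x \<longrightarrow> g x \<le> b * norm x powr e"
    let ?P = "\<lambda>x::'a. ennreal (norm x powr e) * indicator {x. R \<le> norm x} x"
    have P: "?P \<in> borel_measurable lborel" by measurable
    have B: "(\<lambda>x. ennreal a * indicator (ball (0::'a) R) x) \<in> borel_measurable lborel"
      by (intro borel_measurable_times_ennreal borel_measurable_const borel_measurable_indicator) simp
    have "(\<integral>\<^sup>+x. ennreal (g x) \<partial>lborel) \<le> (\<integral>\<^sup>+x. ennreal a * indicator (ball 0 R) x + ennreal b * ?P x \<partial>lborel)"
    proof (rule nn_integral_mono)
      fix x
      show "ennreal (g x) \<le> ennreal a * indicator (ball 0 R) x + ennreal b * ?P x"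
      proof (cases "R \<le> norm x")
        case True
        have "ennreal (g x) \<le> ennreal (b * norm x powr e)" using g(2) True by (intro ennreal_leI) simp
        also have "\<dots> = ennreal b * ennreal (norm x powr e)" by (rule ennreal_mult'[OF b])
        finally show ?thesis using True by simp
      next
        case False
        then show ?thesis using g(1) by (simp add: ennreal_leI)
      qed
    qed
    also have "\<dots> = (\<integral>\<^sup>+x. ennreal a * indicator (ball (0::'a) R) x \<partial>lborel) + (\<integral>\<^sup>+x. ennreal b * ?P x \<partial>lborel)"
      by (rule nn_integral_add[OF B borel_measurable_times_ennreal[OF borel_measurable_const P]])
    also have "(\<integral>\<^sup>+x. ennreal a * indicator (ball (0::'a) R) x \<partial>lborel) = ennreal (a * (unit_ball_vol ?n * R ^ ?n))"
      using R a by (simp add: nn_integral_cmult_indicator emeasure_ball ennreal_mult')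
    also have "(\<integral>\<^sup>+x. ennreal b * ?P x \<partial>lborel) = ennreal b * (\<integral>\<^sup>+x. ?P x \<partial>lborel)"
      by (rule nn_integral_cmult[OF P])
    also have "ennreal (a * (unit_ball_vol ?n * R ^ ?n)) + \<dots> \<le> ennreal (a * (unit_ball_vol ?n * R ^ ?n)) + ennreal b * ennreal (C * R powr (?n + e))"
      by (rule add_left_mono[OF mult_left_mono[OF C(2)[OF R] zero_le]])
    also have "\<dots> = ennreal (a * (unit_ball_vol ?n * R ^ ?n) + b * (C * R powr (?n + e)))"
      using a b C(1) R by (subst ennreal_plus) (simp_all add: ennreal_mult')
    finally show "(\<integral>\<^sup>+x. ennreal (g x) \<partial>lborel) \<le> ennreal (a * (unit_ball_vol ?n * R ^ ?n) + b * (C * R powr (?n + e)))" .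
  qed
qed

lemma lborel_eq_distr_reflect: "(lborel :: 'a::euclidean_space measure) = distr lborel borel (\<lambda>y. x - y)"
  using lborel_affine[of "-1" x] by (simp add: density_1)

lemma nn_integral_lborel_reflect:
  fixes f :: "'a::euclidean_space \<Rightarrow> ennreal"
  assumes [measurable]: "f \<in> borel_measurable borel"
  shows "(\<integral>\<^sup>+y. f (x - y) \<partial>lborel) = (\<integral>\<^sup>+y. f y \<partial>lborel)"
  by (subst (2) lborel_eq_distr_reflect[of x], subst nn_integral_distr) auto


section \<open>Finite differences of the symbol of the fractional Laplacian\<close>

definition fdiff :: "'a::plus \<Rightarrow> ('a \<Rightarrow> 'b::minus) \<Rightarrow> 'a \<Rightarrow> 'b" where
  "fdiff h \<Psi> \<xi> = \<Psi> (\<xi> + h) - \<Psi> \<xi>"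

definition stable_symbol :: "real \<Rightarrow> real \<Rightarrow> 'a::real_normed_vector \<Rightarrow> real" where
  "stable_symbol \<theta> t \<xi> = exp (- (t * norm \<xi> powr \<theta>))"

lemma fdiff_iterate_Suc: "(fdiff h ^^ Suc m) \<Psi> \<xi> = (fdiff h ^^ m) \<Psi> (\<xi> + h) - (fdiff h ^^ m) \<Psi> \<xi>"
  by (simp add: fdiff_def)

lemma fdiff_iterate_bound:
  fixes \<Psi> :: "'a::real_vector \<Rightarrow> real"
  assumes "\<And>j. j \<le> m \<Longrightarrow> \<bar>\<Psi> (\<xi> + real j *\<^sub>R h)\<bar> \<le> M"
  shows "\<bar>(fdiff h ^^ m) \<Psi> \<xi>\<bar> \<le> 2 ^ m * M"
  using assms
proof (induction m arbitrary: \<xi>)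
  case 0
  then show ?case using "0"[of 0] by simp
next
  case (Suc m)
  have 1: "\<bar>(fdiff h ^^ m) \<Psi> \<xi>\<bar> \<le> 2 ^ m * M" by (rule Suc.IH) (simp add: Suc.prems)
  have 2: "\<bar>(fdiff h ^^ m) \<Psi> (\<xi> + h)\<bar> \<le> 2 ^ m * M"
  proof (rule Suc.IH)
    fix j assume "j \<le> m"
    then show "\<bar>\<Psi> (\<xi> + h + real j *\<^sub>R h)\<bar> \<le> M"
      using Suc.prems[of "Suc j"] by (simp add: scaleR_left_distrib add_ac)
  qed
  show ?case unfolding fdiff_iterate_Suc using 1 2 by simp
qed

text \<open>
  Differences along the real line \<open>\<xi> + s h\<close> are unit differences of a function of \<open>s\<close>, to which
  complex analysis applies.
\<close>

lemma fdiff_iterate_of_real: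
  fixes W :: "complex \<Rightarrow> complex" and \<Psi> :: "'a::real_vector \<Rightarrow> real"
  assumes "\<And>s::nat. s \<le> m + k \<Longrightarrow> W (of_nat s) = of_real (\<Psi> (\<xi> + real s *\<^sub>R h))"
  shows "(fdiff 1 ^^ m) W (of_nat k) = of_real ((fdiff h ^^ m) \<Psi> (\<xi> + real k *\<^sub>R h))"
  using assms
proof (induction m arbitrary: k)
  case 0
  then show ?case by simp
next
  case (Suc m)
  have 1: "(fdiff 1 ^^ m) W (of_nat k) = of_real ((fdiff h ^^ m) \<Psi> (\<xi> + real k *\<^sub>R h))"
    by (rule Suc.IH) (simp add: Suc.prems)
  have 2: "(fdiff 1 ^^ m) W (of_nat (Suc k)) = of_real ((fdiff h ^^ m) \<Psi> (\<xi> + real (Suc k) *\<^sub>R h))"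
    by (rule Suc.IH) (simp add: Suc.prems)
  show ?case unfolding fdiff_iterate_Suc using 1 2 by (simp add: scaleR_left_distrib add_ac)
qed

text \<open>
  A unit difference is controlled by the derivative, which Cauchy's inequality bounds by \<open>1 / \<rho>\<close> times
  the supremum. Each difference therefore shrinks the disc by \<open>1 + \<rho>\<close> and gains a factor \<open>1 / \<rho>\<close>.
\<close>

lemma fdiff_iterate_holomorphic_bound:
  fixes W :: "complex \<Rightarrow> complex"
  assumes "W holomorphic_on ball c R" "\<And>s. s \<in> ball c R \<Longrightarrow> norm (W s) \<le> M"
    and "0 < \<rho>" "real m * (1 + \<rho>) < R"
  shows "norm ((fdiff 1 ^^ m) W c) \<le> M / \<rho> ^ m"
  using assms
proof (induction m arbitrary: W M R)
  case 0
  then show ?case by simp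
next
  case (Suc m)
  have der: "norm (deriv W w) \<le> M / \<rho>" if w: "w \<in> ball c (R - \<rho>)" for w
  proof -
    have sub: "cball w \<rho> \<subseteq> ball c R"
    proof
      fix z assume "z \<in> cball w \<rho>"
      then show "z \<in> ball c R" using w dist_triangle[of c z w] by simp
    qed
    have "norm ((deriv ^^ 1) W w) \<le> fact 1 * M / \<rho> ^ 1"
    proof (rule Cauchy_inequality)
      show "W holomorphic_on ball w \<rho>"
        using Suc.prems(1) sub ball_subset_cball holomorphic_on_subset by blast
      show "continuous_on (cball w \<rho>) W"
        using Suc.prems(1) sub holomorphic_on_subset holomorphic_on_imp_continuous_on by blast
      show "norm (W x) \<le> M" if "norm (w - x) = \<rho>" for x
        using that sub Suc.prems(2) by (auto simp: dist_norm)
    qed (use Suc.prems in auto)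
    then show ?thesis by simp
  qed
  have inball: "s \<in> ball c (R - \<rho>)" "s + 1 \<in> ball c (R - \<rho>)" if "s \<in> ball c (R - 1 - \<rho>)" for s
  proof -
    have "dist c (s + 1) \<le> dist c s + 1"
      using dist_triangle[of c "s + 1" s] by (simp add: dist_norm norm_minus_commute)
    then show "s \<in> ball c (R - \<rho>)" "s + 1 \<in> ball c (R - \<rho>)" using that by auto
  qed
  have "norm (fdiff 1 W s) \<le> M / \<rho>" if s: "s \<in> ball c (R - 1 - \<rho>)" for s
  proof -
    have "norm (W (s + 1) - W s) \<le> M / \<rho> * norm (s + 1 - s)"
    proof (rule field_differentiable_bound[of "ball c (R - \<rho>)" W "deriv W"])
      show "(W has_field_derivative deriv W z) (at z within ball c (R - \<rho>))" if "z \<in> ball c (R - \<rho>)" for z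
      proof -
        have "z \<in> ball c R" using that Suc.prems(3) by auto
        then have "(W has_field_derivative deriv W z) (at z)"
          using Suc.prems(1) holomorphic_derivI open_ball by blast
        then show ?thesis by (rule has_field_derivative_at_within)
      qed
    qed (use inball[OF s] der in auto)
    then show ?thesis by (simp add: fdiff_def)
  qed
  moreover have "fdiff 1 W holomorphic_on ball c (R - 1 - \<rho>)"
  proof -
    have a: "(\<lambda>s. W (s + 1)) holomorphic_on ball c (R - 1 - \<rho>)"
    proof (rule holomorphic_on_compose_gen[of "\<lambda>s. s + 1" _ W "ball c R", unfolded o_def])
      show "(\<lambda>s. s + 1) ` ball c (R - 1 - \<rho>) \<subseteq> ball c R"
        using inball(2) Suc.prems(3) by fastforce
    qed (auto intro!: holomorphic_intros Suc.prems)
    have "W holomorphic_on ball c (R - 1 - \<rho>)"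
      using Suc.prems(1) by (rule holomorphic_on_subset) (use Suc.prems(3) in auto)
    with a show ?thesis unfolding fdiff_def[abs_def] by (intro holomorphic_intros)
  qed
  moreover have "real m * (1 + \<rho>) < R - 1 - \<rho>" using Suc.prems(4) by (simp add: algebra_simps)
  ultimately have "norm ((fdiff 1 ^^ m) (fdiff 1 W) c) \<le> M / \<rho> / \<rho> ^ m"
    using Suc.prems(3) by (intro Suc.IH) auto
  then show ?case by (simp add: funpow_swap1 mult.commute)
qed

lemma norm_exp_uminus_minus_one_le:
  fixes z :: complex
  assumes "0 \<le> Re z"
  shows "norm (exp (- z) - 1) \<le> norm z"
proof -
  have "norm (exp (- z) - exp (- 0)) \<le> 1 * norm (z - 0)"
  proof (rule field_differentiable_bound[of "{w. 0 \<le> Re w}" "\<lambda>w. exp (- w)" "\<lambda>w. - exp (- w)"])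
    show "convex {w. 0 \<le> Re w}" by (rule convex_halfspace_Re_ge)
  qed (use assms in \<open>auto intro!: derivative_eq_intros\<close>)
  then show ?thesis by simp
qed

lemma Re_powr_nonneg:
  fixes z :: complex
  assumes "0 < Re z" "0 \<le> a" "a \<le> 1"
  shows "0 \<le> Re (z powr of_real a)"
proof -
  have "\<bar>Im (Ln z)\<bar> < pi / 2" using assms(1) by (rule Re_Ln_pos_lt_imp)
  moreover have "\<bar>a * Im (Ln z)\<bar> \<le> 1 * \<bar>Im (Ln z)\<bar>"
    unfolding abs_mult using assms by (intro mult_right_mono) auto
  ultimately have "0 \<le> cos (a * Im (Ln z))" by (intro cos_ge_zero) linarith+
  then show ?thesis using assms by (auto simp: powr_def Re_exp)
qed

text \<open>
  Along the line through \<open>\<xi>\<close> in direction \<open>h\<close> the squared norm is a quadratic polynomial. On the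
  complex disc of radius \<open>|\<xi>| / (8 |h|)\<close> it stays in the right half plane and comparable to
  \<open>|\<xi>|\<^sup>2\<close>. As \<open>\<theta> / 2 \<le> 1\<close>, its power \<open>\<theta> / 2\<close> has nonnegative real part, so the symbol extends
  holomorphically to this disc and differs from \<open>1\<close> by at most a multiple of \<open>t |\<xi>|\<close> to the power \<open>\<theta>\<close>.
\<close>

lemma fdiff_stable_symbol_far:
  fixes \<xi> h :: "'a::euclidean_space"
  assumes "0 < \<theta>" "\<theta> \<le> 2" "0 \<le> t" "h \<noteq> 0" "0 < m" and far: "20 * real m * norm h \<le> norm \<xi>"
  shows "\<bar>(fdiff h ^^ m) (\<lambda>\<xi>. stable_symbol \<theta> t \<xi> - 1) \<xi>\<bar>
    \<le> 2 * t * norm \<xi> powr \<theta> * (20 * real m * norm h / norm \<xi>) ^ m"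
proof -
  define R where "R = norm \<xi> / (8 * norm h)"
  have \<xi>: "\<xi> \<noteq> 0" using assms by (auto simp: mult_le_0_iff)
  have h: "0 < norm h" and \<xi>0: "0 < norm \<xi>" using assms \<xi> by auto
  have R: "5 / 2 * real m \<le> R" using far h by (simp add: R_def field_simps)
  define q where "q s = of_real (norm \<xi> ^ 2) + 2 * of_real (\<xi> \<bullet> h) * s + of_real (norm h ^ 2) * s ^ 2" for s :: complex
  define W where "W s = exp (- (of_real t * q s powr of_real (\<theta> / 2))) - 1" for s
  have q: "norm (q s - of_real (norm \<xi> ^ 2)) \<le> norm \<xi> ^ 2 / 2" if "s \<in> ball 0 R" for s
  proof -
    have s: "norm s * norm h \<le> norm \<xi> / 8" using that h by (simp add: R_def field_simps)
    have "norm (q s - of_real (norm \<xi> ^ 2)) \<le> norm (2 * of_real (\<xi> \<bullet> h) * s) + norm (of_real (norm h ^ 2) * s ^ 2)"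
      unfolding q_def by (metis add.assoc add_diff_cancel_left' norm_triangle_ineq)
    also have "\<dots> = 2 * \<bar>\<xi> \<bullet> h\<bar> * norm s + (norm s * norm h) ^ 2"
      by (simp add: norm_mult norm_power power_mult_distrib)
    also have "\<dots> \<le> 2 * (norm \<xi> * norm h) * norm s + (norm \<xi> / 8) ^ 2"
      using s by (intro add_mono mult_right_mono mult_left_mono power_mono Cauchy_Schwarz_ineq2) auto
    also have "2 * (norm \<xi> * norm h) * norm s \<le> 2 * norm \<xi> * (norm \<xi> / 8)"
      using mult_left_mono[OF s, of "2 * norm \<xi>"] by (simp add: mult_ac)
    also have "2 * norm \<xi> * (norm \<xi> / 8) + (norm \<xi> / 8) ^ 2 \<le> norm \<xi> ^ 2 / 2"
      by (simp add: power2_eq_square)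
    finally show ?thesis by simp
  qed
  have Req: "0 < Re (q s)" and nq: "norm (q s) \<le> 2 * norm \<xi> ^ 2" if "s \<in> ball 0 R" for s
  proof -
    have "\<bar>Re (q s - of_real (norm \<xi> ^ 2))\<bar> \<le> norm \<xi> ^ 2 / 2" using abs_Re_le_cmod q[OF that] order_trans by blast
    then have "\<bar>Re (q s) - norm \<xi> ^ 2\<bar> \<le> norm \<xi> ^ 2 / 2" by simp
    moreover have "0 < norm \<xi> ^ 2" using \<xi>0 by simp
    ultimately show "0 < Re (q s)" by linarith
    have "norm (q s) \<le> norm (q s - of_real (norm \<xi> ^ 2)) + norm (of_real (norm \<xi> ^ 2) :: complex)"
      by (metis diff_add_cancel norm_triangle_ineq)
    then show "norm (q s) \<le> 2 * norm \<xi> ^ 2"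
      using q[OF that] zero_le_power2[of "norm \<xi>"] by (simp only: norm_of_real abs_of_nonneg)
  qed
  have hol: "W holomorphic_on ball 0 R"
    unfolding W_def
  proof (intro holomorphic_intros)
    show "q holomorphic_on ball 0 R" unfolding q_def by (intro holomorphic_intros)
    show "q s \<notin> \<real>\<^sub>\<le>\<^sub>0" if "s \<in> ball 0 R" for s using Req[OF that] by (auto simp: complex_nonpos_Reals_iff)
  qed
  have Wb: "norm (W s) \<le> 2 * t * norm \<xi> powr \<theta>" if s: "s \<in> ball 0 R" for s
  proof -
    have "0 \<le> Re (of_real t * q s powr of_real (\<theta> / 2))"
      using Re_powr_nonneg[OF Req[OF s], of "\<theta> / 2"] assms by simp
    then have "norm (W s) \<le> norm (of_real t * q s powr of_real (\<theta> / 2))"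
      unfolding W_def by (rule norm_exp_uminus_minus_one_le)
    also have "\<dots> = t * norm (q s) powr (\<theta> / 2)" using assms by (simp add: norm_mult norm_powr_real_powr')
    also have "\<dots> \<le> t * (2 * norm \<xi> ^ 2) powr (\<theta> / 2)"
      using assms nq[OF s] by (intro mult_left_mono powr_mono2) auto
    also have "(2 * norm \<xi> ^ 2) powr (\<theta> / 2) = 2 powr (\<theta> / 2) * norm \<xi> powr \<theta>"
      using \<xi>0 by (simp add: powr_mult powr_powr flip: powr_numeral)
    also have "t * (2 powr (\<theta> / 2) * norm \<xi> powr \<theta>) \<le> t * (2 * norm \<xi> powr \<theta>)"
      using assms powr_mono[of "\<theta> / 2" 1 2] by (intro mult_left_mono mult_right_mono) auto
    finally show ?thesis by (simp add: mult_ac)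
  qed
  have Wreal: "W (of_nat j) = of_real (stable_symbol \<theta> t (\<xi> + real j *\<^sub>R h) - 1)" for j
  proof -
    have "q (of_nat j) = of_real (norm (\<xi> + real j *\<^sub>R h) ^ 2)"
    proof -
      have "norm (\<xi> + real j *\<^sub>R h) ^ 2 = norm \<xi> ^ 2 + 2 * (\<xi> \<bullet> h) * real j + norm h ^ 2 * real j ^ 2"
        unfolding power2_norm_eq_inner by (simp add: inner_simps inner_commute power2_eq_square algebra_simps)
      then show ?thesis unfolding q_def by simp
    qed
    then have "q (of_nat j) powr of_real (\<theta> / 2) = of_real ((norm (\<xi> + real j *\<^sub>R h) ^ 2) powr (\<theta> / 2))"
      by (metis powr_of_real zero_le_power2)
    also have "(norm (\<xi> + real j *\<^sub>R h) ^ 2) powr (\<theta> / 2) = norm (\<xi> + real j *\<^sub>R h) powr \<theta>"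
      by (simp add: powr_powr flip: powr_numeral)
    finally show ?thesis by (simp add: W_def stable_symbol_def exp_of_real flip: of_real_mult of_real_minus)
  qed
  \<comment> \<open>The radius is at least \<open>5 m / 2\<close>: the \<open>m\<close> unit shifts use up to \<open>2 R / 5\<close> of it, and the Cauchy
     estimates another \<open>2 R / 5\<close>.\<close>
  have R': "real m * (1 + norm \<xi> / (20 * real m * norm h)) < R"
  proof -
    have "real m * (1 + norm \<xi> / (20 * real m * norm h)) = real m + 2 / 5 * R"
      using assms by (simp add: R_def field_simps)
    also have "\<dots> < R" using R assms by simp
    finally show ?thesis .
  qed
  have "norm ((fdiff 1 ^^ m) W (of_nat 0)) \<le> 2 * t * norm \<xi> powr \<theta> / (norm \<xi> / (20 * real m * norm h)) ^ m"
    using fdiff_iterate_holomorphic_bound[OF hol Wb _ R'] assms \<xi>0 by simp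
  also have "(fdiff 1 ^^ m) W (of_nat 0)
      = of_real ((fdiff h ^^ m) (\<lambda>\<xi>. stable_symbol \<theta> t \<xi> - 1) (\<xi> + real 0 *\<^sub>R h))"
    by (rule fdiff_iterate_of_real) (simp add: Wreal)
  finally show ?thesis by (simp add: power_divide)
qed

lemma fdiff_stable_symbol_near:
  fixes \<xi> h :: "'a::euclidean_space"
  assumes "0 < \<theta>" "0 \<le> t" and near: "norm \<xi> < 20 * real m * norm h"
  shows "\<bar>(fdiff h ^^ m) (\<lambda>\<xi>. stable_symbol \<theta> t \<xi> - 1) \<xi>\<bar> \<le> 2 ^ m * (t * (21 * real m * norm h) powr \<theta>)"
proof (rule fdiff_iterate_bound)
  fix j assume j: "j \<le> m"
  let ?\<eta> = "\<xi> + real j *\<^sub>R h"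
  have "norm ?\<eta> \<le> norm \<xi> + real j * norm h" by (metis norm_triangle_ineq norm_scaleR abs_of_nat)
  also have "real j * norm h \<le> real m * norm h" using j by (intro mult_right_mono) auto
  finally have "norm ?\<eta> \<le> 21 * real m * norm h" using near by linarith
  then have "norm ?\<eta> powr \<theta> \<le> (21 * real m * norm h) powr \<theta>" using assms by (intro powr_mono2) auto
  then have *: "t * norm ?\<eta> powr \<theta> \<le> t * (21 * real m * norm h) powr \<theta>" using assms by (intro mult_left_mono)
  have "1 + - (t * norm ?\<eta> powr \<theta>) \<le> stable_symbol \<theta> t ?\<eta>" unfolding stable_symbol_def by (rule exp_ge_add_one_self)
  moreover have "stable_symbol \<theta> t ?\<eta> \<le> 1" using assms by (simp add: stable_symbol_def)
  ultimately show "\<bar>stable_symbol \<theta> t ?\<eta> - 1\<bar> \<le> t * (21 * real m * norm h) powr \<theta>" using * by linarith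
qed

text \<open>
  Near the origin the integrand is at most a multiple of \<open>t |h|\<close>\<open>\<^sup>\<theta>\<close> on a ball of radius proportional
  to \<open>|h|\<close>. Away from it, the integral of \<open>|h|\<^sup>m\<close> times \<open>|\<xi>|\<close> to the power \<open>\<theta> - m\<close> converges at infinity
  because \<open>m\<close> exceeds the dimension plus \<open>\<theta>\<close>, and has the same size.
\<close>

lemma nn_integral_fdiff_stable_symbol:
  fixes \<theta> :: real
  assumes "0 < \<theta>" "\<theta> \<le> 2" and m: "real DIM('a::euclidean_space) + \<theta> < real m"
  obtains C where "0 \<le> C" "\<And>(h::'a) t. h \<noteq> 0 \<Longrightarrow> 0 \<le> t \<Longrightarrow>
    (\<integral>\<^sup>+\<xi>. ennreal \<bar>(fdiff h ^^ m) (\<lambda>\<xi>. stable_symbol \<theta> t \<xi> - 1) \<xi>\<bar> \<partial>lborel) \<le> ennreal (C * t * norm h powr (DIM('a) + \<theta>))"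
proof -
  let ?n = "DIM('a)"
  have m0: "0 < m" using m assms by (cases m) auto
  have e: "\<theta> - real m < - real ?n" using m by simp
  obtain C where C: "0 \<le> C" and split: "\<And>(g :: 'a \<Rightarrow> real) a d R. 0 < R \<Longrightarrow> 0 \<le> a \<Longrightarrow> 0 \<le> d \<Longrightarrow>
    \<forall>x. norm x < R \<longrightarrow> g x \<le> a \<Longrightarrow> \<forall>x. R \<le> norm x \<longrightarrow> g x \<le> d * norm x powr (\<theta> - real m) \<Longrightarrow>
    (\<integral>\<^sup>+x. ennreal (g x) \<partial>lborel) \<le> ennreal (a * (unit_ball_vol ?n * R ^ ?n) + d * (C * R powr (?n + (\<theta> - real m))))"
    by (rule nn_integral_inside_outside_bound[OF e], rule that)
  \<comment> \<open>The points \<open>\<xi> + j h\<close> with \<open>|\<xi>| < B |h|\<close> and \<open>j \<le> m\<close> have norm at most \<open>A |h|\<close>.\<close>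
  define A B where "A = 21 * real m" and "B = 20 * real m"
  have AB: "0 < A" "0 < B" using m0 by (simp_all add: A_def B_def)
  let ?C1 = "2 ^ m * (A) powr \<theta> * (unit_ball_vol ?n * B ^ ?n)"
  let ?C2 = "2 * B ^ m * C * B powr (?n + (\<theta> - real m))"
  show ?thesis
  proof (rule that[of "?C1 + ?C2"])
    show "0 \<le> ?C1 + ?C2" using C AB by simp
    fix h :: 'a and t :: real assume h: "h \<noteq> 0" and t: "0 \<le> t"
    let ?f = "\<lambda>\<xi>. \<bar>(fdiff h ^^ m) (\<lambda>\<xi>. stable_symbol \<theta> t \<xi> - 1) \<xi>\<bar>"
    define R where "R = B * norm h"
    have R: "0 < R" using h AB by (simp add: R_def)
    have "(\<integral>\<^sup>+\<xi>. ennreal (?f \<xi>) \<partial>lborel) \<le> ennreal (2 ^ m * (t * (A * norm h) powr \<theta>) * (unit_ball_vol ?n * R ^ ?n)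
        + 2 * t * R ^ m * (C * R powr (?n + (\<theta> - real m))))"
    proof (rule split[OF R])
      show "0 \<le> 2 ^ m * (t * (A * norm h) powr \<theta>)" "0 \<le> 2 * t * R ^ m" using t R by simp_all
      show "\<forall>\<xi>. norm \<xi> < R \<longrightarrow> ?f \<xi> \<le> 2 ^ m * (t * (A * norm h) powr \<theta>)"
        unfolding A_def R_def B_def by (intro allI impI fdiff_stable_symbol_near assms(1) t)
      show "\<forall>\<xi>. R \<le> norm \<xi> \<longrightarrow> ?f \<xi> \<le> 2 * t * R ^ m * norm \<xi> powr (\<theta> - real m)"
      proof (intro allI impI)
        fix \<xi> :: 'a assume \<xi>: "R \<le> norm \<xi>"
        have "?f \<xi> \<le> 2 * t * norm \<xi> powr \<theta> * (R / norm \<xi>) ^ m"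
          unfolding R_def B_def
          by (rule fdiff_stable_symbol_far) (use assms h t m0 \<xi> in \<open>auto simp: R_def B_def\<close>)
        also have "\<dots> = 2 * t * R ^ m * norm \<xi> powr (\<theta> - real m)"
          by (simp add: powr_diff powr_realpow[OF less_le_trans[OF R \<xi>]] power_divide)
        finally show "?f \<xi> \<le> 2 * t * R ^ m * norm \<xi> powr (\<theta> - real m)" .
      qed
    qed
    also have "2 ^ m * (t * (A * norm h) powr \<theta>) * (unit_ball_vol ?n * R ^ ?n) = ?C1 * t * norm h powr (?n + \<theta>)"
      using h by (simp add: R_def powr_mult powr_add powr_realpow power_mult_distrib mult_ac)
    also have "2 * t * R ^ m * (C * R powr (?n + (\<theta> - real m))) = ?C2 * t * norm h powr (?n + \<theta>)"
    proof -
      have 1: "norm h powr (?n + \<theta>) = norm h ^ m * norm h powr (?n + (\<theta> - real m))"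
        using h by (simp add: powr_add [symmetric] powr_realpow [symmetric])
      have 2: "R powr (?n + (\<theta> - real m)) = B powr (?n + (\<theta> - real m)) * norm h powr (?n + (\<theta> - real m))"
        by (simp add: R_def powr_mult)
      have 3: "R ^ m = B ^ m * norm h ^ m" by (simp only: R_def power_mult_distrib)
      show ?thesis unfolding 1 2 3 by (simp only: mult_ac)
    qed
    finally show "(\<integral>\<^sup>+\<xi>. ennreal (?f \<xi>) \<partial>lborel) \<le> ennreal ((?C1 + ?C2) * t * norm h powr (?n + \<theta>))"
      by (simp only: distrib_right)
  qed
qed


section \<open>Bounds for the fractional heat kernel\<close>

lemma stable_symbol_measurable [measurable]: "stable_symbol \<theta> t \<in> borel_measurable (borel :: 'a::euclidean_space measure)"
  unfolding stable_symbol_def[abs_def] by measurable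

text \<open>
  The moments of order \<open>0\<close> and \<open>1\<close> control the size of the kernel and its variation near the origin.
  They scale in time because the symbol is concentrated on the ball of radius \<open>R = t\<close>\<open>\<^sup>-\<^sup>1\<^sup>/\<^sup>\<theta>\<close> and decays faster
  than any power outside it.
\<close>

lemma stable_symbol_moment_bound:
  fixes \<theta> b :: real
  assumes "0 < \<theta>" "0 \<le> b"
  obtains C where "0 \<le> C" "\<And>t. 0 < t \<Longrightarrow>
    (\<integral>\<^sup>+(\<xi>::'a::euclidean_space). ennreal (norm \<xi> powr b * stable_symbol \<theta> t \<xi>) \<partial>lborel) \<le> ennreal (C * t powr (- (DIM('a) + b) / \<theta>))"
proof -
  let ?n = "DIM('a)"
  obtain k :: nat where k: "(real ?n + b) / \<theta> < real k" using reals_Archimedean2 by blast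
  then have k': "b - \<theta> * k < - real ?n" using assms by (simp add: field_simps)
  obtain C where C: "0 \<le> C" and split: "\<And>(g :: 'a \<Rightarrow> real) a d R. 0 < R \<Longrightarrow> 0 \<le> a \<Longrightarrow> 0 \<le> d \<Longrightarrow>
    \<forall>x. norm x < R \<longrightarrow> g x \<le> a \<Longrightarrow> \<forall>x. R \<le> norm x \<longrightarrow> g x \<le> d * norm x powr (b - \<theta> * k) \<Longrightarrow>
    (\<integral>\<^sup>+x. ennreal (g x) \<partial>lborel) \<le> ennreal (a * (unit_ball_vol ?n * R ^ ?n) + d * (C * R powr (?n + (b - \<theta> * k))))"
    by (rule nn_integral_inside_outside_bound[OF k'], rule that)
  define K :: real where "K = fact k"
  have K: "exp (- x) \<le> K / x ^ k" if "0 < x" for x :: real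
  proof -
    have "(\<Sum>j\<in>{k}. x ^ j /\<^sub>R fact j) \<le> exp x"
      unfolding exp_def using that by (intro sum_le_suminf summable_exp_generic) auto
    then have "x ^ k / fact k \<le> exp x" by (simp add: divide_inverse mult.commute)
    then show ?thesis using that by (simp add: K_def exp_minus field_simps)
  qed
  show ?thesis
  proof (rule that[of "unit_ball_vol ?n + K * C"])
    show "0 \<le> unit_ball_vol ?n + K * C" using C by (simp add: K_def)
    fix t :: real assume t: "0 < t"
    define R where "R = t powr (- 1 / \<theta>)"
    have R: "0 < R" using t by (simp add: R_def)
    have tR: "t = R powr (- \<theta>)" using t assms by (simp add: R_def powr_powr)
    have "(\<integral>\<^sup>+(\<xi>::'a). ennreal (norm \<xi> powr b * stable_symbol \<theta> t \<xi>) \<partial>lborel)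
      \<le> ennreal (R powr b * (unit_ball_vol ?n * R ^ ?n) + K / t ^ k * (C * R powr (?n + (b - \<theta> * k))))"
    proof (rule split[OF R])
      show "0 \<le> R powr b" "0 \<le> K / t ^ k" using t by (simp_all add: K_def)
      show "\<forall>\<xi>::'a. norm \<xi> < R \<longrightarrow> norm \<xi> powr b * stable_symbol \<theta> t \<xi> \<le> R powr b"
      proof (intro allI impI)
        fix \<xi> :: 'a assume "norm \<xi> < R"
        then have "norm \<xi> powr b * stable_symbol \<theta> t \<xi> \<le> R powr b * 1"
          using t assms R by (intro mult_mono powr_mono2) (auto simp: stable_symbol_def)
        then show "norm \<xi> powr b * stable_symbol \<theta> t \<xi> \<le> R powr b" by simp
      qed
      show "\<forall>\<xi>::'a. R \<le> norm \<xi> \<longrightarrow> norm \<xi> powr b * stable_symbol \<theta> t \<xi> \<le> K / t ^ k * norm \<xi> powr (b - \<theta> * k)"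
      proof (intro allI impI)
        fix \<xi> :: 'a assume "R \<le> norm \<xi>"
        then have n: "0 < norm \<xi>" using R by linarith
        have "stable_symbol \<theta> t \<xi> \<le> K / (t * norm \<xi> powr \<theta>) ^ k"
          unfolding stable_symbol_def by (rule K) (use t n in auto)
        then have "norm \<xi> powr b * stable_symbol \<theta> t \<xi> \<le> norm \<xi> powr b * (K / (t * norm \<xi> powr \<theta>) ^ k)"
          by (intro mult_left_mono) auto
        also have "\<dots> = K / t ^ k * norm \<xi> powr (b - \<theta> * k)"
        proof -
          have "norm \<xi> powr (\<theta> * k) = (norm \<xi> powr \<theta>) ^ k"
            using n by (simp add: powr_powr [symmetric] powr_realpow)
          then show ?thesis by (simp add: powr_diff power_mult_distrib mult_ac)
        qed
        finally show "norm \<xi> powr b * stable_symbol \<theta> t \<xi> \<le> K / t ^ k * norm \<xi> powr (b - \<theta> * k)" .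
      qed
    qed
    also have "R powr b * (unit_ball_vol ?n * R ^ ?n) = unit_ball_vol ?n * R powr (?n + b)"
      using R by (simp add: powr_add powr_realpow mult_ac)
    also have "K / t ^ k * (C * R powr (?n + (b - \<theta> * k))) = K * C * R powr (?n + b)"
    proof -
      have "t ^ k = R powr (- (\<theta> * k))" using R unfolding tR by (simp add: powr_powr powr_realpow [symmetric])
      moreover have "R powr (?n + (b - \<theta> * k)) = R powr (?n + b) * R powr (- (\<theta> * k))"
        unfolding powr_add [symmetric] by (rule arg_cong[where f = "(powr) R"]) simp
      ultimately show ?thesis using R by simp
    qed
    also have "R powr (?n + b) = t powr (- (?n + b) / \<theta>)"
      unfolding R_def powr_powr by (rule arg_cong[where f = "(powr) t"]) (simp only: divide_inverse, algebra)
    finally show "(\<integral>\<^sup>+(\<xi>::'a). ennreal (norm \<xi> powr b * stable_symbol \<theta> t \<xi>) \<partial>lborel)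
      \<le> ennreal ((unit_ball_vol ?n + K * C) * t powr (- (?n + b) / \<theta>))"
      by (simp add: distrib_right)
  qed
qed

lemma integrable_stable_symbol:
  fixes \<theta> :: real
  assumes "0 < \<theta>" "0 < t"
  shows "integrable lborel (stable_symbol \<theta> t :: 'a::euclidean_space \<Rightarrow> real)"
proof -
  obtain C where "0 \<le> C" and C: "\<And>t. 0 < t \<Longrightarrow>
    (\<integral>\<^sup>+(\<xi>::'a). ennreal (norm \<xi> powr 0 * stable_symbol \<theta> t \<xi>) \<partial>lborel) \<le> ennreal (C * t powr (- (real DIM('a) + 0) / \<theta>))"
    by (rule stable_symbol_moment_bound[OF assms(1) order_refl, where 'a='a], rule that)
  have "(\<integral>\<^sup>+(\<xi>::'a). ennreal (norm (stable_symbol \<theta> t \<xi>)) \<partial>lborel) = (\<integral>\<^sup>+(\<xi>::'a). ennreal (norm \<xi> powr 0 * stable_symbol \<theta> t \<xi>) \<partial>lborel)"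
    by (intro nn_integral_cong_AE AE_I[of _ _ "{0}"]) (auto simp: stable_symbol_def)
  also have "\<dots> < \<infinity>" using C[OF assms(2)] by (rule le_less_trans) simp
  finally show ?thesis by (intro integrableI_bounded) auto
qed

definition fourier :: "('a::euclidean_space \<Rightarrow> real) \<Rightarrow> 'a \<Rightarrow> complex" where
  "fourier \<Psi> x = (LINT \<xi>|lborel. exp (\<i> * of_real (x \<bullet> \<xi>)) * of_real (\<Psi> \<xi>))"

lemma integrable_fourier_integrand:
  assumes "integrable lborel (\<Psi> :: 'a::euclidean_space \<Rightarrow> real)"
  shows "integrable lborel (\<lambda>\<xi>. exp (\<i> * of_real (x \<bullet> \<xi>)) * of_real (\<Psi> \<xi>) :: complex)"
proof -
  have [measurable]: "\<Psi> \<in> borel_measurable borel" using assms by auto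
  show ?thesis by (rule Bochner_Integration.integrable_bound[OF assms]) (auto simp: norm_mult)
qed

lemma norm_fourier_le:
  assumes "integrable lborel (\<Psi> :: 'a::euclidean_space \<Rightarrow> real)"
  shows "ennreal (norm (fourier \<Psi> x)) \<le> (\<integral>\<^sup>+\<xi>. ennreal \<bar>\<Psi> \<xi>\<bar> \<partial>lborel)"
  unfolding fourier_def
  using integral_norm_bound_ennreal[OF integrable_fourier_integrand[OF assms, of x]] by (simp add: norm_mult)

lemma integrable_lborel_shift:
  fixes f :: "'a::euclidean_space \<Rightarrow> 'b::{banach, second_countable_topology}"
  assumes "integrable lborel f"
  shows "integrable lborel (\<lambda>x. f (x + h))"
  using assms by (subst (asm) lborel_distr_plus[of h, symmetric], subst (asm) integrable_distr_eq) (auto simp: add.commute)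

lemma lebesgue_integral_lborel_shift:
  fixes f :: "'a::euclidean_space \<Rightarrow> 'b::{banach, second_countable_topology}"
  assumes "f \<in> borel_measurable borel"
  shows "(LINT x|lborel. f (x + h)) = (LINT x|lborel. f x)"
  using assms by (subst (2) lborel_distr_plus[of h, symmetric], subst integral_distr) (auto simp: add.commute)

text \<open>
  A shift by \<open>h\<close> with \<open>x \<bullet> h = \<pi>\<close> multiplies the character at \<open>x\<close> by \<open>-1\<close>, so a difference of the
  integrand multiplies the Fourier integral by \<open>-2\<close>. Smoothness of the integrand in the mean is thus
  decay of the integral.
\<close>

lemma fourier_fdiff:
  assumes \<Psi>: "integrable lborel (\<Psi> :: 'a::euclidean_space \<Rightarrow> real)" and h: "x \<bullet> h = pi"
  shows "integrable lborel (fdiff h \<Psi>)" "fourier (fdiff h \<Psi>) x = - 2 * fourier \<Psi> x"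
proof -
  have [measurable]: "\<Psi> \<in> borel_measurable borel" using \<Psi> by auto
  have sh: "integrable lborel (\<lambda>\<xi>. \<Psi> (\<xi> + h))" by (rule integrable_lborel_shift[OF \<Psi>])
  show "integrable lborel (fdiff h \<Psi>)"
    unfolding fdiff_def[abs_def] using \<Psi> sh by (rule Bochner_Integration.integrable_diff[rotated])
  have e: "exp (\<i> * of_real (x \<bullet> \<xi>)) = - exp (\<i> * of_real (x \<bullet> (\<xi> + h)))" for \<xi>
    by (simp add: inner_add_right h ring_distribs exp_add exp_pi_i')
  have "fourier (fdiff h \<Psi>) x = fourier (\<lambda>\<xi>. \<Psi> (\<xi> + h)) x - fourier \<Psi> x"
    unfolding fourier_def fdiff_def
    by (subst Bochner_Integration.integral_diff[symmetric])
       (auto intro!: integrable_fourier_integrand \<Psi> sh simp: right_diff_distrib)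
  also have "fourier (\<lambda>\<xi>. \<Psi> (\<xi> + h)) x = - (LINT \<xi>|lborel. exp (\<i> * of_real (x \<bullet> (\<xi> + h))) * of_real (\<Psi> (\<xi> + h)))"
    unfolding fourier_def by (subst e) simp
  also have "(LINT \<xi>|lborel. exp (\<i> * of_real (x \<bullet> (\<xi> + h))) * of_real (\<Psi> (\<xi> + h))) = fourier \<Psi> x"
    unfolding fourier_def by (rule lebesgue_integral_lborel_shift) measurable
  finally show "fourier (fdiff h \<Psi>) x = - 2 * fourier \<Psi> x" by simp
qed

lemma fourier_fdiff_iterate:
  assumes \<Psi>: "integrable lborel (\<Psi> :: 'a::euclidean_space \<Rightarrow> real)" and h: "x \<bullet> h = pi"
  shows "integrable lborel ((fdiff h ^^ m) \<Psi>) \<and> fourier ((fdiff h ^^ m) \<Psi>) x = (- 2) ^ m * fourier \<Psi> x"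
proof (induction m)
  case (Suc m)
  then show ?case using fourier_fdiff[of "(fdiff h ^^ m) \<Psi>" x h] h by simp
qed (simp add: \<Psi>)

lemma fdiff_iterate_minus_const:
  assumes "0 < m"
  shows "(fdiff h ^^ m) (\<lambda>\<xi>. \<Psi> \<xi> - (c::real)) = (fdiff h ^^ m) \<Psi>"
proof -
  obtain k where "m = Suc k" using assms by (cases m) auto
  moreover have "fdiff h (\<lambda>\<xi>. \<Psi> \<xi> - c) = fdiff h \<Psi>" by (simp add: fdiff_def fun_eq_iff)
  ultimately show ?thesis by (simp add: funpow_Suc_right del: funpow.simps)
qed

text \<open>
  The step \<open>h = \<pi> x / |x|\<^sup>2\<close> has length \<open>\<pi> / |x|\<close>, which turns the power of \<open>|h|\<close> in the integral of the
  differences into decay in \<open>x\<close>.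
\<close>

lemma fourier_stable_symbol_decay:
  fixes \<theta> :: real
  assumes "0 < \<theta>" "\<theta> \<le> 2"
  obtains C where "0 \<le> C" "\<And>(x::'a::euclidean_space) t. x \<noteq> 0 \<Longrightarrow> 0 < t \<Longrightarrow>
    norm (fourier (stable_symbol \<theta> t) x) \<le> C * t * norm x powr (- (DIM('a) + \<theta>))"
proof -
  let ?n = "DIM('a)"
  \<comment> \<open>As \<open>\<theta> \<le> 2\<close>, this order exceeds the dimension plus \<open>\<theta>\<close>.\<close>
  define m where "m = ?n + 3"
  have m: "real ?n + \<theta> < real m" "0 < m" using assms by (simp_all add: m_def)
  obtain C where C: "0 \<le> C" "\<And>(h::'a) t. h \<noteq> 0 \<Longrightarrow> 0 \<le> t \<Longrightarrow>
    (\<integral>\<^sup>+\<xi>. ennreal \<bar>(fdiff h ^^ m) (\<lambda>\<xi>. stable_symbol \<theta> t \<xi> - 1) \<xi>\<bar> \<partial>lborel) \<le> ennreal (C * t * norm h powr (DIM('a) + \<theta>))"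
    using nn_integral_fdiff_stable_symbol[OF assms m(1)] by auto
  show ?thesis
  proof (rule that[of "C * pi powr (?n + \<theta>)"])
    show "0 \<le> C * pi powr (?n + \<theta>)" using C by simp
    fix x :: 'a and t :: real assume x: "x \<noteq> 0" and t: "0 < t"
    define h where "h = (pi / norm x ^ 2) *\<^sub>R x"
    have h0: "h \<noteq> 0" using x by (simp add: h_def)
    have hx: "x \<bullet> h = pi" using x by (simp add: h_def power2_norm_eq_inner)
    have nh: "norm h = pi / norm x" using x by (simp add: h_def power2_eq_square)
    note I = fourier_fdiff_iterate[OF integrable_stable_symbol[OF assms(1) t] hx, of m]
    have "norm (fourier (stable_symbol \<theta> t) x) \<le> 2 ^ m * norm (fourier (stable_symbol \<theta> t) x)"
      by (simp add: mult_le_cancel_right1)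
    also have "\<dots> = norm (fourier ((fdiff h ^^ m) (stable_symbol \<theta> t)) x)"
      using I by (simp add: norm_mult norm_power)
    finally have "ennreal (norm (fourier (stable_symbol \<theta> t) x)) \<le> ennreal (norm (fourier ((fdiff h ^^ m) (stable_symbol \<theta> t)) x))"
      by (rule ennreal_leI)
    also have "\<dots> \<le> (\<integral>\<^sup>+\<xi>. ennreal \<bar>(fdiff h ^^ m) (stable_symbol \<theta> t) \<xi>\<bar> \<partial>lborel)"
      using I by (intro norm_fourier_le) blast
    also have "\<dots> \<le> ennreal (C * t * norm h powr (?n + \<theta>))"
      using C(2)[OF h0, of t] t by (simp add: fdiff_iterate_minus_const m)
    also have "norm h powr (?n + \<theta>) = pi powr (?n + \<theta>) * norm x powr (- (?n + \<theta>))"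
      unfolding nh powr_minus_divide using x by (subst powr_divide) auto
    finally show "norm (fourier (stable_symbol \<theta> t) x) \<le> C * pi powr (?n + \<theta>) * t * norm x powr (- (?n + \<theta>))"
      using C t by (simp add: mult_ac)
  qed
qed

lemma frac_heat_kernel_eq_fourier:
  "frac_heat_kernel \<theta> x t = Re (fourier (stable_symbol \<theta> t) (x :: real ^ 'n)) / (2 * pi) ^ CARD('n)"
proof -
  have "(LINT \<xi>|lebesgue. exp (\<i> * complex_of_real (x \<bullet> \<xi>) - complex_of_real (t * norm \<xi> powr \<theta>))) = fourier (stable_symbol \<theta> t) x"
    unfolding fourier_def stable_symbol_def
    by (subst integral_completion) (auto simp: exp_diff exp_minus exp_of_real[symmetric] divide_inverse)
  then show ?thesis unfolding frac_heat_kernel_def by simp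
qed

text \<open>
  Up to constants, the size of the kernel for \<open>\<theta> < 2\<close>, and an upper bound for the Gaussian when \<open>\<theta> = 2\<close>.
\<close>

definition stable_profile :: "real \<Rightarrow> real \<Rightarrow> 'a::euclidean_space \<Rightarrow> real" where
  "stable_profile \<theta> t x = t * max (norm x) (t powr (1 / \<theta>)) powr (- (real DIM('a) + \<theta>))"

lemma frac_heat_kernel_le_stable_profile:
  fixes \<theta> :: real
  assumes "0 < \<theta>" "\<theta> \<le> 2"
  obtains C where "0 < C" "\<And>(x :: real ^ 'n) t. 0 < t \<Longrightarrow> frac_heat_kernel \<theta> x t \<le> C * stable_profile \<theta> t x"
proof -
  let ?n = "DIM(real ^ 'n)"
  obtain C1 where C1: "0 \<le> C1" "\<And>(x::real ^ 'n) t. x \<noteq> 0 \<Longrightarrow> 0 < t \<Longrightarrow>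
    norm (fourier (stable_symbol \<theta> t) x) \<le> C1 * t * norm x powr (- (?n + \<theta>))"
    using fourier_stable_symbol_decay[OF assms] by blast
  obtain C0 where C0: "0 \<le> C0" "\<And>t. 0 < t \<Longrightarrow>
    (\<integral>\<^sup>+(\<xi>::real ^ 'n). ennreal (norm \<xi> powr 0 * stable_symbol \<theta> t \<xi>) \<partial>lborel) \<le> ennreal (C0 * t powr (- (real ?n + 0) / \<theta>))"
    by (rule stable_symbol_moment_bound[OF assms(1) order_refl, where 'a="real ^ 'n"], rule that)
  show ?thesis
  proof (rule that[of "C0 + C1 + 1"])
    show "0 < C0 + C1 + 1" using C0 C1 by simp
    fix x :: "real ^ 'n" and t :: real assume t: "0 < t"
    have "frac_heat_kernel \<theta> x t \<le> norm (fourier (stable_symbol \<theta> t) x) / (2 * pi) ^ CARD('n)"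
      unfolding frac_heat_kernel_eq_fourier by (intro divide_right_mono complex_Re_le_cmod) simp
    also have "\<dots> \<le> norm (fourier (stable_symbol \<theta> t) x) / 1"
      using pi_gt3 by (intro divide_left_mono one_le_power) auto
    finally have 1: "frac_heat_kernel \<theta> x t \<le> norm (fourier (stable_symbol \<theta> t) x)" by simp
    have "norm (fourier (stable_symbol \<theta> t) x) \<le> (C0 + C1 + 1) * stable_profile \<theta> t x"
    proof (cases "norm x \<le> t powr (1 / \<theta>)")
      case True
      have "ennreal (norm (fourier (stable_symbol \<theta> t) x)) \<le> (\<integral>\<^sup>+(\<xi>::real ^ 'n). ennreal \<bar>stable_symbol \<theta> t \<xi>\<bar> \<partial>lborel)"
        by (rule norm_fourier_le[OF integrable_stable_symbol[OF assms(1) t]])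
      also have "\<dots> = (\<integral>\<^sup>+(\<xi>::real ^ 'n). ennreal (norm \<xi> powr 0 * stable_symbol \<theta> t \<xi>) \<partial>lborel)"
        by (intro nn_integral_cong_AE AE_I[of _ _ "{0}"]) (auto simp: stable_symbol_def)
      also have "\<dots> \<le> ennreal (C0 * t powr (- (real ?n + 0) / \<theta>))" by (rule C0(2)[OF t])
      finally have "norm (fourier (stable_symbol \<theta> t) x) \<le> C0 * t powr (- real ?n / \<theta>)" using C0 by simp
      also have "t powr (- real ?n / \<theta>) = stable_profile \<theta> t x"
      proof -
        have "t powr (- real ?n / \<theta>) = t powr 1 * t powr ((1 / \<theta>) * (- (?n + \<theta>)))"
          unfolding powr_add[symmetric] using assms by (intro arg_cong[where f = "(powr) t"]) (simp add: field_simps)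
        also have "\<dots> = stable_profile \<theta> t x"
          using True t by (simp add: stable_profile_def max_absorb2 powr_powr)
        finally show ?thesis .
      qed
      finally have "norm (fourier (stable_symbol \<theta> t) x) \<le> C0 * stable_profile \<theta> t x" .
      moreover have "0 \<le> (C1 + 1) * stable_profile \<theta> t x" using C1 t by (simp add: stable_profile_def)
      ultimately show ?thesis by (simp add: distrib_right)
    next
      case False
      then have "x \<noteq> 0" by auto
      have p: "stable_profile \<theta> t x = t * norm x powr (- (?n + \<theta>))" using False by (simp add: stable_profile_def)
      have "norm (fourier (stable_symbol \<theta> t) x) \<le> C1 * stable_profile \<theta> t x"
        using C1(2)[OF \<open>x \<noteq> 0\<close> t] unfolding p by (simp add: mult_ac)
      moreover have "0 \<le> (C0 + 1) * stable_profile \<theta> t x" using C0 t by (simp add: stable_profile_def)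
      ultimately show ?thesis by (simp add: distrib_right)
    qed
    with 1 show "frac_heat_kernel \<theta> x t \<le> (C0 + C1 + 1) * stable_profile \<theta> t x" by linarith
  qed
qed

text \<open>
  At the origin the kernel is the integral of the symbol, and \<open>1 - cos (x \<bullet> \<xi>) \<le> |x| |\<xi>|\<close> bounds its
  variation by the first moment.
\<close>

lemma frac_heat_kernel_lower_bound:
  assumes "0 < \<theta>"
  obtains c \<epsilon> where "0 < c" "0 < \<epsilon>" "\<And>(x :: real ^ 'n) t. 0 < t \<Longrightarrow> norm x \<le> \<epsilon> * t powr (1 / \<theta>) \<Longrightarrow>
     c * t powr (- real CARD('n) / \<theta>) \<le> frac_heat_kernel \<theta> x t"
proof -
  let ?n = "DIM(real ^ 'n)"
  have card: "?n = CARD('n)" by simp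
  obtain C where C: "0 \<le> C" "\<And>t. 0 < t \<Longrightarrow>
    (\<integral>\<^sup>+(\<xi>::real ^ 'n). ennreal (norm \<xi> powr 1 * stable_symbol \<theta> t \<xi>) \<partial>lborel) \<le> ennreal (C * t powr (- (real ?n + 1) / \<theta>))"
    by (rule stable_symbol_moment_bound[OF assms zero_le_one, where 'a="real ^ 'n"], rule that)
  define V where "V = exp (- 1) * unit_ball_vol (real ?n)"
  have V: "0 < V" by (simp add: V_def)
  define \<epsilon> where "\<epsilon> = V / (2 * (C + 1))"
  have \<epsilon>: "0 < \<epsilon>" "\<epsilon> * C \<le> V / 2" using V C by (auto simp: \<epsilon>_def field_simps)
  show ?thesis
  proof (rule that[of "V / 2 / (2 * pi) ^ CARD('n)" \<epsilon>])
    fix x :: "real ^ 'n" and t :: real assume t: "0 < t" and x: "norm x \<le> \<epsilon> * t powr (1 / \<theta>)"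
    let ?\<Phi> = "stable_symbol \<theta> t :: real ^ 'n \<Rightarrow> real"
    define r where "r = t powr (- 1 / \<theta>)"
    have r: "0 < r" using t by (simp add: r_def)
    have tr: "t * r powr \<theta> = 1" unfolding r_def powr_powr using t assms by (simp add: powr_minus)
    have int: "integrable lborel ?\<Phi>" by (rule integrable_stable_symbol[OF assms t])
    have intn: "integrable lborel (\<lambda>\<xi>. norm \<xi> * ?\<Phi> \<xi>)"
      using C(2)[OF t] by (intro integrableI_bounded) (auto simp: stable_symbol_def abs_mult less_top[symmetric] top_unique)
    have 1: "(LINT \<xi>|lborel. norm \<xi> * ?\<Phi> \<xi>) \<le> C * t powr (- (real ?n + 1) / \<theta>)"
    proof -
      have "ennreal (LINT \<xi>|lborel. norm \<xi> * ?\<Phi> \<xi>) = (\<integral>\<^sup>+(\<xi>::real ^ 'n). ennreal (norm \<xi> powr 1 * ?\<Phi> \<xi>) \<partial>lborel)"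
        using nn_integral_eq_integral[OF intn] by (simp add: stable_symbol_def)
      then show ?thesis using C(2)[OF t] C(1) by (metis ennreal_le_iff mult_nonneg_nonneg powr_ge_zero)
    qed
    have 2: "V * r ^ ?n \<le> (LINT \<xi>|lborel. ?\<Phi> \<xi>)"
    proof -
      have "V * r ^ ?n = (LINT \<xi>|lborel. exp (- 1) * indicator (ball (0 :: real ^ 'n) r) \<xi>)"
        using r by (simp add: V_def content_ball)
      also have "\<dots> \<le> (LINT \<xi>|lborel. ?\<Phi> \<xi>)"
      proof (rule integral_mono[OF _ int])
        show "integrable lborel (\<lambda>\<xi>. exp (- 1) * indicator (ball (0 :: real ^ 'n) r) \<xi> :: real)"
          using emeasure_lborel_ball_finite by (intro integrable_mult_right integrable_real_indicator) auto
        fix \<xi> :: "real ^ 'n"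
        show "exp (- 1) * indicator (ball (0 :: real ^ 'n) r) \<xi> \<le> ?\<Phi> \<xi>"
        proof (cases "norm \<xi> < r")
          case True
          have "t * norm \<xi> powr \<theta> \<le> t * r powr \<theta>"
            by (intro mult_left_mono powr_mono2 less_imp_le[OF assms] less_imp_le[OF t] less_imp_le[OF True] norm_ge_zero)
          then have "exp (- 1) \<le> ?\<Phi> \<xi>" unfolding tr stable_symbol_def exp_le_cancel_iff by linarith
          then show ?thesis using True by simp
        qed (simp add: stable_symbol_def)
      qed
      finally show ?thesis .
    qed
    have Re: "Re (fourier ?\<Phi> x) = (LINT \<xi>|lborel. cos (x \<bullet> \<xi>) * ?\<Phi> \<xi>)"
      unfolding fourier_def using integrable_fourier_integrand[OF int, of x]
      by (subst integral_Re[symmetric]) (auto simp: Re_exp)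
    have icos: "integrable lborel (\<lambda>\<xi>. cos (x \<bullet> \<xi>) * ?\<Phi> \<xi>)"
      by (rule Bochner_Integration.integrable_bound[OF int])
         (auto simp: abs_mult stable_symbol_def mult_le_cancel_right1)
    have "(LINT \<xi>|lborel. ?\<Phi> \<xi>) - norm x * (LINT \<xi>|lborel. norm \<xi> * ?\<Phi> \<xi>) = (LINT \<xi>|lborel. ?\<Phi> \<xi> - norm x * (norm \<xi> * ?\<Phi> \<xi>))"
      using int intn by simp
    also have "\<dots> \<le> Re (fourier ?\<Phi> x)"
      unfolding Re
    proof (rule integral_mono[OF _ icos])
      show "integrable lborel (\<lambda>\<xi>. ?\<Phi> \<xi> - norm x * (norm \<xi> * ?\<Phi> \<xi>))" using int intn by auto
      fix \<xi> :: "real ^ 'n"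
      have "\<bar>cos (x \<bullet> \<xi>) - cos 0\<bar> \<le> \<bar>x \<bullet> \<xi> - 0\<bar>"
        using abs_sin_le_one field_differentiable_bound[of UNIV cos "\<lambda>u. - sin u" 1 "x \<bullet> \<xi>" 0]
        by (auto intro!: derivative_eq_intros)
      moreover have "\<bar>x \<bullet> \<xi>\<bar> \<le> norm x * norm \<xi>" by (rule Cauchy_Schwarz_ineq2)
      ultimately have "1 - norm x * norm \<xi> \<le> cos (x \<bullet> \<xi>)" by simp
      then have "(1 - norm x * norm \<xi>) * ?\<Phi> \<xi> \<le> cos (x \<bullet> \<xi>) * ?\<Phi> \<xi>"
        by (intro mult_right_mono) (auto simp: stable_symbol_def)
      then show "?\<Phi> \<xi> - norm x * (norm \<xi> * ?\<Phi> \<xi>) \<le> cos (x \<bullet> \<xi>) * ?\<Phi> \<xi>" by (simp add: algebra_simps)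
    qed
    finally have 3: "(LINT \<xi>|lborel. ?\<Phi> \<xi>) - norm x * (LINT \<xi>|lborel. norm \<xi> * ?\<Phi> \<xi>) \<le> Re (fourier ?\<Phi> x)" .
    have rn: "r ^ ?n = t powr (- real CARD('n) / \<theta>)"
      using r by (simp add: r_def powr_powr powr_realpow[symmetric])
    have "norm x * (LINT \<xi>|lborel. norm \<xi> * ?\<Phi> \<xi>) \<le> (\<epsilon> * t powr (1 / \<theta>)) * (C * t powr (- (real ?n + 1) / \<theta>))"
      using 1 x \<epsilon> by (intro mult_mono integral_nonneg_AE) (auto simp: stable_symbol_def)
    also have "\<dots> = \<epsilon> * C * t powr (- real CARD('n) / \<theta>)"
    proof -
      have "t powr (1 / \<theta>) * t powr (- (real ?n + 1) / \<theta>) = t powr (- real CARD('n) / \<theta>)"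
        unfolding powr_add[symmetric] using assms by (intro arg_cong[where f = "(powr) t"]) (simp add: field_simps)
      then show ?thesis by (metis mult.assoc mult.left_commute)
    qed
    also have "\<dots> \<le> V / 2 * t powr (- real CARD('n) / \<theta>)" using \<epsilon> by (intro mult_right_mono) auto
    finally have "V / 2 * t powr (- real CARD('n) / \<theta>) \<le> Re (fourier ?\<Phi> x)" using 2 3 unfolding rn by simp
    then show "V / 2 / (2 * pi) ^ CARD('n) * t powr (- real CARD('n) / \<theta>) \<le> frac_heat_kernel \<theta> x t"
      unfolding frac_heat_kernel_eq_fourier
      using divide_right_mono[of "V / 2 * t powr (- real CARD('n) / \<theta>)" "Re (fourier ?\<Phi> x)" "(2 * pi) ^ CARD('n)"] by simp
  qed (use V \<epsilon> in auto)
qed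

lemma frac_heat_kernel_measurable [measurable]:
  assumes [measurable]: "g \<in> borel_measurable M" "h \<in> borel_measurable M"
  shows "(\<lambda>z. frac_heat_kernel \<theta> (g z :: real ^ 'n) (h z)) \<in> borel_measurable M"
proof -
  have [measurable]: "(\<lambda>(p :: (real ^ 'n) \<times> real). fourier (stable_symbol \<theta> (snd p)) (fst p)) \<in> borel_measurable (borel \<Otimes>\<^sub>M borel)"
    unfolding fourier_def stable_symbol_def by measurable
  have "(\<lambda>z. fourier (stable_symbol \<theta> (snd (g z, h z))) (fst (g z, h z))) \<in> borel_measurable M" by measurable
  then show ?thesis unfolding frac_heat_kernel_eq_fourier by simp
qed


section \<open>Convolution with the profile of the kernel\<close>

lemma stable_profile_pos: "0 < t \<Longrightarrow> 0 < stable_profile \<theta> t x"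
proof -
  assume t: "0 < t"
  then have "max (norm x) (t powr (1 / \<theta>)) \<noteq> 0" by (metis less_max_iff_disj less_irrefl powr_gt_zero)
  then show ?thesis using t unfolding stable_profile_def by (intro mult_pos_pos) (simp_all only: powr_gt_zero not_False_eq_True)
qed

lemma stable_profile_minus [simp]: "stable_profile \<theta> t (- x) = stable_profile \<theta> t x"
  by (simp add: stable_profile_def)

lemma stable_profile_measurable [measurable]:
  assumes [measurable]: "g \<in> borel_measurable M" "h \<in> borel_measurable M"
  shows "(\<lambda>z. stable_profile \<theta> (h z) (g z :: 'a::euclidean_space)) \<in> borel_measurable M"
  unfolding stable_profile_def by measurable

lemma stable_profile_inside:
  assumes "0 < \<theta>" "0 < t" "norm (x::'a::euclidean_space) \<le> t powr (1 / \<theta>)"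
  shows "stable_profile \<theta> t x = t powr (- real DIM('a) / \<theta>)"
proof -
  have "stable_profile \<theta> t x = t powr 1 * t powr ((1 / \<theta>) * (- (real DIM('a) + \<theta>)))"
    using assms by (simp add: stable_profile_def max_absorb2 powr_powr)
  also have "\<dots> = t powr (- real DIM('a) / \<theta>)"
    unfolding powr_add[symmetric] using assms(1) by (intro arg_cong[where f = "(powr) t"]) (simp add: field_simps)
  finally show ?thesis .
qed

lemma stable_profile_mass_le:
  fixes \<theta> :: real
  assumes "0 < \<theta>"
  obtains C where "0 \<le> C" "\<And>t. 0 < t \<Longrightarrow> (\<integral>\<^sup>+(x::'a::euclidean_space). ennreal (stable_profile \<theta> t x) \<partial>lborel) \<le> ennreal C"
proof -
  let ?n = "DIM('a)"
  have e: "- (real ?n + \<theta>) < - real ?n" using assms by simp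
  obtain C where C: "0 \<le> C" and split: "\<And>(g :: 'a \<Rightarrow> real) a d R. 0 < R \<Longrightarrow> 0 \<le> a \<Longrightarrow> 0 \<le> d \<Longrightarrow>
    \<forall>x. norm x < R \<longrightarrow> g x \<le> a \<Longrightarrow> \<forall>x. R \<le> norm x \<longrightarrow> g x \<le> d * norm x powr (- (real ?n + \<theta>)) \<Longrightarrow>
    (\<integral>\<^sup>+x. ennreal (g x) \<partial>lborel) \<le> ennreal (a * (unit_ball_vol ?n * R ^ ?n) + d * (C * R powr (?n + (- (real ?n + \<theta>)))))"
    by (rule nn_integral_inside_outside_bound[OF e], rule that)
  show ?thesis
  proof (rule that[of "unit_ball_vol ?n + C"])
    show "0 \<le> unit_ball_vol ?n + C" using C by simp
    fix t :: real assume t: "0 < t"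
    define R where "R = t powr (1 / \<theta>)"
    have R: "0 < R" using t by (simp add: R_def)
    have Rt: "R powr (- \<theta>) = 1 / t" unfolding R_def powr_powr using t assms by (simp add: powr_minus_divide)
    have Rn: "t powr (- real ?n / \<theta>) * R ^ ?n = 1"
      unfolding powr_realpow[OF R, symmetric] unfolding R_def powr_powr powr_add[symmetric] using t by simp
    have "(\<integral>\<^sup>+(x::'a). ennreal (stable_profile \<theta> t x) \<partial>lborel)
      \<le> ennreal (t powr (- real ?n / \<theta>) * (unit_ball_vol ?n * R ^ ?n) + t * (C * R powr (real ?n + (- (real ?n + \<theta>)))))"
    proof (rule split[OF R])
      show "\<forall>x::'a. norm x < R \<longrightarrow> stable_profile \<theta> t x \<le> t powr (- real ?n / \<theta>)"
        using stable_profile_inside[OF assms t, where 'a = 'a] by (simp add: R_def)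
      show "\<forall>x::'a. R \<le> norm x \<longrightarrow> stable_profile \<theta> t x \<le> t * norm x powr (- (real ?n + \<theta>))"
        by (simp add: stable_profile_def R_def max_absorb1)
    qed (use t in simp_all)
    also have "t powr (- real ?n / \<theta>) * (unit_ball_vol ?n * R ^ ?n) = unit_ball_vol ?n"
      using Rn by (metis mult.left_commute mult.right_neutral)
    also have "t * (C * R powr (real ?n + (- (real ?n + \<theta>)))) = C"
    proof -
      have "real ?n + (- (real ?n + \<theta>)) = - \<theta>" by simp
      then show ?thesis using t by (simp only: Rt) simp
    qed
    finally show "(\<integral>\<^sup>+(x::'a). ennreal (stable_profile \<theta> t x) \<partial>lborel) \<le> ennreal (unit_ball_vol ?n + C)" .
  qed
qed

lemma stable_profile_mass_ge:
  assumes "0 < \<theta>" "0 < t"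
  shows "ennreal (unit_ball_vol DIM('a)) \<le> (\<integral>\<^sup>+(x::'a::euclidean_space). ennreal (stable_profile \<theta> t x) \<partial>lborel)"
proof -
  let ?n = "DIM('a)"
  define R where "R = t powr (1 / \<theta>)"
  have R: "0 < R" using assms by (simp add: R_def)
  have Rn: "t powr (- real ?n / \<theta>) * R ^ ?n = 1"
    unfolding powr_realpow[OF R, symmetric] unfolding R_def powr_powr powr_add[symmetric] using assms by simp
  have "unit_ball_vol ?n = t powr (- real ?n / \<theta>) * (unit_ball_vol ?n * R ^ ?n)"
    using Rn by (metis mult.left_commute mult.right_neutral)
  then have "ennreal (unit_ball_vol ?n) = ennreal (t powr (- real ?n / \<theta>)) * ennreal (unit_ball_vol ?n * R ^ ?n)"
    by (metis ennreal_mult' powr_ge_zero)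
  also have "\<dots> = (\<integral>\<^sup>+x. ennreal (t powr (- real ?n / \<theta>)) * indicator (ball (0::'a) R) x \<partial>lborel)"
    using R by (simp add: nn_integral_cmult_indicator emeasure_ball)
  also have "\<dots> \<le> (\<integral>\<^sup>+(x::'a). ennreal (stable_profile \<theta> t x) \<partial>lborel)"
  proof (intro nn_integral_mono)
    fix x :: 'a
    show "ennreal (t powr (- real ?n / \<theta>)) * indicator (ball 0 R) x \<le> ennreal (stable_profile \<theta> t x)"
      using stable_profile_inside[OF assms, of x] by (cases "norm x < R") (auto simp: R_def)
  qed
  finally show ?thesis .
qed

text \<open>
  Up to the time factor, the inverse of the profile is a power of the parabolic distance, so this is a
  triangle inequality: the larger of the two distances bounds the distance of the sum.
\<close>

lemma stable_profile_quasimetric: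
  fixes u v :: "'a::euclidean_space"
  assumes "0 < \<theta>" "0 < a" "0 < b"
  shows "min (stable_profile \<theta> a u) (stable_profile \<theta> b v)
    \<le> (2 + 2 powr (1 / \<theta>)) powr (real DIM('a) + \<theta>) * stable_profile \<theta> (a + b) (u + v)"
proof -
  let ?e = "real DIM('a) + \<theta>"
  define c :: real where "c = 2 + 2 powr (1 / \<theta>)"
  have "0 < (2 :: real) powr (1 / \<theta>)" by simp
  then have c: "0 < c" "2 \<le> c" "2 powr (1 / \<theta>) \<le> c" unfolding c_def by linarith+
  have *: "stable_profile \<theta> a u \<le> c powr ?e * stable_profile \<theta> (a + b) (u + v)"
    if "0 < a" "0 < b" and le: "max (norm v) (b powr (1 / \<theta>)) \<le> max (norm u) (a powr (1 / \<theta>))" for a b and u v :: 'a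
  proof -
    let ?m = "max (norm u) (a powr (1 / \<theta>))"
    have m: "0 < ?m" using that by (simp add: less_max_iff_disj)
    have "norm (u + v) \<le> norm u + norm v" by (rule norm_triangle_ineq)
    also have "\<dots> \<le> 2 * ?m" using le by linarith
    also have "\<dots> \<le> c * ?m" using m c by (intro mult_right_mono) auto
    finally have 1: "norm (u + v) \<le> c * ?m" .
    have "(a + b) powr (1 / \<theta>) \<le> (2 * max a b) powr (1 / \<theta>)" using that assms by (intro powr_mono2) auto
    also have "\<dots> = 2 powr (1 / \<theta>) * max a b powr (1 / \<theta>)" by (rule powr_mult)
    also have "\<dots> \<le> 2 powr (1 / \<theta>) * ?m"
      using le by (intro mult_left_mono) (auto simp: max_def split: if_splits)
    also have "\<dots> \<le> c * ?m" using m c by (intro mult_right_mono) auto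
    finally have 2: "(a + b) powr (1 / \<theta>) \<le> c * ?m" .
    have "(c * ?m) powr (- ?e) \<le> max (norm (u + v)) ((a + b) powr (1 / \<theta>)) powr (- ?e)"
    proof (rule powr_mono2')
      have "0 < (a + b) powr (1 / \<theta>)" using that by simp
      then show "0 < max (norm (u + v)) ((a + b) powr (1 / \<theta>))" by (metis less_max_iff_disj)
    qed (use 1 2 assms(1) in simp_all)
    then have "c powr ?e * (c * ?m) powr (- ?e) \<le> c powr ?e * max (norm (u + v)) ((a + b) powr (1 / \<theta>)) powr (- ?e)"
      by (intro mult_left_mono) auto
    also have "c powr ?e * (c * ?m) powr (- ?e) = ?m powr (- ?e)"
    proof -
      have "c powr ?e * c powr (- ?e) = 1" unfolding powr_add[symmetric] using c by simp
      then show ?thesis by (simp only: powr_mult mult.assoc[symmetric] mult_1)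
    qed
    finally have f: "?m powr (- ?e) \<le> c powr ?e * max (norm (u + v)) ((a + b) powr (1 / \<theta>)) powr (- ?e)" .
    have "a * ?m powr (- ?e) \<le> (a + b) * (c powr ?e * max (norm (u + v)) ((a + b) powr (1 / \<theta>)) powr (- ?e))"
      by (rule mult_mono[OF _ f]) (use that(1,2) in simp_all)
    then show ?thesis unfolding stable_profile_def by (simp only: mult_ac)
  qed
  have "min (stable_profile \<theta> a u) (stable_profile \<theta> b v) \<le> c powr ?e * stable_profile \<theta> (a + b) (u + v)"
  proof (cases "max (norm v) (b powr (1 / \<theta>)) \<le> max (norm u) (a powr (1 / \<theta>))")
    case True
    from *[OF assms(2,3) True] show ?thesis by (rule min.coboundedI1)
  next
    case False
    then have "max (norm u) (a powr (1 / \<theta>)) \<le> max (norm v) (b powr (1 / \<theta>))" by (simp only: not_le less_imp_le)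
    from *[OF assms(3,2) this] show ?thesis by (intro min.coboundedI2) (simp only: add.commute)
  qed
  then show ?thesis unfolding c_def .
qed

definition profile_conv :: "real \<Rightarrow> real \<Rightarrow> ('a::euclidean_space \<Rightarrow> ennreal) \<Rightarrow> 'a \<Rightarrow> ennreal" where
  "profile_conv \<theta> t \<psi> x = (\<integral>\<^sup>+y. ennreal (stable_profile \<theta> t (x - y)) * \<psi> y \<partial>lborel)"

lemma profile_conv_const:
  fixes x :: "'a::euclidean_space"
  shows "profile_conv \<theta> t (\<lambda>_. c) x = (\<integral>\<^sup>+(y::'a). ennreal (stable_profile \<theta> t y) \<partial>lborel) * c"
  unfolding profile_conv_def
  by (subst nn_integral_multc, measurable, subst nn_integral_lborel_reflect[of "\<lambda>y. ennreal (stable_profile \<theta> t y)"]) auto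

text \<open>
  The minimum of two profiles is bounded by the profile of the sum, so their product is at most that
  profile times the sum of the two, and each of them has bounded mass. The convolutions thus form a
  semigroup up to a constant factor.
\<close>

lemma profile_conv_comp_le:
  fixes \<theta> :: real
  assumes "0 < \<theta>"
  obtains C where "0 < C" "\<And>a b (\<psi> :: 'a::euclidean_space \<Rightarrow> ennreal) x. 0 < a \<Longrightarrow> 0 < b \<Longrightarrow> \<psi> \<in> borel_measurable borel \<Longrightarrow>
     profile_conv \<theta> a (profile_conv \<theta> b \<psi>) x \<le> ennreal C * profile_conv \<theta> (a + b) \<psi> x"
proof -
  obtain M where M: "0 \<le> M" "\<And>t. 0 < t \<Longrightarrow> (\<integral>\<^sup>+(x::'a). ennreal (stable_profile \<theta> t x) \<partial>lborel) \<le> ennreal M"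
    by (rule stable_profile_mass_le[OF assms, where 'a='a], rule that)
  define c where "c = (2 + 2 powr (1 / \<theta>)) powr (real DIM('a) + \<theta>)"
  have c: "0 < c" 
  proof -
    have "0 < (2 :: real) powr (1 / \<theta>)" by simp
    then have "0 < 2 + (2 :: real) powr (1 / \<theta>)" by linarith
    then show ?thesis unfolding c_def by (metis powr_gt_zero less_irrefl)
  qed
  show ?thesis
  proof (rule that[of "c * (2 * M + 1)"])
    show "0 < c * (2 * M + 1)" using c M by simp
    fix a b :: real and \<psi> :: "'a \<Rightarrow> ennreal" and x :: 'a
    assume a: "0 < a" and b: "0 < b" and \<psi>[measurable]: "\<psi> \<in> borel_measurable borel"
    let ?pa = "\<lambda>z. ennreal (stable_profile \<theta> a (x - z))" and ?pb = "\<lambda>y z. ennreal (stable_profile \<theta> b (z - y))"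
    have pt: "?pa z * ?pb y z
        \<le> ennreal (c * stable_profile \<theta> (a + b) (x - y)) * (?pa z + ?pb y z)" for y z
    proof -
      let ?p = "stable_profile \<theta> a (x - z)" and ?q = "stable_profile \<theta> b (z - y)" and ?r = "stable_profile \<theta> (a + b) (x - y)"
      have pos: "0 < ?p" "0 < ?q" "0 < ?r" using a b by (auto intro: stable_profile_pos)
      have "min ?p ?q \<le> c * ?r"
        using stable_profile_quasimetric[OF assms a b, of "x - z" "z - y"] by (simp add: c_def)
      then have "min ?p ?q * max ?p ?q \<le> (c * ?r) * (?p + ?q)"
        using pos c by (intro mult_mono) auto
      moreover have "min ?p ?q * max ?p ?q = ?p * ?q" by (cases "?p \<le> ?q") (simp_all add: min_def max_def)
      ultimately have "ennreal (?p * ?q) \<le> ennreal ((c * ?r) * (?p + ?q))" by (metis ennreal_leI)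
      also have "\<dots> = ennreal (c * ?r) * (ennreal ?p + ennreal ?q)"
        using pos c by (subst ennreal_mult') (auto intro!: ennreal_plus)
      also have "ennreal (?p * ?q) = ennreal ?p * ennreal ?q" using pos by (intro ennreal_mult') auto
      finally show ?thesis .
    qed
    have inner: "(\<integral>\<^sup>+z. ?pa z * ?pb y z \<partial>lborel)
        \<le> ennreal (c * (2 * M + 1)) * ennreal (stable_profile \<theta> (a + b) (x - y))" for y
    proof -
      have "(\<integral>\<^sup>+z. ?pa z * ?pb y z \<partial>lborel)
        \<le> (\<integral>\<^sup>+z. ennreal (c * stable_profile \<theta> (a + b) (x - y)) * (?pa z + ?pb y z) \<partial>lborel)"
        by (intro nn_integral_mono pt)
      also have "\<dots> = ennreal (c * stable_profile \<theta> (a + b) (x - y)) *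
          ((\<integral>\<^sup>+z. ?pa z \<partial>lborel) + (\<integral>\<^sup>+z. ?pb y z \<partial>lborel))"
        by (subst nn_integral_cmult, measurable, subst nn_integral_add) auto
      also have "(\<integral>\<^sup>+z. ?pa z \<partial>lborel) = (\<integral>\<^sup>+(z::'a). ennreal (stable_profile \<theta> a z) \<partial>lborel)"
        by (rule nn_integral_lborel_reflect) measurable
      also have "(\<integral>\<^sup>+z. ?pb y z \<partial>lborel) = (\<integral>\<^sup>+z. ennreal (stable_profile \<theta> b (y - z)) \<partial>lborel)"
        by (metis minus_diff_eq stable_profile_minus)
      also have "\<dots> = (\<integral>\<^sup>+(z::'a). ennreal (stable_profile \<theta> b z) \<partial>lborel)"
        by (rule nn_integral_lborel_reflect) measurable
      also have "ennreal (c * stable_profile \<theta> (a + b) (x - y)) *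
          ((\<integral>\<^sup>+(z::'a). ennreal (stable_profile \<theta> a z) \<partial>lborel) + (\<integral>\<^sup>+(z::'a). ennreal (stable_profile \<theta> b z) \<partial>lborel))
          \<le> ennreal (c * stable_profile \<theta> (a + b) (x - y)) * (ennreal M + ennreal M)"
        by (rule mult_left_mono[OF add_mono[OF M(2)[OF a] M(2)[OF b]]]) simp
      also have "\<dots> = ennreal (c * stable_profile \<theta> (a + b) (x - y) * (M + M))"
        using M(1) by (subst ennreal_plus[symmetric], simp, simp, subst ennreal_mult''[symmetric]) auto
      also have "\<dots> \<le> ennreal (c * (2 * M + 1) * stable_profile \<theta> (a + b) (x - y))"
      proof (rule ennreal_leI)
        have "c * stable_profile \<theta> (a + b) (x - y) * (M + M) \<le> c * stable_profile \<theta> (a + b) (x - y) * (2 * M + 1)"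
          using c stable_profile_pos[of "a + b" \<theta> "x - y"] a b by (intro mult_left_mono) auto
        then show "c * stable_profile \<theta> (a + b) (x - y) * (M + M) \<le> c * (2 * M + 1) * stable_profile \<theta> (a + b) (x - y)"
          by (simp only: mult_ac)
      qed
      also have "\<dots> = ennreal (c * (2 * M + 1)) * ennreal (stable_profile \<theta> (a + b) (x - y))"
        by (rule ennreal_mult') (use c M in auto)
      finally show ?thesis .
    qed
    have "profile_conv \<theta> a (profile_conv \<theta> b \<psi>) x
        = (\<integral>\<^sup>+z. (\<integral>\<^sup>+y. ?pa z * (?pb y z * \<psi> y) \<partial>lborel) \<partial>lborel)"
      unfolding profile_conv_def by (subst nn_integral_cmult[symmetric]) auto
    also have "\<dots> = (\<integral>\<^sup>+y. (\<integral>\<^sup>+z. ?pa z * (?pb y z * \<psi> y) \<partial>lborel) \<partial>lborel)"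
      by (rule lborel_pair.Fubini') measurable
    also have "\<dots> = (\<integral>\<^sup>+y. (\<integral>\<^sup>+z. ?pa z * ?pb y z \<partial>lborel) * \<psi> y \<partial>lborel)"
      by (subst nn_integral_multc[symmetric]) (auto simp: mult_ac)
    also have "\<dots> \<le> (\<integral>\<^sup>+y. ennreal (c * (2 * M + 1)) * ennreal (stable_profile \<theta> (a + b) (x - y)) * \<psi> y \<partial>lborel)"
      by (intro nn_integral_mono mult_right_mono inner) auto
    also have "\<dots> = ennreal (c * (2 * M + 1)) * profile_conv \<theta> (a + b) \<psi> x"
      unfolding profile_conv_def mult.assoc by (rule nn_integral_cmult) measurable
    finally show "profile_conv \<theta> a (profile_conv \<theta> b \<psi>) x \<le> ennreal (c * (2 * M + 1)) * profile_conv \<theta> (a + b) \<psi> x" .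
  qed
qed

text \<open>
  The profile at time \<open>1\<close> varies by a bounded factor over distances below \<open>\<rho>\<close>. Averaging in \<open>z\<close> over the
  ball around \<open>y\<close> and exchanging the integrals leaves the local integrals of \<open>\<psi>\<close> against a function of
  finite mass.
\<close>

lemma profile_conv_uniformly_local_bound:
  fixes \<theta> \<rho> :: real
  assumes "0 < \<theta>" "0 < \<rho>"
  obtains C where "0 \<le> C" "\<And>(\<psi> :: 'a::euclidean_space \<Rightarrow> ennreal) B x t. \<psi> \<in> borel_measurable borel \<Longrightarrow>
     (\<And>z. (\<integral>\<^sup>+y\<in>ball z \<rho>. \<psi> y \<partial>lborel) \<le> B) \<Longrightarrow> 0 < t \<Longrightarrow> t \<le> 1 \<Longrightarrow>
     profile_conv \<theta> t \<psi> x \<le> ennreal (C * t powr (- real DIM('a) / \<theta>)) * B"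
proof -
  let ?n = "DIM('a)" and ?e = "real DIM('a) + \<theta>"
  obtain M where M: "0 \<le> M" "\<And>t. 0 < t \<Longrightarrow> (\<integral>\<^sup>+(x::'a). ennreal (stable_profile \<theta> t x) \<partial>lborel) \<le> ennreal M"
    by (rule stable_profile_mass_le[OF assms(1), where 'a='a], rule that)
  define V where "V = unit_ball_vol (real ?n) * \<rho> ^ ?n"
  have V: "0 < V" using assms by (simp add: V_def)
  define c where "c = (1 + \<rho>) powr ?e"
  have c: "0 < c" using assms by (simp add: c_def)
  have time: "stable_profile \<theta> t w \<le> t powr (- real ?n / \<theta>) * stable_profile \<theta> 1 w" if t: "0 < t" "t \<le> 1" for t and w :: 'a
  proof -
    define s where "s = t powr (1 / \<theta>)"
    have s: "0 < s" "s \<le> 1" using t assms powr_mono2[of "1 / \<theta>" t 1] by (auto simp: s_def)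
    have "s * max (norm w) 1 \<le> max (norm w) s"
    proof (cases "norm w \<le> 1")
      case False
      then have "s * norm w \<le> norm w" using s by (intro mult_left_le_one_le) auto
      then show ?thesis using False s by (simp add: max_def)
    qed (simp add: max_absorb2)
    then have "max (norm w) s powr (- ?e) \<le> (s * max (norm w) 1) powr (- ?e)"
      using s(1) assms(1) by (intro powr_mono2') (simp_all add: less_max_iff_disj)
    then have "t * max (norm w) s powr (- ?e) \<le> t * (s * max (norm w) 1) powr (- ?e)"
      using t by (intro mult_left_mono) auto
    also have "\<dots> = t * s powr (- ?e) * max (norm w) 1 powr (- ?e)" by (simp only: powr_mult mult.assoc)
    also have "t * s powr (- ?e) = t powr (- real ?n / \<theta>)"
      using stable_profile_inside[OF assms(1) t(1), of "0::'a"] t by (simp add: stable_profile_def s_def)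
    finally show ?thesis by (simp add: stable_profile_def s_def)
  qed
  have space: "stable_profile \<theta> 1 w \<le> c * stable_profile \<theta> 1 w'" if "norm (w - w') < \<rho>" for w w' :: 'a
  proof -
    have m: "\<rho> \<le> \<rho> * max (norm w) 1" using assms by (simp add: mult_le_cancel_left1)
    have "norm w' \<le> norm w + norm (w - w')" by (metis norm_minus_commute norm_triangle_sub)
    also have "\<dots> \<le> (1 + \<rho>) * max (norm w) 1"
      using that m max.cobounded1[of "norm w" 1] unfolding distrib_right by linarith
    finally have "norm w' \<le> (1 + \<rho>) * max (norm w) 1" .
    moreover have "1 \<le> (1 + \<rho>) * max (norm w) 1"
      using m assms max.cobounded2[of 1 "norm w"] unfolding distrib_right by linarith
    ultimately have "max (norm w') 1 \<le> (1 + \<rho>) * max (norm w) 1" by simp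
    then have "((1 + \<rho>) * max (norm w) 1) powr (- ?e) \<le> max (norm w') 1 powr (- ?e)"
      using assms by (intro powr_mono2') (simp_all add: less_max_iff_disj)
    then have "c * ((1 + \<rho>) * max (norm w) 1) powr (- ?e) \<le> c * max (norm w') 1 powr (- ?e)"
      using c by (intro mult_left_mono) auto
    also have "c * ((1 + \<rho>) * max (norm w) 1) powr (- ?e) = max (norm w) 1 powr (- ?e)"
    proof -
      have "c * (1 + \<rho>) powr (- ?e) = 1" unfolding c_def powr_add[symmetric] using assms by simp
      then show ?thesis by (simp only: powr_mult mult.assoc[symmetric] mult_1)
    qed
    finally show ?thesis by (simp add: stable_profile_def)
  qed
  show ?thesis
  proof (rule that[of "c * M / V"])
    show "0 \<le> c * M / V" using c M V by simp
    fix \<psi> :: "'a \<Rightarrow> ennreal" and B :: ennreal and x :: 'a and t :: real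
    assume [measurable]: "\<psi> \<in> borel_measurable borel" and B: "\<And>z. (\<integral>\<^sup>+y\<in>ball z \<rho>. \<psi> y \<partial>lborel) \<le> B" and t: "0 < t" "t \<le> 1"
    let ?p1 = "\<lambda>y. ennreal (stable_profile \<theta> 1 (x - y))"
    have bm: "(\<lambda>p. indicator (ball (fst p) \<rho>) (snd p) :: ennreal) \<in> borel_measurable (lborel \<Otimes>\<^sub>M (lborel :: 'a measure))"
    proof -
      have "{p :: 'a \<times> 'a. dist (fst p) (snd p) < \<rho>} \<in> sets (borel \<Otimes>\<^sub>M borel)"
        unfolding borel_prod by (intro borel_open open_Collect_less continuous_intros)
      then have "indicator {p :: 'a \<times> 'a. dist (fst p) (snd p) < \<rho>} \<in> borel_measurable (borel \<Otimes>\<^sub>M borel)" by measurable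
      then show ?thesis by (simp add: indicator_def ball_def cong: measurable_cong_sets)
    qed
    note [measurable] = measurable_compose[OF _ bm]
    have ib [measurable]: "(indicator (ball y \<rho>) :: 'a \<Rightarrow> ennreal) \<in> borel_measurable borel" for y
      by (rule borel_measurable_indicator) simp
    have m3: "(\<lambda>(z, y). indicator (ball z \<rho>) y * (ennreal (c * stable_profile \<theta> 1 (x - z)) * \<psi> y)) \<in> borel_measurable (lborel \<Otimes>\<^sub>M lborel)"
      using bm by (simp add: case_prod_beta)
    have "ennreal V * (\<integral>\<^sup>+y. ?p1 y * \<psi> y \<partial>lborel)
       = (\<integral>\<^sup>+y. ennreal V * (?p1 y * \<psi> y) \<partial>lborel)"
      by (rule nn_integral_cmult[symmetric]) measurable
    also have "\<dots> = (\<integral>\<^sup>+y. (\<integral>\<^sup>+z. indicator (ball y \<rho>) z * (?p1 y * \<psi> y) \<partial>lborel) \<partial>lborel)"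
      using assms(2) by (subst nn_integral_multc) (auto simp: V_def emeasure_ball)
    also have "\<dots> \<le> (\<integral>\<^sup>+y. (\<integral>\<^sup>+z. indicator (ball z \<rho>) y * (ennreal (c * stable_profile \<theta> 1 (x - z)) * \<psi> y) \<partial>lborel) \<partial>lborel)"
    proof (intro nn_integral_mono)
      fix y z :: 'a
      show "indicator (ball y \<rho>) z * (?p1 y * \<psi> y) \<le> indicator (ball z \<rho>) y * (ennreal (c * stable_profile \<theta> 1 (x - z)) * \<psi> y)"
      proof (cases "dist y z < \<rho>")
        case True
        have "stable_profile \<theta> 1 (x - y) \<le> c * stable_profile \<theta> 1 (x - z)"
          using True by (intro space) (simp add: dist_norm norm_minus_commute)
        then show ?thesis using True by (simp add: dist_commute mult_right_mono ennreal_leI)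
      qed simp
    qed
    also have "\<dots> = (\<integral>\<^sup>+z. (\<integral>\<^sup>+y. indicator (ball z \<rho>) y * (ennreal (c * stable_profile \<theta> 1 (x - z)) * \<psi> y) \<partial>lborel) \<partial>lborel)"
      by (rule lborel_pair.Fubini'[OF m3])
    also have "\<dots> = (\<integral>\<^sup>+z. ennreal (c * stable_profile \<theta> 1 (x - z)) * (\<integral>\<^sup>+y\<in>ball z \<rho>. \<psi> y \<partial>lborel) \<partial>lborel)"
      by (subst nn_integral_cmult[symmetric]) (auto simp: mult_ac)
    also have "\<dots> \<le> (\<integral>\<^sup>+z. ennreal (c * stable_profile \<theta> 1 (x - z)) * B \<partial>lborel)"
      by (intro nn_integral_mono mult_left_mono B) auto
    also have "\<dots> = ennreal c * (\<integral>\<^sup>+z. ennreal (stable_profile \<theta> 1 (x - z)) \<partial>lborel) * B"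
      using c by (subst nn_integral_cmult[symmetric], measurable, subst nn_integral_multc[symmetric]) (auto simp: ennreal_mult')
    also have "(\<integral>\<^sup>+z. ennreal (stable_profile \<theta> 1 (x - z)) \<partial>lborel) = (\<integral>\<^sup>+(z::'a). ennreal (stable_profile \<theta> 1 z) \<partial>lborel)"
      by (rule nn_integral_lborel_reflect) measurable
    also have "ennreal c * \<dots> * B \<le> ennreal c * ennreal M * B"
      by (intro mult_right_mono mult_left_mono M) auto
    finally have 1: "ennreal V * profile_conv \<theta> 1 \<psi> x \<le> ennreal (c * M) * B"
      using c M by (simp add: profile_conv_def ennreal_mult')
    have "profile_conv \<theta> 1 \<psi> x = ennreal (1 / V) * (ennreal V * profile_conv \<theta> 1 \<psi> x)"
      using V by (simp add: mult.assoc[symmetric] ennreal_mult'[symmetric])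
    also have "\<dots> \<le> ennreal (1 / V) * (ennreal (c * M) * B)" by (rule mult_left_mono[OF 1]) simp
    also have "\<dots> = ennreal (c * M / V) * B"
      using V c M by (simp add: mult.assoc[symmetric] ennreal_mult'[symmetric])
    finally have 2: "profile_conv \<theta> 1 \<psi> x \<le> ennreal (c * M / V) * B" .
    have "profile_conv \<theta> t \<psi> x \<le> (\<integral>\<^sup>+y. ennreal (t powr (- real ?n / \<theta>)) * (?p1 y * \<psi> y) \<partial>lborel)"
      unfolding profile_conv_def
    proof (intro nn_integral_mono)
      fix y
      have "ennreal (stable_profile \<theta> t (x - y)) \<le> ennreal (t powr (- real ?n / \<theta>)) * ?p1 y"
        using ennreal_leI[OF time[OF t, of "x - y"]] by (simp add: ennreal_mult')
      then show "ennreal (stable_profile \<theta> t (x - y)) * \<psi> y \<le> ennreal (t powr (- real ?n / \<theta>)) * (?p1 y * \<psi> y)"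
        unfolding mult.assoc[symmetric] by (rule mult_right_mono) simp
    qed
    also have "\<dots> = ennreal (t powr (- real ?n / \<theta>)) * profile_conv \<theta> 1 \<psi> x"
      unfolding profile_conv_def by (rule nn_integral_cmult) measurable
    also have "\<dots> \<le> ennreal (t powr (- real ?n / \<theta>)) * (ennreal (c * M / V) * B)" by (rule mult_left_mono[OF 2]) simp
    also have "\<dots> = ennreal (c * M / V * t powr (- real ?n / \<theta>)) * B"
    proof -
      have "ennreal (c * M / V * t powr (- real ?n / \<theta>)) = ennreal (c * M / V) * ennreal (t powr (- real ?n / \<theta>))"
        by (rule ennreal_mult') (use V c M(1) in simp)
      then show ?thesis by (simp only: mult_ac)
    qed
    finally show "profile_conv \<theta> t \<psi> x \<le> ennreal (c * M / V * t powr (- real ?n / \<theta>)) * B" .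
  qed
qed

lemma frac_heat_kernel_conv_le_profile_conv:
  assumes "0 < \<theta>" "\<theta> \<le> 2"
  obtains A where "0 < A" "\<And>(\<psi> :: real ^ 'n \<Rightarrow> ennreal) t x. 0 < t \<Longrightarrow> \<psi> \<in> borel_measurable borel \<Longrightarrow>
    (\<integral>\<^sup>+y. ennreal (frac_heat_kernel \<theta> (x - y) t) * \<psi> y \<partial>lborel) \<le> ennreal A * profile_conv \<theta> t \<psi> x"
proof -
  obtain A where A: "0 < A" and kP: "\<And>(x :: real ^ 'n) t. 0 < t \<Longrightarrow> frac_heat_kernel \<theta> x t \<le> A * stable_profile \<theta> t x"
    by (rule frac_heat_kernel_le_stable_profile[OF assms, where 'n = 'n], rule that)
  show ?thesis
  proof (rule that[OF A])
    fix \<psi> :: "real ^ 'n \<Rightarrow> ennreal" and t :: real and x assume t: "0 < t" and [measurable]: "\<psi> \<in> borel_measurable borel"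
    have "(\<integral>\<^sup>+y. ennreal (frac_heat_kernel \<theta> (x - y) t) * \<psi> y \<partial>lborel) \<le> (\<integral>\<^sup>+y. ennreal A * (ennreal (stable_profile \<theta> t (x - y)) * \<psi> y) \<partial>lborel)"
    proof (intro nn_integral_mono)
      fix y
      have "ennreal (frac_heat_kernel \<theta> (x - y) t) \<le> ennreal (A * stable_profile \<theta> t (x - y))"
        by (rule ennreal_leI[OF kP[OF t]])
      also have "\<dots> = ennreal A * ennreal (stable_profile \<theta> t (x - y))" using A by (intro ennreal_mult') auto
      finally show "ennreal (frac_heat_kernel \<theta> (x - y) t) * \<psi> y \<le> ennreal A * (ennreal (stable_profile \<theta> t (x - y)) * \<psi> y)"
        unfolding mult.assoc[symmetric] by (rule mult_right_mono) simp
    qed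
    also have "\<dots> = ennreal A * profile_conv \<theta> t \<psi> x"
      unfolding profile_conv_def by (rule nn_integral_cmult) measurable
    finally show "(\<integral>\<^sup>+y. ennreal (frac_heat_kernel \<theta> (x - y) t) * \<psi> y \<partial>lborel) \<le> ennreal A * profile_conv \<theta> t \<psi> x" .
  qed
qed


section \<open>The source term and its tail integral\<close>

locale regular_source =
  fixes f :: "real \<Rightarrow> real" and q :: real
  assumes C1: "f C1_differentiable_on {0<..}"
    and cont: "continuous_on {0..} f"
    and pos: "0 < u \<Longrightarrow> 0 < f u"
    and deriv_ge: "0 \<le> u \<Longrightarrow> (f has_real_derivative D) (at u within {0..}) \<Longrightarrow> 0 \<le> D"
    and tail_fin: "eventually (\<lambda>u. tail_int f u < \<infinity>) at_top"
    and lim: "((\<lambda>u. deriv f u * enn2real (tail_int f u)) \<longlongrightarrow> q) at_top"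
    and q: "1 < q"
begin

definition F :: "real \<Rightarrow> real" where "F u = enn2real (tail_int f u)"

lemma f_has_deriv: "0 < u \<Longrightarrow> (f has_real_derivative deriv f u) (at u)"
proof -
  assume "0 < u"
  then obtain D where "(f has_vector_derivative D) (at u)"
    using C1 unfolding C1_differentiable_on_def by auto
  then have "(f has_real_derivative D) (at u)" by (simp add: has_real_derivative_iff_has_vector_derivative)
  then show ?thesis by (metis DERIV_imp_deriv)
qed

lemma deriv_f_nonneg: "0 < u \<Longrightarrow> 0 \<le> deriv f u"
  using deriv_ge f_has_deriv has_field_derivative_at_within less_imp_le by blast

lemma f_mono:
  assumes "0 \<le> a" "a \<le> b"
  shows "f a \<le> f b"
proof (rule DERIV_nonneg_imp_increasing_open[of a b f])
  from assms show "continuous_on {a..b} f" by (intro continuous_on_subset[OF cont]) auto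
  fix x assume "a < x"
  then show "\<exists>y. DERIV f x :> y \<and> 0 \<le> y"
    using assms(1) f_has_deriv[of x] deriv_f_nonneg[of x] by auto
qed (use assms in auto)

lemma cont_recip: "0 < a \<Longrightarrow> continuous_on {a..} (\<lambda>t. 1 / f t)"
  using pos by (intro continuous_intros continuous_on_subset[OF cont]) (auto simp: less_imp_neq[symmetric] dest: less_le_trans)

lemma recip_measurable: "0 < a \<Longrightarrow> a \<le> b \<Longrightarrow> (\<lambda>t. ennreal (1 / f t) * indicator {b..} t) \<in> borel_measurable borel"
proof -
  assume "0 < a" "a \<le> b"
  then have "(\<lambda>t. indicator {b..} t *\<^sub>R (1 / f t)) \<in> borel_measurable borel"
    by (intro borel_measurable_continuous_on_indicator cont_recip) auto
  then have "(\<lambda>t. ennreal (indicator {b..} t *\<^sub>R (1 / f t))) \<in> borel_measurable borel" by measurable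
  also have "(\<lambda>t. ennreal (indicator {b..} t *\<^sub>R (1 / f t))) = (\<lambda>t. ennreal (1 / f t) * indicator {b..} t)"
    by (auto simp: indicator_def)
  finally show ?thesis .
qed

text \<open>
  The continuous integrand makes the integral over \<open>[a, b]\<close> a Henstock-Kurzweil integral, which can be
  differentiated in its endpoint.
\<close>

lemma tail_int_split:
  assumes "0 < a" "a \<le> b"
  shows "tail_int f a = ennreal (integral {a..b} (\<lambda>t. 1 / f t)) + tail_int f b"
proof -
  have c: "continuous_on {a..b} (\<lambda>t. 1 / f t)" using cont_recip[OF assms(1)] by (rule continuous_on_subset) auto
  have "(\<integral>\<^sup>+t. ennreal (1 / f t) * indicator {a..b} t \<partial>lborel) = ennreal (integral {a..b} (\<lambda>t. 1 / f t))"
  proof (rule nn_integral_has_integral_lebesgue')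
    show "0 \<le> 1 / f t" if "t \<in> {a..b}" for t using that assms pos[of t] by simp
    show "((\<lambda>t. 1 / f t) has_integral integral {a..b} (\<lambda>t. 1 / f t)) {a..b}"
      using c by (intro integrable_integral integrable_continuous_real)
  qed
  moreover have m: "(\<lambda>t. ennreal (1 / f t) * indicator {a..b} t) \<in> borel_measurable lborel"
  proof -
    have "(\<lambda>t. indicator {a..b} t *\<^sub>R (1 / f t)) \<in> borel_measurable borel"
      using c by (intro borel_measurable_continuous_on_indicator) auto
    then have "(\<lambda>t. ennreal (indicator {a..b} t *\<^sub>R (1 / f t))) \<in> borel_measurable borel" by measurable
    also have "(\<lambda>t. ennreal (indicator {a..b} t *\<^sub>R (1 / f t))) = (\<lambda>t. ennreal (1 / f t) * indicator {a..b} t)"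
      by (auto simp: indicator_def)
    finally show ?thesis by simp
  qed
  moreover have "(\<integral>\<^sup>+t\<in>{a..}. ennreal (1 / f t) \<partial>lborel)
      = (\<integral>\<^sup>+t. ennreal (1 / f t) * indicator {a..b} t + ennreal (1 / f t) * indicator {b..} t \<partial>lborel)"
    using assms by (intro nn_integral_cong_AE AE_I[of _ _ "{b}"]) (auto simp: indicator_def)
  ultimately show ?thesis
    using recip_measurable[OF assms] unfolding tail_int_def nn_integral_completion
    by (simp add: nn_integral_add)
qed

lemma tail_int_finite: "0 < u \<Longrightarrow> tail_int f u < \<infinity>"
proof -
  assume u: "0 < u"
  obtain K where K: "\<And>v. K \<le> v \<Longrightarrow> tail_int f v < \<infinity>" using tail_fin by (auto simp: eventually_at_top_linorder)
  have "tail_int f u = ennreal (integral {u..max u K} (\<lambda>t. 1 / f t)) + tail_int f (max u K)"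
    using u by (intro tail_int_split) auto
  also have "\<dots> < \<infinity>" using K[of "max u K"] by simp
  finally show ?thesis .
qed

lemma F_split: "0 < a \<Longrightarrow> a \<le> b \<Longrightarrow> F a = integral {a..b} (\<lambda>t. 1 / f t) + F b"
proof -
  assume ab: "0 < a" "a \<le> b"
  have "0 \<le> 1 / f t" if "t \<in> {a..b}" for t using that ab pos[of t] by simp
  then have "0 \<le> integral {a..b} (\<lambda>t. 1 / f t)"
    using cont_recip[OF ab(1)] by (intro integral_nonneg integrable_continuous_real continuous_on_subset[OF cont_recip[OF ab(1)]]) auto
  then show ?thesis
    unfolding F_def tail_int_split[OF ab] using tail_int_finite[of b] ab by (subst enn2real_plus) auto
qed

lemma F_has_deriv: "0 < u \<Longrightarrow> (F has_real_derivative - (1 / f u)) (at u)"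
proof -
  assume u: "0 < u"
  let ?a = "u / 2" and ?b = "u + 1"
  have "((\<lambda>x. integral {?a..x} (\<lambda>t. 1 / f t)) has_real_derivative 1 / f u) (at u within {?a..?b})"
    using u by (intro integral_has_real_derivative continuous_on_subset[OF cont_recip[of ?a]]) auto
  moreover have "at u within {?a..?b} = at u" using u by (intro at_within_interior) auto
  ultimately have "((\<lambda>x. F ?a - integral {?a..x} (\<lambda>t. 1 / f t)) has_real_derivative - (1 / f u)) (at u)"
    by (auto intro!: derivative_eq_intros)
  moreover have "eventually (\<lambda>x. x \<in> {?a<..}) (nhds u)"
    by (rule eventually_nhds_in_open) (use u in auto)
  then have "eventually (\<lambda>x. F x = F ?a - integral {?a..x} (\<lambda>t. 1 / f t)) (nhds u)"
      proof eventually_elim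
    case (elim x)
    then show ?case using u F_split[of ?a x] by simp
  qed
  ultimately show ?thesis by (simp cong: DERIV_cong_ev)
qed

lemma F_strict_antimono:
  assumes "0 < a" "a < b"
  shows "F b < F a"
proof (rule DERIV_neg_imp_decreasing[OF assms(2)])
  fix x assume "a \<le> x"
  then show "\<exists>y. (F has_real_derivative y) (at x) \<and> y < 0"
    using assms F_has_deriv[of x] pos[of x] by (intro exI[of _ "- (1 / f x)"]) auto
qed

lemma F_antimono: "0 < a \<Longrightarrow> a \<le> b \<Longrightarrow> F b \<le> F a"
  using F_strict_antimono[of a b] by (cases "a = b") auto

lemma F_pos: "0 < u \<Longrightarrow> 0 < F u"
  using F_strict_antimono[of u "u + 1"] enn2real_nonneg[of "tail_int f (u + 1)"] unfolding F_def by linarith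

lemma tail_int_neg_powr_eq: "0 < u \<Longrightarrow> tail_int_neg_powr f r u = F u powr (- r)"
  using tail_int_finite[of u] by (simp add: tail_int_neg_powr_def F_def powr_minus_divide)

lemma F_powr_mono:
  assumes "0 < a" "a \<le> b" "0 < r"
  shows "F a powr (- r) \<le> F b powr (- r)"
  using F_antimono[OF assms(1,2)] F_pos[of b] assms by (intro powr_mono2') auto

lemma continuous_on_F: "A \<subseteq> {0<..} \<Longrightarrow> continuous_on A F"
  by (intro continuous_at_imp_continuous_on ballI DERIV_isCont[OF F_has_deriv]) auto

lemma tail_int_neg_powr_measurable:
  assumes \<phi>: "\<phi> \<in> borel_measurable M" and nonneg: "\<And>x. 0 \<le> \<phi> x"
  shows "(\<lambda>x. tail_int_neg_powr f r (\<phi> x)) \<in> borel_measurable M"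
proof -
  let ?h = "\<lambda>u. if u = 0 then tail_int_neg_powr f r 0 else (indicator {0<..} u *\<^sub>R F u) powr (- r)"
  have [measurable]: "(\<lambda>u. indicator {0<..} u *\<^sub>R F u) \<in> borel_measurable borel"
    by (intro borel_measurable_continuous_on_indicator continuous_on_F) auto
  have "?h \<in> borel_measurable borel" by measurable
  then have "(\<lambda>x. ?h (\<phi> x)) \<in> borel_measurable M" by (rule measurable_compose[OF \<phi>])
  moreover have eq: "?h u = tail_int_neg_powr f r u" if "0 \<le> u" for u
    using that tail_int_neg_powr_eq[of u r] by (cases "u = 0") auto
  have "(\<lambda>x. ?h (\<phi> x)) = (\<lambda>x. tail_int_neg_powr f r (\<phi> x))" by (rule ext, rule eq, rule nonneg)
  ultimately show ?thesis by (simp only:)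
qed

lemma fF_has_deriv: "0 < u \<Longrightarrow> ((\<lambda>u. f u * F u) has_real_derivative deriv f u * F u - 1) (at u)"
  using DERIV_mult[OF f_has_deriv F_has_deriv, of u] pos[of u] by (simp add: mult.commute)

text \<open>
  The derivative \<open>f' F - 1\<close> of \<open>f F\<close> tends to \<open>q - 1 > 0\<close>, so \<open>f F\<close> grows at least linearly.
\<close>

lemma fF_lower: obtains \<kappa> K where "0 < \<kappa>" "0 < K" "\<And>u. K \<le> u \<Longrightarrow> \<kappa> * u \<le> f u * F u"
proof -
  define d where "d = (q - 1) / 2"
  have d: "0 < d" using q by (simp add: d_def)
  have "eventually (\<lambda>u. 1 + d < deriv f u * F u) at_top"
    using lim unfolding F_def by (rule order_tendstoD) (use q in \<open>simp add: d_def field_simps\<close>)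
  then obtain K0 where K0: "\<And>u. K0 \<le> u \<Longrightarrow> 1 + d < deriv f u * F u" by (auto simp: eventually_at_top_linorder)
  define K where "K = max K0 1"
  have K: "0 < K" by (simp add: K_def)
  have low: "d * (u - K) \<le> f u * F u" if "K \<le> u" for u
  proof -
    have "f K * F K - d * K \<le> f u * F u - d * u"
    proof (rule DERIV_nonneg_imp_nondecreasing[OF that])
      fix x assume x: "K \<le> x"
      have "((\<lambda>u. f u * F u - d * u) has_real_derivative (deriv f x * F x - 1) - d) (at x)"
        using x K DERIV_diff[OF fF_has_deriv DERIV_cmult[OF DERIV_ident, of d], of x] by simp
      moreover have "0 \<le> (deriv f x * F x - 1) - d" using K0[of x] x by (simp add: K_def)
      ultimately show "\<exists>y. ((\<lambda>u. f u * F u - d * u) has_real_derivative y) (at x) \<and> 0 \<le> y" by blast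
    qed
    moreover have "0 < f K * F K" using K pos F_pos by simp
    ultimately show ?thesis by (simp add: right_diff_distrib)
  qed
  show ?thesis
  proof (rule that[of "d / 2" "2 * K"])
    fix u assume u: "2 * K \<le> u"
    have "d / 2 * u \<le> d * (u - K)" using mult_left_mono[OF u, of d] d by (simp add: field_simps)
    also have "\<dots> \<le> f u * F u" using u K by (intro low) auto
    finally show "d / 2 * u \<le> f u * F u" .
  qed (use d K in auto)
qed

lemma fF_upper:
  assumes "eventually (\<lambda>u. deriv f u * F u \<le> p) at_top"
  obtains C K where "0 < C" "0 < K" "\<And>u. K \<le> u \<Longrightarrow> f u * F u \<le> C * u"
proof -
  obtain K0 where K0: "\<And>u. K0 \<le> u \<Longrightarrow> deriv f u * F u \<le> p" using assms by (auto simp: eventually_at_top_linorder)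
  define K where "K = max K0 1"
  have K: "1 \<le> K" by (simp add: K_def)
  define P where "P = max p 1"
  have up: "f u * F u \<le> (f K * F K + P) * u" if u: "K \<le> u" for u
  proof -
    have "P * K - f K * F K \<le> P * u - f u * F u"
    proof (rule DERIV_nonneg_imp_nondecreasing[OF u])
      fix x assume x: "K \<le> x"
      have "((\<lambda>u. P * u - f u * F u) has_real_derivative P - (deriv f x * F x - 1)) (at x)"
        using x K DERIV_diff[OF DERIV_cmult[OF DERIV_ident, of P] fF_has_deriv, of x] by simp
      moreover have "0 \<le> P - (deriv f x * F x - 1)" using K0[of x] x by (simp add: K_def P_def)
      ultimately show "\<exists>y. ((\<lambda>u. P * u - f u * F u) has_real_derivative y) (at x) \<and> 0 \<le> y" by blast
    qed
    moreover have "0 < f K * F K" "0 \<le> P * K" using K pos[of K] F_pos[of K] by (auto simp: P_def)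
    moreover from this have "f K * F K \<le> f K * F K * u" using u K mult_left_mono[of 1 u "f K * F K"] by simp
    ultimately show ?thesis by (simp add: distrib_right)
  qed
  show ?thesis
    by (rule that[of "f K * F K + P" K]) (use K pos[of K] F_pos[of K] up in \<open>auto simp: P_def intro!: add_pos_pos\<close>)
qed

text \<open>The lower bound of \<open>f F\<close> bounds the logarithmic derivative of \<open>F\<close>, so
  \<open>u\<close>\<open>\<^sup>\<gamma>\<close>\<open> F u\<close> is nondecreasing for large \<open>u\<close>: rescaling the argument costs only a constant factor.\<close>

lemma F_scale:
  obtains \<gamma> K where "0 < \<gamma>" "0 < K" "\<And>u l. K \<le> u \<Longrightarrow> 1 \<le> l \<Longrightarrow> F u \<le> l powr \<gamma> * F (l * u)"
proof -
  obtain \<kappa> K where \<kappa>: "0 < \<kappa>" and K: "0 < K" and low: "\<And>u. K \<le> u \<Longrightarrow> \<kappa> * u \<le> f u * F u"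
    by (rule fF_lower, rule that)
  define \<gamma> where "\<gamma> = 1 / \<kappa>"
  have \<gamma>: "0 < \<gamma>" using \<kappa> by (simp add: \<gamma>_def)
  show ?thesis
  proof (rule that[OF \<gamma> K])
    fix u l :: real assume u: "K \<le> u" and l: "1 \<le> l"
    have u0: "0 < u" using u K by simp
    have ul: "u \<le> l * u" using l u0 by simp
    have "u powr \<gamma> * F u \<le> (l * u) powr \<gamma> * F (l * u)"
    proof (rule DERIV_nonneg_imp_nondecreasing[OF ul])
      fix x assume x: "u \<le> x"
      have x0: "0 < x" "K \<le> x" using x u0 u by auto
      have "((\<lambda>x. x powr \<gamma> * F x) has_real_derivative \<gamma> * x powr (\<gamma> - 1) * F x + x powr \<gamma> * - (1 / f x)) (at x)"
        using x0 by (auto intro!: derivative_eq_intros F_has_deriv)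
      moreover have "0 \<le> \<gamma> * x powr (\<gamma> - 1) * F x + x powr \<gamma> * - (1 / f x)"
      proof -
        have "x / f x \<le> \<gamma> * F x"
          using low[OF x0(2)] pos[OF x0(1)] \<kappa> by (simp add: \<gamma>_def field_simps)
        then have "x powr (\<gamma> - 1) * (x / f x) \<le> x powr (\<gamma> - 1) * (\<gamma> * F x)" by (intro mult_left_mono) auto
        moreover have "x powr (\<gamma> - 1) * (x / f x) = x powr \<gamma> * (1 / f x)" using x0 by (simp add: powr_diff)
        ultimately show ?thesis by (simp only: mult_minus_right mult_ac)
      qed
      ultimately show "\<exists>y. ((\<lambda>x. x powr \<gamma> * F x) has_real_derivative y) (at x) \<and> 0 \<le> y" by blast
    qed
    also have "(l * u) powr \<gamma> * F (l * u) = u powr \<gamma> * (l powr \<gamma> * F (l * u))" by (simp only: powr_mult mult_ac)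
    finally show "F u \<le> l powr \<gamma> * F (l * u)" using u0 by (simp add: mult_le_cancel_left_pos)
  qed
qed

text \<open>
  Conversely, an at most linear growth of \<open>f F\<close> makes \<open>u\<close>\<open>\<^sup>\<gamma>\<close>\<open> F u\<close> nonincreasing for a small \<open>\<gamma>\<close>, a polynomial rate of decay.
\<close>

lemma F_tendsto_0: "(F \<longlongrightarrow> 0) at_top"
proof -
  have "eventually (\<lambda>u. deriv f u * F u < q + 1) at_top"
    using lim unfolding F_def by (rule order_tendstoD) simp
  then have ev: "eventually (\<lambda>u. deriv f u * F u \<le> q + 1) at_top" by eventually_elim simp
  obtain C K where C: "0 < C" and K: "0 < K" and up: "\<And>u. K \<le> u \<Longrightarrow> f u * F u \<le> C * u"
    by (rule fF_upper[OF ev], rule that)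
  define \<gamma> where "\<gamma> = 1 / C"
  have \<gamma>: "0 < \<gamma>" using C by (simp add: \<gamma>_def)
  have le: "F u \<le> (K powr \<gamma> * F K) * u powr (- \<gamma>)" if u: "K \<le> u" for u
  proof -
    have "u powr \<gamma> * F u \<le> K powr \<gamma> * F K"
    proof (rule DERIV_nonpos_imp_nonincreasing[OF u])
      fix x assume x: "K \<le> x"
      have x0: "0 < x" using x K by simp
      have "((\<lambda>x. x powr \<gamma> * F x) has_real_derivative \<gamma> * x powr (\<gamma> - 1) * F x + x powr \<gamma> * - (1 / f x)) (at x)"
        using x0 by (auto intro!: derivative_eq_intros F_has_deriv)
      moreover have "\<gamma> * x powr (\<gamma> - 1) * F x + x powr \<gamma> * - (1 / f x) \<le> 0"
      proof -
        have "\<gamma> * F x \<le> x / f x"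
          using up[OF x] pos[OF x0] C by (simp add: \<gamma>_def field_simps)
        then have "x powr (\<gamma> - 1) * (\<gamma> * F x) \<le> x powr (\<gamma> - 1) * (x / f x)" by (intro mult_left_mono) auto
        moreover have "x powr (\<gamma> - 1) * (x / f x) = x powr \<gamma> * (1 / f x)" using x0 by (simp add: powr_diff)
        ultimately show ?thesis by (simp only: mult_minus_right mult_ac)
      qed
      ultimately show "\<exists>y. ((\<lambda>x. x powr \<gamma> * F x) has_real_derivative y) (at x) \<and> y \<le> 0" by blast
    qed
    then show ?thesis using u K by (simp add: powr_minus_divide field_simps)
  qed
  have "((\<lambda>u. (K powr \<gamma> * F K) * u powr (- \<gamma>)) \<longlongrightarrow> 0) at_top"
    using \<gamma> by (intro tendsto_mult_right_zero tendsto_neg_powr filterlim_ident) auto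
  then show ?thesis
  proof (rule Lim_null_comparison[rotated])
    show "eventually (\<lambda>u. norm (F u) \<le> (K powr \<gamma> * F K) * u powr (- \<gamma>)) at_top"
      unfolding eventually_at_top_linorder using le by (intro exI[of _ K]) (simp add: F_def)
  qed
qed

lemma F_inverse:
  assumes "0 < \<tau>" "\<tau> \<le> F 1"
  obtains v where "1 \<le> v" "F v = \<tau>"
proof -
  have "eventually (\<lambda>u. F u < \<tau>) at_top" using F_tendsto_0 assms(1) by (rule order_tendstoD)
  then obtain b where b: "\<And>u. b \<le> u \<Longrightarrow> F u < \<tau>" by (auto simp: eventually_at_top_linorder)
  have "\<exists>x. 1 \<le> x \<and> x \<le> max 1 b \<and> F x = \<tau>"
  proof (rule IVT2')
    show "F (max 1 b) \<le> \<tau>" using b[of "max 1 b"] by simp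
    show "continuous_on {1..max 1 b} F"
      by (intro continuous_at_imp_continuous_on ballI DERIV_isCont[OF F_has_deriv]) auto
  qed (use assms in auto)
  then show ?thesis using that by blast
qed

text \<open>
  The bound \<open>f' F \<le> r + 1\<close> near infinity is equivalent to convexity of \<open>F\<close>\<open>\<^sup>-\<^sup>r\<close>; the supporting lines are what
  the estimate of the supersolution uses.
\<close>

lemma F_powr_supporting_line:
  assumes ev: "eventually (\<lambda>u. deriv f u * F u \<le> r + 1) at_top" and r: "0 < r"
  obtains K where "0 < K"
    "\<And>v0. K \<le> v0 \<Longrightarrow> \<exists>s>0. \<forall>v\<ge>K. F v0 powr (- r) + s * (v - v0) \<le> F v powr (- r)"
proof -
  obtain K0 where K0: "\<And>u. K0 \<le> u \<Longrightarrow> deriv f u * F u \<le> r + 1" using ev by (auto simp: eventually_at_top_linorder)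
  define K where "K = max K0 1"
  have K: "0 < K" "K0 \<le> K" by (simp_all add: K_def)
  define g' where "g' v = r * F v powr (- r - 1) / f v" for v
  define g'' where "g'' v = r * F v powr (- r - 2) / f v ^ 2 * ((r + 1) - deriv f v * F v)" for v
  have d1: "((\<lambda>v. F v powr (- r)) has_real_derivative g' v) (at v)" if "v \<in> {K..}" for v
  proof -
    have v: "0 < v" using that K by auto
    show ?thesis unfolding g'_def
      by (rule derivative_eq_intros F_has_deriv F_pos v refl)+ (simp add: field_simps)
  qed
  have d2: "(g' has_real_derivative g'' v) (at v)" if "v \<in> {K..}" for v
  proof -
    have v: "0 < v" using that K by auto
    have fv: "f v \<noteq> 0" using pos[OF v] by simp
    have p: "F v powr (- r - 1) = F v powr (- r - 2) * F v"
    proof -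
      have "- r - 1 = (- r - 2) + 1" by simp
      then have "F v powr (- r - 1) = F v powr (- r - 2) * F v powr 1" by (metis powr_add)
      then show ?thesis using F_pos[OF v] by simp
    qed
    have "((\<lambda>v. F v powr (- r - 1)) has_real_derivative (r + 1) * F v powr (- r - 2) / f v) (at v)"
      by (rule derivative_eq_intros F_has_deriv F_pos v refl)+ (use fv in \<open>simp add: field_simps\<close>)
    from DERIV_divide[OF DERIV_cmult[OF this, of r] f_has_deriv[OF v] fv]
    have "(g' has_real_derivative (r * ((r + 1) * F v powr (- r - 2) / f v) * f v - r * F v powr (- r - 1) * deriv f v) / (f v * f v)) (at v)"
      unfolding g'_def[abs_def] by simp
    also have "(r * ((r + 1) * F v powr (- r - 2) / f v) * f v - r * F v powr (- r - 1) * deriv f v) / (f v * f v) = g'' v"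
      unfolding g''_def p using fv by (simp add: power2_eq_square field_simps)
    finally show ?thesis .
  qed
  have nn: "0 \<le> g'' v" if "v \<in> {K..}" for v
    using K0[of v] that K r unfolding g''_def by (intro mult_nonneg_nonneg divide_nonneg_nonneg) auto
  show ?thesis
  proof (rule that[OF K(1)])
    fix v0 assume v0: "K \<le> v0"
    have "0 < g' v0" unfolding g'_def using v0 K r pos[of v0] F_pos[of v0] by simp
    moreover have "F v0 powr (- r) + g' v0 * (v - v0) \<le> F v powr (- r)" if "K \<le> v" for v
      using f''_imp_f'[of "{K..}", OF _ d1 d2 nn, of v0 v] v0 that by auto
    ultimately show "\<exists>s>0. \<forall>v\<ge>K. F v0 powr (- r) + s * (v - v0) \<le> F v powr (- r)" by blast
  qed
qed

end


section \<open>Nonexistence\<close>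

text \<open>
  A fixed part of the mass of the kernel lies within a multiple of \<open>t\<close>\<open>\<^sup>1\<^sup>/\<^sup>\<theta>\<close> of its centre. Up to the
  diffusive time of a ball, a fixed part of that mass stays in the ball, even for centres near its boundary.
\<close>

lemma frac_heat_kernel_ball_mass:
  assumes "0 < \<theta>"
  obtains \<delta> \<epsilon> where "0 < \<delta>" "0 < \<epsilon>" "\<epsilon> \<le> 1" "\<And>R t (x :: real ^ 'n). 0 < R \<Longrightarrow> 0 < t \<Longrightarrow> t \<le> 2 * R powr \<theta> \<Longrightarrow> norm x < \<epsilon> * R \<Longrightarrow>
    ennreal \<delta> \<le> (\<integral>\<^sup>+y\<in>ball 0 (\<epsilon> * R). ennreal (frac_heat_kernel \<theta> (x - y) t) \<partial>lebesgue)"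
proof -
  obtain c \<epsilon>0 where c: "0 < c" and \<epsilon>0: "0 < \<epsilon>0" and low: "\<And>(x :: real ^ 'n) t. 0 < t \<Longrightarrow> norm x \<le> \<epsilon>0 * t powr (1 / \<theta>) \<Longrightarrow>
     c * t powr (- real CARD('n) / \<theta>) \<le> frac_heat_kernel \<theta> x t"
    by (rule frac_heat_kernel_lower_bound[OF assms, where 'n = 'n], rule that)
  define D where "D = (2 :: real) powr (1 / \<theta>)"
  have D: "0 < D" by (simp add: D_def)
  define \<eta> where "\<eta> = min \<epsilon>0 (2 / D)"
  have \<eta>: "0 < \<eta>" "\<eta> \<le> \<epsilon>0" "\<eta> \<le> 2 / D" using \<epsilon>0 D by (simp_all add: \<eta>_def)
  define \<epsilon> where "\<epsilon> = \<eta> * D / 2"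
  define V where "V = unit_ball_vol (real CARD('n))"
  have V: "0 < V" by (simp add: V_def)
  show ?thesis
  proof (rule that[of "c * V * (\<eta> / 2) ^ CARD('n)" \<epsilon>])
    show "0 < c * V * (\<eta> / 2) ^ CARD('n)" using c V \<eta> by simp
    show \<epsilon>: "0 < \<epsilon>" using \<eta> D by (simp add: \<epsilon>_def)
    show "\<epsilon> \<le> 1" using \<eta>(3) D by (simp add: \<epsilon>_def field_simps)
    fix R t :: real and x :: "real ^ 'n"
    assume R: "0 < R" and t: "0 < t" and tR: "t \<le> 2 * R powr \<theta>" and x: "norm x < \<epsilon> * R"
    define l where "l = \<eta> * t powr (1 / \<theta>)"
    have l: "0 < l" using \<eta> t by (simp add: l_def)
    have bl: "l / 2 \<le> \<epsilon> * R"
    proof -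
      have "t powr (1 / \<theta>) \<le> (2 * R powr \<theta>) powr (1 / \<theta>)" using t tR assms by (intro powr_mono2) auto
      also have "\<dots> = D * R" unfolding powr_mult powr_powr D_def using assms R by simp
      finally have "\<eta> * t powr (1 / \<theta>) \<le> \<eta> * (D * R)" using \<eta> by (intro mult_left_mono) auto
      then show ?thesis by (simp add: l_def \<epsilon>_def)
    qed
    \<comment> \<open>Pulling \<open>x\<close> towards the origin yields a ball of radius \<open>l / 2\<close> that lies in the large ball and near \<open>x\<close>.\<close>
    define p where "p = l / (2 * (\<epsilon> * R))"
    have eR: "0 < \<epsilon> * R" using \<epsilon> R by simp
    have p: "0 \<le> p" "p \<le> 1" using l eR bl by (simp_all add: p_def field_simps)
    have sub: "ball ((1 - p) *\<^sub>R x) (l / 2) \<subseteq> ball 0 (\<epsilon> * R) \<inter> {y. norm (x - y) \<le> l}"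
    proof
      fix y assume y: "y \<in> ball ((1 - p) *\<^sub>R x) (l / 2)"
      have pe: "p * (\<epsilon> * R) = l / 2" using \<epsilon> R by (simp add: p_def)
      have y': "norm ((1 - p) *\<^sub>R x - y) < l / 2" using y by (simp add: dist_norm)
      have "norm y \<le> norm ((1 - p) *\<^sub>R x) + norm ((1 - p) *\<^sub>R x - y)" by (metis norm_minus_commute norm_triangle_sub add.commute)
      also have "norm ((1 - p) *\<^sub>R x) = (1 - p) * norm x" using p by simp
      also have "(1 - p) * norm x \<le> (1 - p) * (\<epsilon> * R)" using p x by (intro mult_left_mono) auto
      also have "\<dots> = \<epsilon> * R - l / 2" using pe by (simp add: left_diff_distrib)
      finally have 1: "norm y < \<epsilon> * R" using y' by linarith
      have "norm (x - y) \<le> norm (x - (1 - p) *\<^sub>R x) + norm ((1 - p) *\<^sub>R x - y)"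
        by (metis norm_triangle_ineq diff_add_cancel add_diff_eq)
      also have "x - (1 - p) *\<^sub>R x = p *\<^sub>R x" by (simp add: scaleR_left_diff_distrib)
      also have "norm (p *\<^sub>R x) \<le> p * (\<epsilon> * R)" using p x by (simp add: mult_left_mono)
      finally have "norm (x - y) \<le> l" using y' pe by linarith
      with 1 show "y \<in> ball 0 (\<epsilon> * R) \<inter> {y. norm (x - y) \<le> l}" by simp
    qed
    have "c * V * (\<eta> / 2) ^ CARD('n) = c * t powr (- real CARD('n) / \<theta>) * (V * (l / 2) ^ CARD('n))"
    proof -
      have 1: "t powr (- real CARD('n) / \<theta>) * (t powr (1 / \<theta>)) ^ CARD('n) = 1"
        using t by (simp add: powr_realpow[symmetric] powr_powr powr_add[symmetric])
      have 2: "(l / 2) ^ CARD('n) = (\<eta> / 2) ^ CARD('n) * (t powr (1 / \<theta>)) ^ CARD('n)"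
        unfolding power_mult_distrib[symmetric] l_def by simp
      have "c * t powr (- real CARD('n) / \<theta>) * (V * (l / 2) ^ CARD('n))
          = c * V * (\<eta> / 2) ^ CARD('n) * (t powr (- real CARD('n) / \<theta>) * (t powr (1 / \<theta>)) ^ CARD('n))"
        unfolding 2 by (simp only: mult_ac)
      then show ?thesis unfolding 1 by (simp only: mult_1_right)
    qed
    then have "ennreal (c * V * (\<eta> / 2) ^ CARD('n)) = ennreal (c * t powr (- real CARD('n) / \<theta>) * (V * (l / 2) ^ CARD('n)))"
      by (rule arg_cong)
    also have "\<dots> = ennreal (c * t powr (- real CARD('n) / \<theta>)) * ennreal (V * (l / 2) ^ CARD('n))"
      by (rule ennreal_mult', rule mult_nonneg_nonneg) (use c in simp_all)
    also have "\<dots> = (\<integral>\<^sup>+y. ennreal (c * t powr (- real CARD('n) / \<theta>)) * indicator (ball ((1 - p) *\<^sub>R x) (l / 2)) y \<partial>lborel)"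
      using l by (simp add: nn_integral_cmult_indicator emeasure_ball V_def)
    also have "\<dots> \<le> (\<integral>\<^sup>+y\<in>ball 0 (\<epsilon> * R). ennreal (frac_heat_kernel \<theta> (x - y) t) \<partial>lborel)"
    proof (intro nn_integral_mono)
      fix y
      show "ennreal (c * t powr (- real CARD('n) / \<theta>)) * indicator (ball ((1 - p) *\<^sub>R x) (l / 2)) y
        \<le> ennreal (frac_heat_kernel \<theta> (x - y) t) * indicator (ball 0 (\<epsilon> * R)) y"
      proof (cases "y \<in> ball ((1 - p) *\<^sub>R x) (l / 2)")
        case True
        then have y: "y \<in> ball 0 (\<epsilon> * R)" "norm (x - y) \<le> l" using sub by auto
        have "l \<le> \<epsilon>0 * t powr (1 / \<theta>)" unfolding l_def using \<eta> by (intro mult_right_mono) auto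
        then have "ennreal (c * t powr (- real CARD('n) / \<theta>)) \<le> ennreal (frac_heat_kernel \<theta> (x - y) t)"
          using y(2) by (intro ennreal_leI low t) linarith
        then show ?thesis using True y(1) by (simp only: indicator_simps mult_1_right)
      qed simp
    qed
    finally show "ennreal (c * V * (\<eta> / 2) ^ CARD('n)) \<le> (\<integral>\<^sup>+y\<in>ball 0 (\<epsilon> * R). ennreal (frac_heat_kernel \<theta> (x - y) t) \<partial>lebesgue)"
      unfolding nn_integral_completion .
  qed
qed

context regular_source
begin

text \<open>
  On a ball on which the solution is at least \<open>m\<close>, the reaction alone doubles it within a time
  proportional to \<open>m / f m\<close>, because the kernel keeps a fixed part of its mass in the ball. The
  doubling times sum up to a multiple of \<open>F (m / 2)\<close>.
\<close>

lemma integral_solution_doubling: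
  fixes u :: "real ^ 'n \<Rightarrow> real \<Rightarrow> real" and B :: "(real ^ 'n) set"
  assumes sol: "integral_solution \<theta> f \<phi> T u" and m: "0 < m" and \<delta>: "0 < \<delta>"
    and B [measurable]: "B \<in> sets borel" and a: "0 \<le> a" and b: "b \<le> T"
    and mass: "\<And>t x. 0 < t \<Longrightarrow> t < b - a \<Longrightarrow> x \<in> B \<Longrightarrow> ennreal \<delta> \<le> (\<integral>\<^sup>+y\<in>B. ennreal (frac_heat_kernel \<theta> (x - y) t) \<partial>lebesgue)"
    and init: "\<And>t. a < t \<Longrightarrow> t < b \<Longrightarrow> AE x in lebesgue. x \<in> B \<longrightarrow> m \<le> u x t"
    and t: "a + 2 * m / (\<delta> * f m) < t" "t < b"
  shows "AE x in lebesgue. x \<in> B \<longrightarrow> 2 * m \<le> u x t"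
proof -
  let ?I = "\<lambda>x. \<integral>\<^sup>+s\<in>{0<..<t}. frac_heat_semigroup \<theta> (t - s) (\<lambda>y. ennreal (f (u y s))) x \<partial>lebesgue"
  have fm: "0 < f m" using pos m by simp
  have "0 < 2 * m / (\<delta> * f m)" using m fm \<delta> by simp
  then have at: "a < t" using t by linarith
  have tT: "t \<in> {0<..<T}" using at a b t by auto
  have conv: "ennreal (\<delta> * f m) \<le> frac_heat_semigroup \<theta> (t - s) (\<lambda>y. ennreal (f (u y s))) x"
    if s: "s \<in> {a<..<t}" and x: "x \<in> B" for s x
  proof -
    have "ennreal (\<delta> * f m) = ennreal \<delta> * ennreal (f m)" using \<delta> by (intro ennreal_mult') auto
    also have "\<dots> \<le> (\<integral>\<^sup>+y\<in>B. ennreal (frac_heat_kernel \<theta> (x - y) (t - s)) \<partial>lebesgue) * ennreal (f m)"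
      using s t x by (intro mult_right_mono mass) auto
    also have "\<dots> = (\<integral>\<^sup>+y. ennreal (frac_heat_kernel \<theta> (x - y) (t - s)) * indicator B y * ennreal (f m) \<partial>lebesgue)"
      unfolding nn_integral_completion by (rule nn_integral_multc[symmetric]) measurable
    also have "\<dots> \<le> frac_heat_semigroup \<theta> (t - s) (\<lambda>y. ennreal (f (u y s))) x"
      unfolding frac_heat_semigroup_def
    proof (rule nn_integral_mono_AE)
      show "AE y in lebesgue. ennreal (frac_heat_kernel \<theta> (x - y) (t - s)) * indicator B y * ennreal (f m)
          \<le> ennreal (frac_heat_kernel \<theta> (x - y) (t - s)) * ennreal (f (u y s))"
        using init[of s]
      proof (rule eventually_mono)
        fix y assume y: "y \<in> B \<longrightarrow> m \<le> u y s"
        show "ennreal (frac_heat_kernel \<theta> (x - y) (t - s)) * indicator B y * ennreal (f m)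
          \<le> ennreal (frac_heat_kernel \<theta> (x - y) (t - s)) * ennreal (f (u y s))"
          using y m f_mono[of m "u y s"] by (cases "y \<in> B") (auto intro!: mult_left_mono ennreal_leI)
      qed (use s t in auto)
    qed
    finally show ?thesis .
  qed
  have "AE x in lebesgue. ennreal (u x t) = frac_heat_semigroup \<theta> t (\<lambda>y. ennreal (\<phi> y)) x +
          ?I x"
    using sol tT unfolding integral_solution_def by blast
  then show ?thesis
  proof (rule eventually_mono, intro impI)
    fix x
    assume eq: "ennreal (u x t) = frac_heat_semigroup \<theta> t (\<lambda>y. ennreal (\<phi> y)) x +
          ?I x" and x: "x \<in> B"
    have "2 * m \<le> (\<delta> * f m) * (t - a)" using t(1) fm \<delta> by (simp add: field_simps)
    then have "ennreal (2 * m) \<le> ennreal ((\<delta> * f m) * (t - a))" by (rule ennreal_leI)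
    also have "\<dots> = (\<integral>\<^sup>+s. ennreal (\<delta> * f m) * indicator {a<..<t} s \<partial>lebesgue)"
      unfolding nn_integral_completion using \<delta> fm at by (simp add: nn_integral_cmult_indicator ennreal_mult')
    also have "\<dots> \<le> ?I x"
      using conv[OF _ x] a by (intro nn_integral_mono) (auto simp: indicator_def)
    also have "\<dots> \<le> ennreal (u x t)" unfolding eq by simp
    finally show "2 * m \<le> u x t" using m by (simp add: ennreal_le_iff2)
  qed
qed

text \<open>
  As \<open>1 / f\<close> is nonincreasing, its integral over \<open>[m / 2, m]\<close> is at least \<open>m / (2 f m)\<close>.
\<close>

lemma doubling_time_le:
  assumes "0 < m"
  shows "2 * m / f m \<le> 4 * (F (m / 2) - F m)"
proof -
  have le: "m / 2 / f m \<le> integral {m / 2..m} (\<lambda>t. 1 / f t)"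
  proof -
    have "integral {m / 2..m} (\<lambda>t. 1 / f m) \<le> integral {m / 2..m} (\<lambda>t. 1 / f t)"
    proof (rule integral_le)
      show "(\<lambda>t. 1 / f t) integrable_on {m / 2..m}"
        using assms by (intro integrable_continuous_real continuous_on_subset[OF cont_recip[of "m / 2"]]) auto
      show "1 / f m \<le> 1 / f t" if "t \<in> {m / 2..m}" for t
        using that assms f_mono[of t m] pos[of t] pos[of m] by (intro divide_left_mono) auto
    qed (simp add: integrable_const_ivl)
    then show ?thesis using assms by simp
  qed
  moreover have "F (m / 2) = integral {m / 2..m} (\<lambda>t. 1 / f t) + F m" using assms by (intro F_split) auto
  ultimately show ?thesis by simp
qed

text \<open>
  The doubling times telescope, so every level \<open>2\<^sup>k m\<close> is passed before one common time, at which the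
  finite solution would have to be infinite on \<open>B\<close>.
\<close>

lemma integral_solution_blow_up:
  fixes u :: "real ^ 'n \<Rightarrow> real \<Rightarrow> real" and B :: "(real ^ 'n) set"
  assumes sol: "integral_solution \<theta> f \<phi> T u" and m: "0 < m" and \<delta>: "0 < \<delta>"
    and B [measurable]: "B \<in> sets borel" and a: "0 \<le> a" and b: "b \<le> T"
    and mass: "\<And>t x. 0 < t \<Longrightarrow> t < b - a \<Longrightarrow> x \<in> B \<Longrightarrow> ennreal \<delta> \<le> (\<integral>\<^sup>+y\<in>B. ennreal (frac_heat_kernel \<theta> (x - y) t) \<partial>lebesgue)"
    and init: "\<And>t. a < t \<Longrightarrow> t < b \<Longrightarrow> AE x in lebesgue. x \<in> B \<longrightarrow> m \<le> u x t"
    and time: "4 / \<delta> * F (m / 2) < b - a"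
  shows "AE x in lebesgue. x \<notin> B"
proof -
  define s where "s k = a + 4 / \<delta> * (F (m / 2) - F (2 ^ k * m / 2))" for k :: nat
  have level: "AE x in lebesgue. x \<in> B \<longrightarrow> 2 ^ k * m \<le> u x t" if "s k < t" "t < b" for k t
    using that
  proof (induction k arbitrary: t)
    case 0
    then show ?case using init by (simp add: s_def)
  next
    case (Suc k)
    let ?m = "2 ^ k * m"
    have mk: "0 < ?m" using m by simp
    have "F (?m / 2) \<le> F (m / 2)" using m by (intro F_antimono) auto
    then have ask: "a \<le> s k" using \<delta> by (simp add: s_def)
    have "2 * ?m / (\<delta> * f ?m) = 1 / \<delta> * (2 * ?m / f ?m)" by simp
    also have "\<dots> \<le> 1 / \<delta> * (4 * (F (?m / 2) - F ?m))"
      using \<delta> by (intro mult_left_mono doubling_time_le mk) auto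
    also have "\<dots> = s (Suc k) - s k" by (simp add: s_def algebra_simps)
    finally have st: "s k + 2 * ?m / (\<delta> * f ?m) \<le> s (Suc k)" by simp
    have "AE x in lebesgue. x \<in> B \<longrightarrow> 2 * ?m \<le> u x t"
    proof (rule integral_solution_doubling[OF sol mk \<delta> B _ b])
      show "0 \<le> s k" using a ask by simp
      show "AE x in lebesgue. x \<in> B \<longrightarrow> ?m \<le> u x t" if "s k < t" "t < b" for t using Suc.IH that by blast
    qed (use Suc.prems st mass ask in auto)
    then show ?case by (simp add: mult.assoc)
  qed
  define t where "t = (a + 4 / \<delta> * F (m / 2) + b) / 2"
  have t: "a + 4 / \<delta> * F (m / 2) < t" "t < b" using time by (simp_all add: t_def)
  have "AE x in lebesgue. x \<in> B \<longrightarrow> 2 ^ k * m \<le> u x t" for k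
  proof (rule level)
    have "s k \<le> a + 4 / \<delta> * F (m / 2)"
      unfolding s_def using \<delta> F_pos[of "2 ^ k * m / 2"] m by (intro add_left_mono mult_left_mono) auto
    then show "s k < t" using t by linarith
  qed (rule t)
  then have "AE x in lebesgue. \<forall>k. x \<in> B \<longrightarrow> 2 ^ k * m \<le> u x t" unfolding AE_all_countable by blast
  then show ?thesis
  proof (rule eventually_mono)
    fix x assume x: "\<forall>k. x \<in> B \<longrightarrow> 2 ^ k * m \<le> u x t"
    obtain k :: nat where "u x t / m < 2 ^ k" using real_arch_pow[of 2 "u x t / m"] by auto
    then have "u x t < 2 ^ k * m" using m by (simp add: field_simps)
    then show "x \<notin> B" using x by (metis not_le)
  qed
qed

text \<open>
  The value \<open>0\<close> outside \<open>(0, F 1]\<close> makes the singular datum vanish away from the origin; at the origin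
  itself the datum is \<open>0\<close> as well.
\<close>

definition F_inv :: "real \<Rightarrow> real" where
  "F_inv \<tau> = (if 0 < \<tau> \<and> \<tau> \<le> F 1 then (SOME v. 1 \<le> v \<and> F v = \<tau>) else 0)"

lemma F_inv:
  assumes "0 < \<tau>" "\<tau> \<le> F 1"
  shows "1 \<le> F_inv \<tau> \<and> F (F_inv \<tau>) = \<tau>"
proof -
  have "\<exists>v. 1 \<le> v \<and> F v = \<tau>" using F_inverse[OF assms] by blast
  from someI_ex[OF this] show ?thesis using assms by (simp add: F_inv_def)
qed

lemma F_inv_antimono: "0 < \<sigma> \<Longrightarrow> \<sigma> \<le> \<tau> \<Longrightarrow> \<tau> \<le> F 1 \<Longrightarrow> F_inv \<tau> \<le> F_inv \<sigma>"
  using F_inv[of \<sigma>] F_inv[of \<tau>] F_strict_antimono[of "F_inv \<sigma>" "F_inv \<tau>"] by (cases "F_inv \<tau> \<le> F_inv \<sigma>") auto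

lemma F_inv_measurable [measurable]: "F_inv \<in> borel_measurable borel"
proof -
  let ?A = "{0<..F 1}"
  have "mono_on ?A (\<lambda>\<tau>. - F_inv \<tau>)" by (auto intro!: mono_onI F_inv_antimono)
  then have "(\<lambda>\<tau>. - F_inv \<tau>) \<in> borel_measurable (restrict_space borel ?A)" by (rule borel_measurable_mono_on_fnc)
  then have "(\<lambda>\<tau>. - F_inv \<tau> * indicator ?A \<tau>) \<in> borel_measurable borel"
    by (subst (asm) borel_measurable_restrict_space_iff) (auto simp: mult.commute)
  then have "(\<lambda>\<tau>. - (- F_inv \<tau> * indicator ?A \<tau>)) \<in> borel_measurable borel" by measurable
  also have "(\<lambda>\<tau>. - (- F_inv \<tau> * indicator ?A \<tau>)) = F_inv" by (auto simp: F_inv_def indicator_def)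
  finally show ?thesis .
qed

text \<open>
  Where the datum is positive, \<open>F\<close> of it to the power \<open>- r\<close> is \<open>|x|\<close> to the power \<open>- \<alpha> r\<close>, which is locally
  integrable; elsewhere it is constant.
\<close>

lemma singular_datum_L1_ul:
  fixes \<alpha> r \<rho> :: real
  assumes "0 < \<alpha>" "0 < r" "\<alpha> * r < real CARD('n)" "0 < \<rho>"
  shows "(\<lambda>x :: real ^ 'n. tail_int_neg_powr f r (F_inv (norm x powr \<alpha>))) \<in> L1_ul \<rho>"
proof -
  define c where "c = tail_int_neg_powr f r 0"
  have c: "0 \<le> c" by (simp add: c_def tail_int_neg_powr_def)
  let ?h = "\<lambda>x :: real ^ 'n. tail_int_neg_powr f r (F_inv (norm x powr \<alpha>))"
  have h: "?h x = (if x \<noteq> 0 \<and> norm x powr \<alpha> \<le> F 1 then norm x powr (- (\<alpha> * r)) else c)" for x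
  proof (cases "x \<noteq> 0 \<and> norm x powr \<alpha> \<le> F 1")
    case True
    then have "1 \<le> F_inv (norm x powr \<alpha>) \<and> F (F_inv (norm x powr \<alpha>)) = norm x powr \<alpha>" by (intro F_inv) auto
    then have "?h x = (norm x powr \<alpha>) powr (- r)" using tail_int_neg_powr_eq[of "F_inv (norm x powr \<alpha>)" r] by simp
    then show ?thesis using True by (simp add: powr_powr)
  next
    case False
    then have "F_inv (norm x powr \<alpha>) = 0" using assms(1) by (auto simp: F_inv_def)
    then have "?h x = c" by (simp only: c_def)
    then show ?thesis using False by (simp only: if_False)
  qed
  have meas: "?h \<in> borel_measurable borel" unfolding h by measurable
  define R where "R = F 1 powr (1 / \<alpha>) + 1"
  have R: "0 < R" by (simp add: R_def add_nonneg_pos)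
  have inR: "norm x < R" if "norm x powr \<alpha> \<le> F 1" for x :: "real ^ 'n"
  proof -
    have "(norm x powr \<alpha>) powr (1 / \<alpha>) \<le> F 1 powr (1 / \<alpha>)" using that assms by (intro powr_mono2) auto
    then show ?thesis using assms(1) by (simp add: powr_powr R_def)
  qed
  have "- real DIM(real ^ 'n) < - (\<alpha> * r)" using assms by simp
  then obtain C where C: "0 \<le> C" "\<And>R. 0 < R \<Longrightarrow> (\<integral>\<^sup>+x\<in>{x::real ^ 'n. x \<noteq> 0 \<and> norm x < R}. ennreal (norm x powr (- (\<alpha> * r))) \<partial>lborel)
      \<le> ennreal (C * R powr (real DIM(real ^ 'n) + (- (\<alpha> * r))))"
    using nn_integral_norm_powr_ball by blast
  define I where "I = C * R powr (real DIM(real ^ 'n) + (- (\<alpha> * r)))"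
  have bound: "(\<integral>\<^sup>+x\<in>S. ennreal \<bar>?h x\<bar> \<partial>lebesgue) \<le> ennreal c * emeasure lborel S + ennreal I"
    if [measurable]: "S \<in> sets borel" for S
  proof -
    have "(\<integral>\<^sup>+x\<in>S. ennreal \<bar>?h x\<bar> \<partial>lborel) \<le> (\<integral>\<^sup>+x. ennreal c * indicator S x
        + ennreal (norm x powr (- (\<alpha> * r))) * indicator {x. x \<noteq> 0 \<and> norm x < R} x \<partial>lborel)"
    proof (intro nn_integral_mono)
      fix x :: "real ^ 'n"
      show "ennreal \<bar>?h x\<bar> * indicator S x \<le> ennreal c * indicator S x
        + ennreal (norm x powr (- (\<alpha> * r))) * indicator {x. x \<noteq> 0 \<and> norm x < R} x"
        using c inR[of x] unfolding h by (auto simp: indicator_def)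
    qed
    also have "\<dots> = ennreal c * emeasure lborel S + (\<integral>\<^sup>+x\<in>{x::real ^ 'n. x \<noteq> 0 \<and> norm x < R}. ennreal (norm x powr (- (\<alpha> * r))) \<partial>lborel)"
      by (subst nn_integral_add) (auto simp: nn_integral_cmult_indicator)
    also have "\<dots> \<le> ennreal c * emeasure lborel S + ennreal I"
      unfolding I_def by (intro add_left_mono C R)
    finally show ?thesis unfolding nn_integral_completion .
  qed
  have "set_integrable lebesgue K ?h" if "compact K" for K
  proof -
    have K: "K \<in> sets borel" using that by (simp add: borel_compact)
    have "(\<lambda>x. indicator K x *\<^sub>R ?h x) \<in> borel_measurable borel" using meas K by measurable
    moreover have "(\<integral>\<^sup>+x. ennreal (norm (indicator K x *\<^sub>R ?h x)) \<partial>lebesgue) < \<infinity>"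
    proof -
      have "(\<integral>\<^sup>+x. ennreal (norm (indicator K x *\<^sub>R ?h x)) \<partial>lebesgue) = (\<integral>\<^sup>+x\<in>K. ennreal \<bar>?h x\<bar> \<partial>lebesgue)"
        by (intro nn_integral_cong) (auto simp: indicator_def)
      also have "\<dots> \<le> ennreal c * emeasure lborel K + ennreal I" by (rule bound[OF K])
      also have "\<dots> < \<infinity>" using emeasure_compact_finite[OF that] by (simp add: ennreal_mult_less_top)
      finally show ?thesis .
    qed
    ultimately show ?thesis unfolding set_integrable_def by (intro integrableI_bounded) (auto intro: measurable_completion)
  qed
  moreover have "(SUP y. \<integral>\<^sup>+x\<in>ball y \<rho>. ennreal \<bar>?h x\<bar> \<partial>lebesgue) < \<infinity>"
  proof -
    have "(SUP y. \<integral>\<^sup>+x\<in>ball y \<rho>. ennreal \<bar>?h x\<bar> \<partial>lebesgue) \<le> ennreal c * ennreal (unit_ball_vol (real CARD('n)) * \<rho> ^ CARD('n)) + ennreal I"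
    proof (rule SUP_least)
      fix y :: "real ^ 'n"
      have e: "emeasure lborel (ball y \<rho>) = ennreal (unit_ball_vol (real CARD('n)) * \<rho> ^ CARD('n))"
        using emeasure_ball[of \<rho> y] assms(4) by simp
      show "(\<integral>\<^sup>+x\<in>ball y \<rho>. ennreal \<bar>?h x\<bar> \<partial>lebesgue)
          \<le> ennreal c * ennreal (unit_ball_vol (real CARD('n)) * \<rho> ^ CARD('n)) + ennreal I"
        unfolding e[symmetric] by (rule bound[OF borel_open[OF open_ball]])
    qed
    also have "\<dots> < \<infinity>" by (simp add: ennreal_mult_less_top)
    finally show ?thesis .
  qed
  ultimately show ?thesis using meas by (auto simp: L1_ul_def L1_loc_def intro: measurable_completion)
qed

text \<open>
  Between the times \<open>R\<close>\<open>\<^sup>\<theta>\<close> and \<open>2 R\<close>\<open>\<^sup>\<theta>\<close> the linear part alone keeps the solution above a multiple of the value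
  of the datum at distance \<open>R\<close>, on a ball of radius proportional to \<open>R\<close>. The blow-up time of the reaction from that level is
  a multiple of \<open>R\<close>\<open>\<^sup>\<alpha>\<close>, which for small \<open>R\<close> is shorter than \<open>R\<close>\<open>\<^sup>\<theta>\<close>.
\<close>

lemma singular_datum_no_local_solution:
  assumes \<theta>: "0 < \<theta>" "\<theta> < \<alpha>"
  shows "\<not> has_local_solution \<theta> f (\<lambda>x :: real ^ 'n. F_inv (norm x powr \<alpha>))"
proof
  let ?\<phi> = "\<lambda>x :: real ^ 'n. F_inv (norm x powr \<alpha>)"
  assume "has_local_solution \<theta> f ?\<phi>"
  then obtain T u where T: "0 < T" and sol: "integral_solution \<theta> f ?\<phi> T u"
    unfolding has_local_solution_def by blast
  have \<alpha>: "0 < \<alpha>" using \<theta> by simp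
  obtain \<delta> \<epsilon> where \<delta>: "0 < \<delta>" and \<epsilon>: "0 < \<epsilon>" "\<epsilon> \<le> 1" and mass: "\<And>R t (x :: real ^ 'n). 0 < R \<Longrightarrow> 0 < t \<Longrightarrow> t \<le> 2 * R powr \<theta> \<Longrightarrow> norm x < \<epsilon> * R \<Longrightarrow>
    ennreal \<delta> \<le> (\<integral>\<^sup>+y\<in>ball 0 (\<epsilon> * R). ennreal (frac_heat_kernel \<theta> (x - y) t) \<partial>lebesgue)"
    by (rule frac_heat_kernel_ball_mass[OF \<theta>(1), where 'n = 'n], rule that)
  obtain \<gamma> K where \<gamma>: "0 < \<gamma>" and K: "0 < K" and scale: "\<And>v l. K \<le> v \<Longrightarrow> 1 \<le> l \<Longrightarrow> F v \<le> l powr \<gamma> * F (l * v)"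
    by (rule F_scale, rule that)
  define L where "L = max 1 (2 / \<delta>)"
  have L: "1 \<le> L" "2 / \<delta> \<le> L" "0 < L" by (auto simp: L_def)
  define A where "A = min (F 1) (F (L * K))"
  have A: "0 < A" using F_pos[of 1] F_pos[of "L * K"] L K by (simp add: A_def)
  define E where "E = \<delta> / 4 / L powr \<gamma>"
  have E: "0 < E" using \<delta> L by (simp add: E_def)
  \<comment> \<open>The three bounds on \<open>R\<close> put the datum in the range where \<open>F\<close> can be rescaled, the ball's
     diffusive time below \<open>T\<close>, and the blow-up time below the diffusive time.\<close>
  define R where "R = min (A powr (1 / \<alpha>)) (min ((T / 2) powr (1 / \<theta>)) (E powr (1 / (\<alpha> - \<theta>)))) / 2"
  have R: "0 < R" using A E T by (simp add: R_def)
  have less: "R powr p < X" if "0 < p" "0 < X" "R < X powr (1 / p)" for p X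
  proof -
    have "R powr p < (X powr (1 / p)) powr p" using that R by (intro powr_less_mono2) auto
    then show ?thesis using that by (simp add: powr_powr)
  qed
  have R0: "R < A powr (1 / \<alpha>)" "R < (T / 2) powr (1 / \<theta>)" "R < E powr (1 / (\<alpha> - \<theta>))"
    using R unfolding R_def by linarith+
  have R1: "R powr \<alpha> < A" using less[of \<alpha> A] \<alpha> A R0 by simp
  have R2: "2 * R powr \<theta> < T" using less[of \<theta> "T / 2"] \<theta> T R0 by simp
  have R3: "R powr (\<alpha> - \<theta>) < E" using less[of "\<alpha> - \<theta>" E] \<theta> E R0 by simp
  have R\<alpha>: "0 < R powr \<alpha>" "R powr \<alpha> \<le> F 1" using R R1 by (simp_all add: A_def)
  define v where "v = F_inv (R powr \<alpha>)"
  have v: "1 \<le> v" "F v = R powr \<alpha>" using F_inv[OF R\<alpha>] by (simp_all add: v_def)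
  have "F v < F (L * K)" using v R1 by (simp add: A_def)
  then have vK: "L * K < v" using F_antimono[of v "L * K"] v by linarith
  have scaled: "F (v / L) \<le> L powr \<gamma> * R powr \<alpha>"
    using scale[of "v / L" L] vK L v by (simp add: field_simps)
  define m where "m = \<delta> * v"
  have m: "0 < m" using \<delta> v by (simp add: m_def)
  have "v / L \<le> m / 2"
  proof -
    have "2 \<le> L * \<delta>" using L \<delta> by (simp add: field_simps)
    then have "2 * v \<le> L * \<delta> * v" using v by (intro mult_right_mono) auto
    then show ?thesis using L by (simp add: m_def field_simps)
  qed
  then have Fm: "F (m / 2) \<le> L powr \<gamma> * R powr \<alpha>"
    using F_antimono[of "v / L" "m / 2"] scaled v L by (simp add: divide_pos_pos)
  let ?B = "ball (0 :: real ^ 'n) (\<epsilon> * R)"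
  have B [measurable]: "?B \<in> sets borel" by simp
  have "AE x in lebesgue. x \<notin> ?B"
  proof (rule integral_solution_blow_up[OF sol m \<delta> B, of "R powr \<theta>" "2 * R powr \<theta>"])
    show "0 \<le> R powr \<theta>" by simp
    show "2 * R powr \<theta> \<le> T" using R2 by simp
    show "ennreal \<delta> \<le> (\<integral>\<^sup>+y\<in>?B. ennreal (frac_heat_kernel \<theta> (x - y) t) \<partial>lebesgue)"
      if "0 < t" "t < 2 * R powr \<theta> - R powr \<theta>" "x \<in> ?B" for t x
      using that R by (intro mass) auto
    have "4 / \<delta> * F (m / 2) \<le> 4 / \<delta> * (L powr \<gamma> * R powr \<alpha>)" using \<delta> Fm by (intro mult_left_mono) auto
    also have "\<dots> = R powr \<theta> * (R powr (\<alpha> - \<theta>) / E)"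
      using R \<delta> L by (simp add: E_def powr_diff field_simps)
    also have "\<dots> < R powr \<theta> * 1" using R R3 E by (intro mult_strict_left_mono) (auto simp: field_simps)
    finally show "4 / \<delta> * F (m / 2) < 2 * R powr \<theta> - R powr \<theta>" by simp
    fix t assume t: "R powr \<theta> < t" "t < 2 * R powr \<theta>"
    have t0: "0 < t" using t R by (simp add: less_trans[of 0 "R powr \<theta>"])
    have tT: "t \<in> {0<..<T}" using t t0 R2 by simp
    have lower: "ennreal m \<le> frac_heat_semigroup \<theta> t (\<lambda>y. ennreal (?\<phi> y)) x" if x: "x \<in> ?B" for x
    proof -
      have "ennreal m = ennreal \<delta> * ennreal v" unfolding m_def using \<delta> by (intro ennreal_mult') auto
      also have "\<dots> \<le> (\<integral>\<^sup>+y\<in>?B. ennreal (frac_heat_kernel \<theta> (x - y) t) \<partial>lebesgue) * ennreal v"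
        using x R t t0 by (intro mult_right_mono mass) auto
      also have "\<dots> = (\<integral>\<^sup>+y. ennreal (frac_heat_kernel \<theta> (x - y) t) * indicator ?B y * ennreal v \<partial>lebesgue)"
        unfolding nn_integral_completion by (rule nn_integral_multc[symmetric]) measurable
      also have "\<dots> \<le> frac_heat_semigroup \<theta> t (\<lambda>y. ennreal (?\<phi> y)) x"
        unfolding frac_heat_semigroup_def
      proof (rule nn_integral_mono_AE)
        have "AE y in lborel. y \<noteq> (0 :: real ^ 'n)" by (rule AE_lborel_singleton)
        then have "AE y in lebesgue. y \<noteq> (0 :: real ^ 'n)" by (rule AE_completion)
        then show "AE y in lebesgue. ennreal (frac_heat_kernel \<theta> (x - y) t) * indicator ?B y * ennreal v
            \<le> ennreal (frac_heat_kernel \<theta> (x - y) t) * ennreal (F_inv (norm y powr \<alpha>))"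
        proof (rule eventually_mono)
          fix y :: "real ^ 'n" assume y: "y \<noteq> 0"
          show "ennreal (frac_heat_kernel \<theta> (x - y) t) * indicator ?B y * ennreal v
            \<le> ennreal (frac_heat_kernel \<theta> (x - y) t) * ennreal (F_inv (norm y powr \<alpha>))"
          proof (cases "y \<in> ?B")
            case True
            then have "norm y < \<epsilon> * R" by simp
            also have "\<dots> \<le> 1 * R" using \<epsilon> R by (intro mult_right_mono) auto
            finally have "norm y \<le> R" by simp
            then have "norm y powr \<alpha> \<le> R powr \<alpha>" using \<alpha> by (intro powr_mono2) auto
            then have "v \<le> F_inv (norm y powr \<alpha>)" unfolding v_def using y R\<alpha> by (intro F_inv_antimono) auto
            then show ?thesis using True by (auto intro!: mult_left_mono ennreal_leI)
          qed simp
        qed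
      qed
      finally show ?thesis .
    qed
    have "AE x in lebesgue. ennreal (u x t) = frac_heat_semigroup \<theta> t (\<lambda>y. ennreal (?\<phi> y)) x +
          (\<integral>\<^sup>+s\<in>{0<..<t}. frac_heat_semigroup \<theta> (t - s) (\<lambda>y. ennreal (f (u y s))) x \<partial>lebesgue)"
      using sol tT unfolding integral_solution_def by blast
    then show "AE x in lebesgue. x \<in> ?B \<longrightarrow> m \<le> u x t"
    proof (rule eventually_mono, intro impI)
      fix x assume eq: "ennreal (u x t) = frac_heat_semigroup \<theta> t (\<lambda>y. ennreal (?\<phi> y)) x +
          (\<integral>\<^sup>+s\<in>{0<..<t}. frac_heat_semigroup \<theta> (t - s) (\<lambda>y. ennreal (f (u y s))) x \<partial>lebesgue)" and x: "x \<in> ?B"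
      have "ennreal m \<le> ennreal (u x t)" unfolding eq using lower[OF x] by (rule order_trans) simp
      then show "m \<le> u x t" using m by (simp add: ennreal_le_iff2)
    qed
  qed
  then have "emeasure lebesgue ?B = 0" by (subst (asm) AE_iff_measurable[of ?B]) auto
  moreover have "emeasure lebesgue ?B = ennreal (unit_ball_vol (real CARD('n)) * (\<epsilon> * R) ^ CARD('n))"
    using \<epsilon> R emeasure_ball[of "\<epsilon> * R" "0 :: real ^ 'n"] by simp
  moreover have "0 < unit_ball_vol (real CARD('n)) * (\<epsilon> * R) ^ CARD('n)" using \<epsilon> R by simp
  ultimately show False by (simp add: ennreal_eq_0_iff)
qed

end


section \<open>Existence below a supersolution\<close>

context regular_source
begin

definition duhamel :: "real \<Rightarrow> (real ^ 'n \<Rightarrow> real) \<Rightarrow> (real ^ 'n \<Rightarrow> real \<Rightarrow> ennreal) \<Rightarrow> real ^ 'n \<Rightarrow> real \<Rightarrow> ennreal" where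
  "duhamel \<theta> \<phi> v x t = (\<integral>\<^sup>+y. ennreal (frac_heat_kernel \<theta> (x - y) t) * ennreal (\<phi> y) \<partial>lborel) +
     (\<integral>\<^sup>+s\<in>{0<..<t}. (\<integral>\<^sup>+y. ennreal (frac_heat_kernel \<theta> (x - y) (t - s)) * ennreal (f (enn2real (v y s))) \<partial>lborel) \<partial>lborel)"

text \<open>
  The values of \<open>f\<close> at negative arguments are arbitrary, hence the truncation in the proof.
\<close>

lemma source_measurable: "(\<lambda>e. ennreal (f (enn2real e))) \<in> borel_measurable borel"
proof -
  have "continuous_on UNIV (\<lambda>u. f (max u 0))"
    by (rule continuous_on_compose2[OF cont]) (auto intro!: continuous_intros)
  then have [measurable]: "(\<lambda>u. f (max u 0)) \<in> borel_measurable borel" by (rule borel_measurable_continuous_onI)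
  have "(\<lambda>e. ennreal (f (max (enn2real e) 0))) \<in> borel_measurable borel" by measurable
  then show ?thesis by simp
qed

lemma duhamel_measurable:
  fixes v :: "real ^ 'n \<Rightarrow> real \<Rightarrow> ennreal"
  assumes [measurable]: "\<phi> \<in> borel_measurable borel" "(\<lambda>(x, t). v x t) \<in> borel_measurable (borel \<Otimes>\<^sub>M borel)"
  shows "(\<lambda>(x, t). duhamel \<theta> \<phi> v x t) \<in> borel_measurable (borel \<Otimes>\<^sub>M borel)"
proof -
  have [measurable]: "(\<lambda>p. ennreal (f (enn2real (v (fst p) (snd p))))) \<in> borel_measurable (borel \<Otimes>\<^sub>M borel)"
    using measurable_compose[OF assms(2) source_measurable] by (simp add: case_prod_beta)
  have [measurable]: "(\<lambda>(p :: (real ^ 'n) \<times> real, y). ennreal (frac_heat_kernel \<theta> (fst p - y) (snd p)) * ennreal (\<phi> y)) \<in> borel_measurable ((borel \<Otimes>\<^sub>M borel) \<Otimes>\<^sub>M lborel)"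
    by measurable
  have m1: "(\<lambda>p. \<integral>\<^sup>+y. ennreal (frac_heat_kernel \<theta> (fst p - y) (snd p)) * ennreal (\<phi> y) \<partial>lborel) \<in> borel_measurable (borel \<Otimes>\<^sub>M borel)"
    by measurable
  have f': "(\<lambda>q :: (((real ^ 'n) \<times> real) \<times> real) \<times> (real ^ 'n). ennreal (f (enn2real (v (snd q) (snd (fst q)))))) \<in> borel_measurable (((borel \<Otimes>\<^sub>M borel) \<Otimes>\<^sub>M lborel) \<Otimes>\<^sub>M lborel)"
    using measurable_compose[of "\<lambda>q :: (((real ^ 'n) \<times> real) \<times> real) \<times> (real ^ 'n). (snd q, snd (fst q))" "((borel \<Otimes>\<^sub>M borel) \<Otimes>\<^sub>M lborel) \<Otimes>\<^sub>M lborel" "borel \<Otimes>\<^sub>M borel" "\<lambda>p. ennreal (f (enn2real (v (fst p) (snd p))))" borel]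
    by simp
  have [measurable]: "(\<lambda>(pr :: ((real ^ 'n) \<times> real) \<times> real, y). ennreal (frac_heat_kernel \<theta> (fst (fst pr) - y) (snd (fst pr) - snd pr)) * ennreal (f (enn2real (v y (snd pr))))) \<in> borel_measurable (((borel \<Otimes>\<^sub>M borel) \<Otimes>\<^sub>M lborel) \<Otimes>\<^sub>M lborel)"
    unfolding case_prod_beta by (rule borel_measurable_times_ennreal[OF _ f']) measurable
  have m2: "(\<lambda>pr. \<integral>\<^sup>+y. ennreal (frac_heat_kernel \<theta> (fst (fst pr) - y) (snd (fst pr) - snd pr)) * ennreal (f (enn2real (v y (snd pr)))) \<partial>lborel) \<in> borel_measurable ((borel \<Otimes>\<^sub>M borel) \<Otimes>\<^sub>M lborel)"
    by measurable
  have "{pr :: ((real ^ 'n) \<times> real) \<times> real. 0 < snd pr \<and> snd pr < snd (fst pr)} \<in> sets ((borel \<Otimes>\<^sub>M borel) \<Otimes>\<^sub>M borel)"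
    unfolding borel_prod by (intro borel_open open_Collect_conj open_Collect_less continuous_intros)
  then have m3: "(\<lambda>pr :: ((real ^ 'n) \<times> real) \<times> real. indicator {0<..<snd (fst pr)} (snd pr) :: ennreal) \<in> borel_measurable ((borel \<Otimes>\<^sub>M borel) \<Otimes>\<^sub>M lborel)"
    by (subst measurable_cong[where g = "indicator {pr. 0 < snd pr \<and> snd pr < snd (fst pr)}"]) (auto simp: indicator_def cong: measurable_cong_sets)
  have m4: "(\<lambda>(p :: (real ^ 'n) \<times> real, s). (\<integral>\<^sup>+y. ennreal (frac_heat_kernel \<theta> (fst p - y) (snd p - s)) * ennreal (f (enn2real (v y s))) \<partial>lborel) * indicator {0<..<snd p} s) \<in> borel_measurable ((borel \<Otimes>\<^sub>M borel) \<Otimes>\<^sub>M lborel)"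
    using m2 m3 unfolding case_prod_beta by (intro borel_measurable_times_ennreal)
  have m5: "(\<lambda>p :: (real ^ 'n) \<times> real. \<integral>\<^sup>+s. (\<integral>\<^sup>+y. ennreal (frac_heat_kernel \<theta> (fst p - y) (snd p - s)) * ennreal (f (enn2real (v y s))) \<partial>lborel) * indicator {0<..<snd p} s \<partial>lborel) \<in> borel_measurable (borel \<Otimes>\<^sub>M borel)"
    by (rule lborel.borel_measurable_nn_integral[OF m4])
  show ?thesis
    using borel_measurable_add[OF m1 m5] unfolding duhamel_def case_prod_beta by simp
qed

text \<open>
  The conversion to real numbers sends \<open>\<infinity>\<close> to \<open>0\<close>, so monotonicity depends on the larger function being finite.
\<close>

lemma duhamel_mono:
  assumes "t \<le> T" and "\<And>y s. 0 < s \<Longrightarrow> s < T \<Longrightarrow> v y s \<le> w y s" and "\<And>y s. 0 < s \<Longrightarrow> s < T \<Longrightarrow> w y s < \<infinity>"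
  shows "duhamel \<theta> \<phi> v x t \<le> duhamel \<theta> \<phi> w x t"
  unfolding duhamel_def
proof (intro add_left_mono nn_integral_mono)
  fix s
  show "(\<integral>\<^sup>+y. ennreal (frac_heat_kernel \<theta> (x - y) (t - s)) * ennreal (f (enn2real (v y s))) \<partial>lborel) * indicator {0<..<t} s
     \<le> (\<integral>\<^sup>+y. ennreal (frac_heat_kernel \<theta> (x - y) (t - s)) * ennreal (f (enn2real (w y s))) \<partial>lborel) * indicator {0<..<t} s"
  proof (cases "s \<in> {0<..<t}")
    case True
    then have s: "0 < s" "s < T" using assms(1) by auto
    have "f (enn2real (v y s)) \<le> f (enn2real (w y s))" for y
      using assms(2,3)[OF s, of y] by (intro f_mono enn2real_mono) auto
    then show ?thesis by (intro mult_right_mono nn_integral_mono mult_left_mono ennreal_leI) auto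
  qed simp
qed

lemma source_SUP:
  fixes a :: "nat \<Rightarrow> ennreal"
  assumes a: "incseq a" and fin: "(SUP n. a n) < \<infinity>"
  shows "(SUP n. ennreal (f (enn2real (a n)))) = ennreal (f (enn2real (SUP n. a n)))"
proof -
  have fin_n: "a n < \<infinity>" for n using fin by (meson SUP_upper UNIV_I le_less_trans)
  have "incseq (\<lambda>n. ennreal (f (enn2real (a n))))"
  proof (rule incseq_SucI)
    fix n
    show "ennreal (f (enn2real (a n))) \<le> ennreal (f (enn2real (a (Suc n))))"
      using fin_n[of "Suc n"] incseq_SucD[OF a, of n] by (intro ennreal_leI f_mono enn2real_mono) auto
  qed
  then have 1: "(\<lambda>n. ennreal (f (enn2real (a n)))) \<longlonglongrightarrow> (SUP n. ennreal (f (enn2real (a n))))" by (rule LIMSEQ_SUP)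
  have "(\<lambda>n. enn2real (a n)) \<longlonglongrightarrow> enn2real (SUP n. a n)"
    using LIMSEQ_SUP[OF a] fin by (intro tendsto_enn2real) auto
  then have "(\<lambda>n. f (enn2real (a n))) \<longlonglongrightarrow> f (enn2real (SUP n. a n))"
    by (rule continuous_on_tendsto_compose[OF cont]) auto
  then have 2: "(\<lambda>n. ennreal (f (enn2real (a n)))) \<longlonglongrightarrow> ennreal (f (enn2real (SUP n. a n)))" by (rule tendsto_ennrealI)
  show ?thesis using LIMSEQ_unique[OF 1 2] .
qed

text \<open>
  The monotone iteration for the integral equation starts at zero and stays below the supersolution;
  monotone convergence identifies its limit as a solution.
\<close>

lemma solution_below_supersolution:
  fixes ubar :: "real ^ 'n \<Rightarrow> real \<Rightarrow> ennreal"
  assumes \<phi>: "\<phi> \<in> borel_measurable lborel" and T: "0 < T"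
    and super: "\<And>x t. 0 < t \<Longrightarrow> t < T \<Longrightarrow> duhamel \<theta> \<phi> ubar x t \<le> ubar x t"
    and fin: "\<And>x t. 0 < t \<Longrightarrow> t < T \<Longrightarrow> ubar x t < \<infinity>"
  shows "has_local_solution \<theta> f \<phi>"
proof -
  define v where "v n = ((duhamel \<theta> \<phi>) ^^ n) (\<lambda>_ _. 0)" for n
  have v_Suc: "v (Suc n) = duhamel \<theta> \<phi> (v n)" for n by (simp add: v_def)
  have vm: "(\<lambda>(x, t). v n x t) \<in> borel_measurable (borel \<Otimes>\<^sub>M borel)" for n
  proof (induction n)
    case (Suc n)
    then show ?case unfolding v_Suc using \<phi> by (intro duhamel_measurable) auto
  qed (simp add: v_def)
  have vm1: "(\<lambda>y. v n y s) \<in> borel_measurable borel" for n s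
    using measurable_compose[OF _ vm[of n], of "\<lambda>y. (y, s)" borel] by simp
  have vle: "v n x t \<le> ubar x t" if "0 < t" "t < T" for n x t
    using that
  proof (induction n arbitrary: x t)
    case (Suc n)
    have "v (Suc n) x t \<le> duhamel \<theta> \<phi> ubar x t"
      unfolding v_Suc by (rule duhamel_mono[of t T]) (use Suc fin in auto)
    also have "\<dots> \<le> ubar x t" by (rule super) (use Suc.prems in auto)
    finally show ?case .
  qed (simp add: v_def)
  have vfin: "v n x t < \<infinity>" if "0 < t" "t < T" for n x t using vle[OF that] fin[OF that] by (rule le_less_trans)
  have vstep: "v n x t \<le> v (Suc n) x t" if "0 < t" "t < T" for n x t
    using that
  proof (induction n arbitrary: x t)
    case (Suc n)
    show ?case unfolding v_Suc[of "Suc n"] v_Suc[of n, symmetric]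
      by (subst v_Suc, rule duhamel_mono[of t T]) (use Suc vfin in auto)
  qed (simp add: v_def)
  have vinc: "incseq (\<lambda>n. v n x t)" if "0 < t" "t < T" for x t by (rule incseq_SucI) (rule vstep[OF that])
  define V where "V x t = (SUP n. v n x t)" for x t
  have Vfin: "V x t < \<infinity>" if "0 < t" "t < T" for x t
    unfolding V_def using vle[OF that] fin[OF that] by (meson SUP_least le_less_trans)
  have eq: "V x t = duhamel \<theta> \<phi> V x t" if t: "0 < t" "t < T" for x t
  proof -
    let ?k = "\<lambda>s y. ennreal (frac_heat_kernel \<theta> (x - y) (t - s))"
    let ?g = "\<lambda>n s. (\<integral>\<^sup>+y. ?k s y * ennreal (f (enn2real (v n y s))) \<partial>lborel) * indicator {0<..<t} s"
    have fm[measurable]: "(\<lambda>y. ennreal (f (enn2real (v n y s)))) \<in> borel_measurable borel" for n s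
      using measurable_compose[OF vm1 source_measurable] .
    have finc: "incseq (\<lambda>n y. ?k s y * ennreal (f (enn2real (v n y s))))" if "s \<in> {0<..<t}" for s
    proof (rule incseq_SucI, rule le_funI)
      fix n y
      have s: "0 < s" "s < T" using that t by auto
      show "?k s y * ennreal (f (enn2real (v n y s))) \<le> ?k s y * ennreal (f (enn2real (v (Suc n) y s)))"
        using vstep[OF s, of n y] vfin[OF s, of "Suc n" y] by (intro mult_left_mono ennreal_leI f_mono enn2real_mono) auto
    qed
    have ginc: "incseq ?g"
    proof (rule incseq_SucI, rule le_funI)
      fix n s
      show "?g n s \<le> ?g (Suc n) s"
      proof (cases "s \<in> {0<..<t}")
        case True
        show ?thesis
          using incseq_SucD[OF finc[OF True], of n] by (intro mult_right_mono nn_integral_mono) (auto simp: le_fun_def)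
      qed simp
    qed
    have gm: "?g n \<in> borel_measurable lborel" for n
    proof -
      have [measurable]: "(\<lambda>p. ennreal (f (enn2real (v n (fst p) (snd p))))) \<in> borel_measurable (borel \<Otimes>\<^sub>M borel)"
        using measurable_compose[OF vm[of n] source_measurable] by (simp add: case_prod_beta)
      have f': "(\<lambda>q :: real \<times> (real ^ 'n). ennreal (f (enn2real (v n (snd q) (fst q))))) \<in> borel_measurable (lborel \<Otimes>\<^sub>M lborel)"
        using measurable_compose[of "\<lambda>q :: real \<times> (real ^ 'n). (snd q, fst q)" "lborel \<Otimes>\<^sub>M lborel" "borel \<Otimes>\<^sub>M borel" "\<lambda>p. ennreal (f (enn2real (v n (fst p) (snd p))))" borel]
        by simp
      have "(\<lambda>(s, y). ?k s y * ennreal (f (enn2real (v n y s)))) \<in> borel_measurable (lborel \<Otimes>\<^sub>M lborel)"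
        unfolding case_prod_beta by (rule borel_measurable_times_ennreal[OF _ f']) measurable
      then have "(\<lambda>s. \<integral>\<^sup>+y. ?k s y * ennreal (f (enn2real (v n y s))) \<partial>lborel) \<in> borel_measurable lborel"
        by (rule lborel.borel_measurable_nn_integral)
      then show ?thesis by (intro borel_measurable_times_ennreal borel_measurable_indicator) auto
    qed
    have gsup: "(SUP n. ?g n s) = (\<integral>\<^sup>+y. ?k s y * ennreal (f (enn2real (V y s))) \<partial>lborel) * indicator {0<..<t} s" for s
    proof (cases "s \<in> {0<..<t}")
      case True
      then have s: "0 < s" "s < T" using t by auto
      have "(SUP n. ?g n s) = (SUP n. \<integral>\<^sup>+y. ?k s y * ennreal (f (enn2real (v n y s))) \<partial>lborel)"
        using True by simp
      also have "\<dots> = (\<integral>\<^sup>+y. (SUP n. ?k s y * ennreal (f (enn2real (v n y s)))) \<partial>lborel)"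
        by (rule nn_integral_monotone_convergence_SUP[symmetric, OF finc[OF True]]) measurable
      also have "\<dots> = (\<integral>\<^sup>+y. ?k s y * ennreal (f (enn2real (V y s))) \<partial>lborel)"
      proof (rule nn_integral_cong)
        fix y
        have "(SUP n. ?k s y * ennreal (f (enn2real (v n y s)))) = ?k s y * (SUP n. ennreal (f (enn2real (v n y s))))"
          by (simp add: SUP_mult_left_ennreal)
        also have "(SUP n. ennreal (f (enn2real (v n y s)))) = ennreal (f (enn2real (V y s)))"
          unfolding V_def by (rule source_SUP[OF vinc[OF s]]) (use Vfin[OF s] in \<open>simp add: V_def\<close>)
        finally show "(SUP n. ?k s y * ennreal (f (enn2real (v n y s)))) = ?k s y * ennreal (f (enn2real (V y s)))" .
      qed
      finally show ?thesis using True by simp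
    qed simp
    have "(\<lambda>n. v (Suc n) x t) \<longlonglongrightarrow> V x t" unfolding V_def by (intro LIMSEQ_Suc LIMSEQ_SUP vinc t)
    moreover have "incseq (\<lambda>n. v (Suc n) x t)" by (rule incseq_SucI) (rule vstep[OF t])
    then have "(\<lambda>n. v (Suc n) x t) \<longlonglongrightarrow> (SUP n. v (Suc n) x t)" by (rule LIMSEQ_SUP)
    ultimately have "V x t = (SUP n. v (Suc n) x t)" by (rule LIMSEQ_unique)
    also have "\<dots> = (SUP n. (\<integral>\<^sup>+y. ennreal (frac_heat_kernel \<theta> (x - y) t) * ennreal (\<phi> y) \<partial>lborel) + (\<integral>\<^sup>+s. ?g n s \<partial>lborel))"
      unfolding v_Suc duhamel_def ..
    also have "\<dots> = (\<integral>\<^sup>+y. ennreal (frac_heat_kernel \<theta> (x - y) t) * ennreal (\<phi> y) \<partial>lborel) + (SUP n. \<integral>\<^sup>+s. ?g n s \<partial>lborel)"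
      by (rule ennreal_SUP_add_right[symmetric]) simp
    also have "(SUP n. \<integral>\<^sup>+s. ?g n s \<partial>lborel) = (\<integral>\<^sup>+s. (SUP n. ?g n s) \<partial>lborel)"
      by (rule nn_integral_monotone_convergence_SUP[symmetric, OF ginc gm])
    finally show ?thesis unfolding gsup duhamel_def .
  qed
  have Vm: "(\<lambda>p. V (fst p) (snd p)) \<in> borel_measurable (borel \<Otimes>\<^sub>M borel)"
    unfolding V_def using vm by (intro borel_measurable_SUP) (auto simp: case_prod_beta)
  have um: "(\<lambda>(x, t). enn2real (V x t)) \<in> borel_measurable (lebesgue_on (UNIV \<times> {0<..<T}))"
  proof -
    have "(\<lambda>p. enn2real (V (fst p) (snd p))) \<in> borel_measurable borel"
      using Vm unfolding borel_prod by measurable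
    then have "(\<lambda>p. enn2real (V (fst p) (snd p))) \<in> borel_measurable lebesgue"
      by (intro measurable_completion) simp
    then show ?thesis unfolding case_prod_beta by (rule measurable_restrict_space1)
  qed
  have "integral_solution \<theta> f \<phi> T (\<lambda>x t. enn2real (V x t))"
    unfolding integral_solution_def
  proof (intro conjI um allI ballI AE_I2)
    fix t x assume t: "t \<in> {0<..<T}"
    have "ennreal (enn2real (V x t)) = V x t" using Vfin[of t x] t by simp
    also have "\<dots> = duhamel \<theta> \<phi> V x t" using t by (intro eq) auto
    finally show "ennreal (enn2real (V x t)) = frac_heat_semigroup \<theta> t (\<lambda>y. ennreal (\<phi> y)) x +
          (\<integral>\<^sup>+s\<in>{0<..<t}. frac_heat_semigroup \<theta> (t - s) (\<lambda>y. ennreal (f (enn2real (V y s)))) x \<partial>lebesgue)"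
      unfolding duhamel_def frac_heat_semigroup_def nn_integral_completion .
  qed simp
  then show ?thesis unfolding has_local_solution_def using T by blast
qed

end


section \<open>A supersolution\<close>

context regular_source
begin

text \<open>
  Jensen's inequality for the convex function \<open>F\<close>\<open>\<^sup>-\<^sup>r\<close>, by integrating its supporting line at the mean
  value. The profile has mass \<open>\<mu>\<close>, so the mean value is \<open>W / \<mu>\<close>. The slope is positive, which also bounds
  the convolution of \<open>w\<close> by that of \<open>F\<close>\<open>\<^sup>-\<^sup>r\<close> and makes it finite.
\<close>

lemma profile_conv_jensen:
  fixes w :: "'a::euclidean_space \<Rightarrow> real" and x :: 'a
  assumes \<theta>: "0 < \<theta>" and t: "0 < t" and K: "0 < K"
    and line: "\<And>v0. K \<le> v0 \<Longrightarrow> \<exists>s>0. \<forall>v\<ge>K. F v0 powr (- r) + s * (v - v0) \<le> F v powr (- r)"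
    and [measurable]: "w \<in> borel_measurable borel" "(\<lambda>y. F (w y) powr (- r)) \<in> borel_measurable borel"
    and wK: "\<And>y. K \<le> w y"
    and \<mu>: "(\<integral>\<^sup>+(y::'a). ennreal (stable_profile \<theta> t y) \<partial>lborel) = ennreal \<mu>" "0 < \<mu>"
    and fin: "profile_conv \<theta> t (\<lambda>y. ennreal (F (w y) powr (- r))) x \<le> ennreal D" "0 \<le> D"
  obtains W where "profile_conv \<theta> t (\<lambda>y. ennreal (w y)) x = ennreal W" "K * \<mu> \<le> W" "F (W / \<mu>) powr (- r) \<le> D / \<mu>"
proof -
  let ?P = "\<lambda>y. stable_profile \<theta> t (x - y)"
  have P: "0 < ?P y" for y by (rule stable_profile_pos[OF t])
  have const: "(\<integral>\<^sup>+y. ennreal (?P y) * ennreal c \<partial>lborel) = ennreal (\<mu> * c)" for c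
    using profile_conv_const[of \<theta> t "ennreal c" x] \<mu> unfolding profile_conv_def by (simp add: ennreal_mult')
  have line_int: "ennreal (\<mu> * F v0 powr (- r)) + ennreal s * profile_conv \<theta> t (\<lambda>y. ennreal (w y)) x
      \<le> ennreal D + ennreal (\<mu> * (s * v0))"
    if v0: "K \<le> v0" and s: "0 < s" and l: "\<forall>v\<ge>K. F v0 powr (- r) + s * (v - v0) \<le> F v powr (- r)" for v0 s
  proof -
    have "ennreal (\<mu> * F v0 powr (- r)) + ennreal s * profile_conv \<theta> t (\<lambda>y. ennreal (w y)) x
       = (\<integral>\<^sup>+y. ennreal (?P y) * ennreal (F v0 powr (- r)) + ennreal s * (ennreal (?P y) * ennreal (w y)) \<partial>lborel)"
      by (subst nn_integral_add) (auto simp: const profile_conv_def nn_integral_cmult)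
    also have "\<dots> \<le> (\<integral>\<^sup>+y. ennreal (?P y) * ennreal (F (w y) powr (- r)) + ennreal (?P y) * ennreal (s * v0) \<partial>lborel)"
    proof (intro nn_integral_mono)
      fix y
      have "F v0 powr (- r) + s * w y \<le> F (w y) powr (- r) + s * v0"
        using l[rule_format, OF wK[of y]] by (simp add: right_diff_distrib)
      then have "?P y * (F v0 powr (- r) + s * w y) \<le> ?P y * (F (w y) powr (- r) + s * v0)"
        using P[of y] by (intro mult_left_mono) auto
      then have "ennreal (?P y * F v0 powr (- r) + s * (?P y * w y)) \<le> ennreal (?P y * F (w y) powr (- r) + ?P y * (s * v0))"
        by (intro ennreal_leI) (simp add: distrib_left mult_ac)
      moreover have "ennreal (?P y * F v0 powr (- r) + s * (?P y * w y)) = ennreal (?P y) * ennreal (F v0 powr (- r)) + ennreal s * (ennreal (?P y) * ennreal (w y))"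
        using P[of y] s wK[of y] K by (simp add: ennreal_mult' ennreal_plus)
      moreover have "ennreal (?P y * F (w y) powr (- r) + ?P y * (s * v0)) = ennreal (?P y) * ennreal (F (w y) powr (- r)) + ennreal (?P y) * ennreal (s * v0)"
        using P[of y] s v0 K by (simp add: ennreal_mult' ennreal_plus)
      ultimately show "ennreal (?P y) * ennreal (F v0 powr (- r)) + ennreal s * (ennreal (?P y) * ennreal (w y))
          \<le> ennreal (?P y) * ennreal (F (w y) powr (- r)) + ennreal (?P y) * ennreal (s * v0)" by (simp only:)
    qed
    also have "\<dots> = profile_conv \<theta> t (\<lambda>y. ennreal (F (w y) powr (- r))) x + ennreal (\<mu> * (s * v0))"
      by (subst nn_integral_add) (auto simp: const profile_conv_def)
    also have "\<dots> \<le> ennreal D + ennreal (\<mu> * (s * v0))" by (rule add_right_mono[OF fin(1)])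
    finally show ?thesis .
  qed
  \<comment> \<open>The supporting line at \<open>K\<close> shows that the convolution is finite.\<close>
  have "profile_conv \<theta> t (\<lambda>y. ennreal (w y)) x \<noteq> \<infinity>"
  proof
    assume inf: "profile_conv \<theta> t (\<lambda>y. ennreal (w y)) x = \<infinity>"
    obtain s where s: "0 < s" "\<forall>v\<ge>K. F K powr (- r) + s * (v - K) \<le> F v powr (- r)" using line[of K] by auto
    have "ennreal s * profile_conv \<theta> t (\<lambda>y. ennreal (w y)) x = \<infinity>" using inf s(1) by (simp add: ennreal_mult_top)
    then show False using line_int[OF order_refl s] by (simp add: top_unique ennreal_plus[symmetric] del: ennreal_plus)
  qed
  then obtain W where W0: "0 \<le> W" and W: "profile_conv \<theta> t (\<lambda>y. ennreal (w y)) x = ennreal W"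
    by (cases "profile_conv \<theta> t (\<lambda>y. ennreal (w y)) x") auto
  have "ennreal (\<mu> * K) \<le> profile_conv \<theta> t (\<lambda>y. ennreal (w y)) x"
    unfolding const[symmetric] profile_conv_def by (intro nn_integral_mono mult_left_mono ennreal_leI wK) auto
  then have KW: "K * \<mu> \<le> W" using W W0 by (simp add: mult.commute)
  define v0 where "v0 = W / \<mu>"
  have v0: "K \<le> v0" using KW \<mu> by (simp add: v0_def field_simps)
  obtain s where s: "0 < s" "\<forall>v\<ge>K. F v0 powr (- r) + s * (v - v0) \<le> F v powr (- r)" using line[OF v0] by auto
  have e: "\<mu> * (s * v0) = s * W" using \<mu> by (simp add: v0_def)
  have "ennreal (\<mu> * F v0 powr (- r) + s * W) = ennreal (\<mu> * F v0 powr (- r)) + ennreal s * ennreal W"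
    using \<mu> s W0 by (simp add: ennreal_mult' ennreal_plus)
  also have "\<dots> \<le> ennreal D + ennreal (s * W)" using line_int[OF v0 s] unfolding W e .
  also have "\<dots> = ennreal (D + s * W)" using fin(2) s W0 by (simp add: ennreal_plus)
  finally have le: "ennreal (\<mu> * F v0 powr (- r) + s * W) \<le> ennreal (D + s * W)" .
  have "0 \<le> D + s * W" using fin(2) s W0 by (intro add_nonneg_nonneg mult_nonneg_nonneg) auto
  from le[unfolded ennreal_le_iff[OF this]] have "\<mu> * F v0 powr (- r) \<le> D" by linarith
  then have "F v0 powr (- r) \<le> D / \<mu>" using \<mu>(2) by (simp add: pos_le_divide_eq mult.commute)
  then show ?thesis using that[OF W KW] by (simp add: v0_def)
qed

text \<open>
  Shifting the datum by \<open>K\<close> moves it to the range where \<open>F\<close>\<open>\<^sup>-\<^sup>r\<close> is convex. Where the datum is at least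
  \<open>K\<close> the shift at most doubles it, which costs a constant factor; elsewhere the shifted datum is bounded.
\<close>

lemma shifted_datum_uniformly_local:
  fixes \<phi> :: "'a::euclidean_space \<Rightarrow> real"
  assumes K: "0 < K" and r: "0 < r"
    and scale: "\<And>u. K \<le> u \<Longrightarrow> F (2 * u) powr (- r) \<le> c * F u powr (- r)" and c: "0 \<le> c"
    and \<phi> [measurable]: "\<phi> \<in> borel_measurable borel" and \<phi>0: "\<And>x. 0 \<le> \<phi> x"
    and ul: "(SUP y. \<integral>\<^sup>+x\<in>ball y \<rho>. ennreal (tail_int_neg_powr f r (\<phi> x)) \<partial>lborel) < \<infinity>" and \<rho>: "0 < \<rho>"
  obtains B where "B < \<infinity>" "\<And>z. (\<integral>\<^sup>+y\<in>ball z \<rho>. ennreal (F (\<phi> y + K) powr (- r)) \<partial>lborel) \<le> B"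
proof -
  let ?h = "\<lambda>y. ennreal (tail_int_neg_powr f r (\<phi> y))"
  define c1 where "c1 = F (2 * K) powr (- r)"
  have gbound: "ennreal (F (\<phi> y + K) powr (- r)) \<le> ennreal c * ?h y + ennreal c1" for y
  proof (cases "K \<le> \<phi> y")
    case True
    have "F (\<phi> y + K) powr (- r) \<le> F (2 * \<phi> y) powr (- r)" using True K r by (intro F_powr_mono) auto
    also have "\<dots> \<le> c * F (\<phi> y) powr (- r)" by (rule scale[OF True])
    also have "F (\<phi> y) powr (- r) = tail_int_neg_powr f r (\<phi> y)"
      using True K by (intro tail_int_neg_powr_eq[symmetric]) auto
    finally have "ennreal (F (\<phi> y + K) powr (- r)) \<le> ennreal (c * tail_int_neg_powr f r (\<phi> y))" by (rule ennreal_leI)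
    also have "\<dots> = ennreal c * ?h y" by (rule ennreal_mult'[OF c])
    also have "\<dots> \<le> \<dots> + ennreal c1" by simp
    finally show ?thesis .
  next
    case False
    have "F (\<phi> y + K) powr (- r) \<le> c1" unfolding c1_def using False K \<phi>0[of y] r by (intro F_powr_mono) auto
    then have "ennreal (F (\<phi> y + K) powr (- r)) \<le> ennreal c1" by (rule ennreal_leI)
    also have "\<dots> \<le> ennreal c * ?h y + ennreal c1" by simp
    finally show ?thesis .
  qed
  have hm [measurable]: "?h \<in> borel_measurable borel"
    using tail_int_neg_powr_measurable[OF \<phi> \<phi>0] by measurable
  let ?vol = "ennreal (unit_ball_vol DIM('a) * \<rho> ^ DIM('a))"
  show ?thesis
  proof (rule that[of "ennreal c * (SUP y. \<integral>\<^sup>+x\<in>ball y \<rho>. ?h x \<partial>lborel) + ennreal c1 * ?vol"])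
    show "ennreal c * (SUP y. \<integral>\<^sup>+x\<in>ball y \<rho>. ?h x \<partial>lborel) + ennreal c1 * ?vol < \<infinity>"
      using ul by (simp add: ennreal_mult_less_top)
    fix z
    have hz: "(\<lambda>y. ?h y * indicator (ball z \<rho>) y) \<in> borel_measurable lborel"
      "(\<lambda>y. ennreal c1 * indicator (ball z \<rho>) y) \<in> borel_measurable lborel"
      using hm by (auto intro!: borel_measurable_times_ennreal borel_measurable_indicator)
    have "(\<integral>\<^sup>+y\<in>ball z \<rho>. ennreal (F (\<phi> y + K) powr (- r)) \<partial>lborel)
      \<le> (\<integral>\<^sup>+y. ennreal c * (?h y * indicator (ball z \<rho>) y) + ennreal c1 * indicator (ball z \<rho>) y \<partial>lborel)"
      using gbound by (intro nn_integral_mono) (auto simp: indicator_def)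
    also have "\<dots> = (\<integral>\<^sup>+y. ennreal c * (?h y * indicator (ball z \<rho>) y) \<partial>lborel) + (\<integral>\<^sup>+y. ennreal c1 * indicator (ball z \<rho>) y \<partial>lborel)"
      by (rule nn_integral_add[OF borel_measurable_times_ennreal[OF borel_measurable_const hz(1)] hz(2)])
    also have "(\<integral>\<^sup>+y. ennreal c * (?h y * indicator (ball z \<rho>) y) \<partial>lborel) = ennreal c * (\<integral>\<^sup>+y\<in>ball z \<rho>. ?h y \<partial>lborel)"
      by (rule nn_integral_cmult[OF hz(1)])
    also have "(\<integral>\<^sup>+y. ennreal c1 * indicator (ball z \<rho>) y \<partial>lborel) = ennreal c1 * ?vol"
      using \<rho> emeasure_ball[of \<rho> z] by (simp add: nn_integral_cmult_indicator)
    finally show "(\<integral>\<^sup>+y\<in>ball z \<rho>. ennreal (F (\<phi> y + K) powr (- r)) \<partial>lborel)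
        \<le> ennreal c * (SUP y. \<integral>\<^sup>+x\<in>ball y \<rho>. ?h x \<partial>lborel) + ennreal c1 * ?vol"
      by (rule order_trans) (intro add_right_mono mult_left_mono SUP_upper; simp)
  qed
qed

text \<open>
  Jensen's inequality and the uniformly local bound give \<open>F (W t)\<close>\<open>\<^sup>-\<^sup>r \<lesssim> t\<close> to the power \<open>- N / \<theta>\<close> for the
  convolution \<open>W t\<close> of the shifted datum with the profile. Since \<open>f u \<lesssim> u / F u\<close>, the source term
  at a multiple of \<open>W t\<close> is at most \<open>W t\<close> times \<open>t\<close> to the power \<open>- N / (r \<theta>)\<close>, up to constants.
\<close>

lemma source_profile_conv_le:
  fixes \<phi> :: "real ^ 'n \<Rightarrow> real"
  assumes \<theta>: "0 < \<theta>" and \<rho>: "0 < \<rho>" and r0: "0 < r"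
    and ev: "eventually (\<lambda>u. deriv f u * F u \<le> r + 1) at_top"
    and \<phi>m: "\<phi> \<in> borel_measurable borel" and \<phi>0: "\<And>x. 0 \<le> \<phi> x"
    and ul: "(SUP y. \<integral>\<^sup>+x\<in>ball y \<rho>. ennreal (tail_int_neg_powr f r (\<phi> x)) \<partial>lborel) < \<infinity>"
  obtains K \<Lambda> G where "0 < K" "L \<le> \<Lambda>" "0 \<le> G"
    "\<And>x t. 0 < t \<Longrightarrow> t \<le> 1 \<Longrightarrow> profile_conv \<theta> t (\<lambda>y. ennreal (\<phi> y + K)) x < \<infinity>"
    "\<And>x t. 0 < t \<Longrightarrow> t \<le> 1 \<Longrightarrow> ennreal (f (enn2real (ennreal \<Lambda> * profile_conv \<theta> t (\<lambda>y. ennreal (\<phi> y + K)) x)))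
      \<le> ennreal (G * \<Lambda> * t powr (- (real CARD('n) / (\<theta> * r)))) * profile_conv \<theta> t (\<lambda>y. ennreal (\<phi> y + K)) x"
proof -
  let ?n = "CARD('n)"
  note \<phi>m [measurable]
  obtain K1 where K1: "0 < K1" and line: "\<And>v0. K1 \<le> v0 \<Longrightarrow> \<exists>s>0. \<forall>v\<ge>K1. F v0 powr (- r) + s * (v - v0) \<le> F v powr (- r)"
    by (rule F_powr_supporting_line[OF ev r0], rule that)
  obtain \<gamma> K2 where \<gamma>: "0 < \<gamma>" and K2: "0 < K2" and scale: "\<And>u l. K2 \<le> u \<Longrightarrow> 1 \<le> l \<Longrightarrow> F u \<le> l powr \<gamma> * F (l * u)"
    by (rule F_scale, rule that)
  obtain C3 K3 where C3: "0 < C3" and K3: "0 < K3" and up: "\<And>u. K3 \<le> u \<Longrightarrow> f u * F u \<le> C3 * u"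
    by (rule fF_upper[OF ev], rule that)
  define K where "K = max K1 (max K2 K3)"
  have K: "0 < K" "K1 \<le> K" "K2 \<le> K" "K3 \<le> K" using K1 by (auto simp: K_def)
  have lineK: "\<exists>s>0. \<forall>v\<ge>K. F v0 powr (- r) + s * (v - v0) \<le> F v powr (- r)" if "K \<le> v0" for v0
    using line[of v0] that K by (meson order_trans)
  have gscale: "F (l * u) powr (- r) \<le> l powr (\<gamma> * r) * F u powr (- r)" if "K \<le> u" "1 \<le> l" for l u
  proof -
    have pos: "0 < F u" "0 < F (l * u)" "0 < l powr \<gamma>" using that K by (auto intro!: F_pos mult_pos_pos)
    have "(l powr \<gamma> * F (l * u)) powr (- r) \<le> F u powr (- r)"
      using scale[of u l] that K pos r0 by (intro powr_mono2') auto
    then have "l powr (\<gamma> * r) * ((l powr \<gamma> * F (l * u)) powr (- r)) \<le> l powr (\<gamma> * r) * F u powr (- r)" by (intro mult_left_mono) auto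
    also have "l powr (\<gamma> * r) * ((l powr \<gamma> * F (l * u)) powr (- r)) = F (l * u) powr (- r)"
    proof -
      have "l powr (\<gamma> * r) * (l powr \<gamma>) powr (- r) = 1" unfolding powr_powr powr_add[symmetric] using that by simp
      then show ?thesis by (simp only: powr_mult mult.assoc[symmetric] mult_1)
    qed
    finally show ?thesis .
  qed
  define w where "w y = \<phi> y + K" for y
  have wm [measurable]: "w \<in> borel_measurable borel" unfolding w_def by measurable
  have wK: "K \<le> w y" for y using \<phi>0[of y] by (simp add: w_def)
  have gm [measurable]: "(\<lambda>y. F (w y) powr (- r)) \<in> borel_measurable borel"
  proof -
    have "continuous_on {K..} F" using K by (intro continuous_on_F) auto
    then have "(\<lambda>u. indicator {K..} u *\<^sub>R F u) \<in> borel_measurable borel"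
      by (intro borel_measurable_continuous_on_indicator) auto
    from measurable_compose[OF wm this] have "(\<lambda>y. F (w y)) \<in> borel_measurable borel" using wK by simp
    then show ?thesis by measurable
  qed
  obtain B where Bfin: "B < \<infinity>" and Bb: "\<And>z. (\<integral>\<^sup>+y\<in>ball z \<rho>. ennreal (F (w y) powr (- r)) \<partial>lborel) \<le> B"
  proof (rule shifted_datum_uniformly_local[OF K(1) r0 _ _ \<phi>m \<phi>0 ul \<rho>])
    show "F (2 * u) powr (- r) \<le> 2 powr (\<gamma> * r) * F u powr (- r)" if "K \<le> u" for u
      by (rule gscale[OF that]) simp
  qed (use that in \<open>auto simp: w_def\<close>)
  obtain C6 where C6: "0 \<le> C6" and ulb: "\<And>(\<psi> :: real ^ 'n \<Rightarrow> ennreal) B x t. \<psi> \<in> borel_measurable borel \<Longrightarrow>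
     (\<And>z. (\<integral>\<^sup>+y\<in>ball z \<rho>. \<psi> y \<partial>lborel) \<le> B) \<Longrightarrow> 0 < t \<Longrightarrow> t \<le> 1 \<Longrightarrow>
     profile_conv \<theta> t \<psi> x \<le> ennreal (C6 * t powr (- real DIM(real ^ 'n) / \<theta>)) * B"
    by (rule profile_conv_uniformly_local_bound[OF \<theta> \<rho>, where 'a = "real ^ 'n"], rule that, assumption, blast)
  obtain M where M: "0 \<le> M" "\<And>t. 0 < t \<Longrightarrow> (\<integral>\<^sup>+(x::real ^ 'n). ennreal (stable_profile \<theta> t x) \<partial>lborel) \<le> ennreal M"
    by (rule stable_profile_mass_le[OF \<theta>, where 'a = "real ^ 'n"], rule that)
  define V where "V = unit_ball_vol (real ?n)"
  have V: "0 < V" by (simp add: V_def)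
  define D where "D = C6 * enn2real B"
  have D: "0 \<le> D" using C6 by (simp add: D_def)
  \<comment> \<open>The second bound keeps \<open>\<Lambda> W\<close> at least \<open>K\<close>, since the profile has mass at least \<open>V\<close>.\<close>
  define \<Lambda> where "\<Lambda> = max L (1 / V)"
  have \<Lambda>: "0 < \<Lambda>" "L \<le> \<Lambda>" "1 \<le> \<Lambda> * V"
  proof -
    show "0 < \<Lambda>" "L \<le> \<Lambda>" using V by (auto simp: \<Lambda>_def less_max_iff_disj)
    have "1 / V \<le> \<Lambda>" by (simp add: \<Lambda>_def)
    then show "1 \<le> \<Lambda> * V" using V by (simp add: field_simps)
  qed
  define W where "W x t = profile_conv \<theta> t (\<lambda>y. ennreal (w y)) x" for x t
  define E where "E = (\<Lambda> * M) powr (\<gamma> * r) * (D / V)"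
  have E: "0 \<le> E" using D V by (simp add: E_def)
  define G where "G = C3 * E powr (1 / r)"
  have G: "0 \<le> G" using C3 by (simp add: G_def)
  have root: "(X powr (- r)) powr (1 / r) = 1 / X" if "0 < X" for X :: real
    unfolding powr_powr using that r0 by (simp add: powr_minus_divide)
  have time_root: "(E * t powr (- real ?n / \<theta>)) powr (1 / r) = E powr (1 / r) * t powr (- (real ?n / (\<theta> * r)))" for t
    unfolding powr_mult powr_powr by simp
  have source_le: "f u \<le> C3 * u * (1 / F u)" if "K \<le> u" for u
    using up[of u] that K F_pos[of u] by (simp add: pos_le_divide_eq)
  have main: "W x t < \<infinity> \<and> ennreal (f (enn2real (ennreal \<Lambda> * W x t))) \<le> ennreal (G * \<Lambda> * t powr (- (real ?n / (\<theta> * r)))) * W x t"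
    if t: "0 < t" "t \<le> 1" for x t
  proof -
    obtain \<mu> where \<mu>: "(\<integral>\<^sup>+(y::real ^ 'n). ennreal (stable_profile \<theta> t y) \<partial>lborel) = ennreal \<mu>" "0 \<le> \<mu>"
      using M(2)[OF t(1)] by (cases "\<integral>\<^sup>+(y::real ^ 'n). ennreal (stable_profile \<theta> t y) \<partial>lborel") (auto simp: top_unique)
    have \<mu>M: "\<mu> \<le> M" using M(2)[OF t(1)] M(1) unfolding \<mu>(1) by simp
    have "ennreal V \<le> ennreal \<mu>" using stable_profile_mass_ge[OF \<theta> t(1), where 'a = "real ^ 'n"] unfolding \<mu>(1) V_def by simp
    then have V\<mu>: "V \<le> \<mu>" using \<mu>(2) by simp
    have \<mu>0: "0 < \<mu>" using V V\<mu> by simp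
    let ?D = "D * t powr (- real ?n / \<theta>)"
    have "profile_conv \<theta> t (\<lambda>y. ennreal (F (w y) powr (- r))) x \<le> ennreal (C6 * t powr (- real DIM(real ^ 'n) / \<theta>)) * B"
      by (rule ulb[OF _ Bb t]) measurable
    also have "\<dots> = ennreal (C6 * t powr (- real DIM(real ^ 'n) / \<theta>)) * ennreal (enn2real B)" using Bfin by simp
    also have "\<dots> = ennreal (C6 * t powr (- real DIM(real ^ 'n) / \<theta>) * enn2real B)"
      using C6 by (intro ennreal_mult'[symmetric]) auto
    also have "C6 * t powr (- real DIM(real ^ 'n) / \<theta>) * enn2real B = ?D" by (simp add: D_def mult_ac)
    finally have conv: "profile_conv \<theta> t (\<lambda>y. ennreal (F (w y) powr (- r))) x \<le> ennreal ?D" .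
    obtain Wr where Wr: "profile_conv \<theta> t (\<lambda>y. ennreal (w y)) x = ennreal Wr" "K * \<mu> \<le> Wr" "F (Wr / \<mu>) powr (- r) \<le> ?D / \<mu>"
      by (rule profile_conv_jensen[OF \<theta> t(1) K(1) lineK wm gm wK \<mu>(1) \<mu>0 conv]) (use D in auto)
    have Wr0: "0 < Wr" using Wr(2) K \<mu>0 by (meson less_le_trans mult_pos_pos)
    have W: "W x t = ennreal Wr" unfolding W_def by (rule Wr(1))
    define v0 where "v0 = Wr / \<mu>"
    have v0: "K \<le> v0" using Wr(2) \<mu>0 by (simp add: v0_def field_simps)
    have l1: "1 \<le> \<Lambda> * \<mu>" using \<Lambda> V\<mu> mult_left_mono[OF V\<mu>, of \<Lambda>] by linarith
    have eq: "\<Lambda> * Wr = (\<Lambda> * \<mu>) * v0" using \<mu>0 by (simp add: v0_def)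
    have big: "K \<le> \<Lambda> * Wr"
    proof -
      have "1 * K \<le> (\<Lambda> * \<mu>) * v0" by (rule mult_mono[OF l1 v0]) (use K \<Lambda> \<mu>0 in simp_all)
      then show ?thesis unfolding eq mult_1 .
    qed
    have "F (\<Lambda> * Wr) powr (- r) \<le> (\<Lambda> * \<mu>) powr (\<gamma> * r) * F v0 powr (- r)"
      unfolding eq by (rule gscale[OF v0 l1])
    also have "\<dots> \<le> (\<Lambda> * M) powr (\<gamma> * r) * (?D / V)"
    proof (rule mult_mono)
      show "(\<Lambda> * \<mu>) powr (\<gamma> * r) \<le> (\<Lambda> * M) powr (\<gamma> * r)"
        using \<Lambda> \<mu>M \<mu>0 \<gamma> r0 by (intro powr_mono2 mult_left_mono) auto
      have "F v0 powr (- r) \<le> ?D / \<mu>" using Wr(3) by (simp add: v0_def)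
      also have "\<dots> \<le> ?D / V" using D V V\<mu> by (intro divide_left_mono) (auto intro: mult_pos_pos \<mu>0)
      finally show "F v0 powr (- r) \<le> ?D / V" .
    qed auto
    also have "\<dots> = E * t powr (- real ?n / \<theta>)" by (simp add: E_def)
    finally have gE: "F (\<Lambda> * Wr) powr (- r) \<le> E * t powr (- real ?n / \<theta>)" .
    have Fp: "0 < F (\<Lambda> * Wr)" using big K by (intro F_pos) auto
    have "1 / F (\<Lambda> * Wr) = (F (\<Lambda> * Wr) powr (- r)) powr (1 / r)"
      by (rule root[OF Fp, symmetric])
    also have "\<dots> \<le> (E * t powr (- real ?n / \<theta>)) powr (1 / r)" using r0 by (intro powr_mono2 gE) simp_all
    also have "\<dots> = E powr (1 / r) * t powr (- (real ?n / (\<theta> * r)))" by (rule time_root)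
    finally have inv: "1 / F (\<Lambda> * Wr) \<le> E powr (1 / r) * t powr (- (real ?n / (\<theta> * r)))" .
    have "f (\<Lambda> * Wr) \<le> C3 * (\<Lambda> * Wr) * (1 / F (\<Lambda> * Wr))"
      by (rule source_le[OF big])
    also have "\<dots> \<le> C3 * (\<Lambda> * Wr) * (E powr (1 / r) * t powr (- (real ?n / (\<theta> * r))))"
      using C3 \<Lambda>(1) Wr0 by (intro mult_left_mono inv) simp
    also have "\<dots> = G * \<Lambda> * t powr (- (real ?n / (\<theta> * r))) * Wr" by (simp only: G_def mult_ac)
    finally have "ennreal (f (\<Lambda> * Wr)) \<le> ennreal (G * \<Lambda> * t powr (- (real ?n / (\<theta> * r))) * Wr)" by (rule ennreal_leI)
    also have "\<dots> = ennreal (G * \<Lambda> * t powr (- (real ?n / (\<theta> * r)))) * ennreal Wr"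
      using G \<Lambda> by (intro ennreal_mult') auto
    finally have fin: "ennreal (f (\<Lambda> * Wr)) \<le> ennreal (G * \<Lambda> * t powr (- (real ?n / (\<theta> * r)))) * ennreal Wr" .
    have "enn2real (ennreal \<Lambda> * ennreal Wr) = \<Lambda> * Wr"
      using \<Lambda>(1) Wr0 by (subst ennreal_mult'[symmetric]) simp_all
    then show ?thesis using fin unfolding W by (simp only: ennreal_less_top infinity_ennreal_def)
  qed
  show ?thesis
    by (rule that[OF K(1) \<Lambda>(2) G main[THEN conjunct1, unfolded W_def w_def] main[THEN conjunct2, unfolded W_def w_def]])
qed

text \<open>
  The supersolution is a multiple of the convolution \<open>W t\<close>. The reaction acts on it as a linear potential
  that is integrable in time, so for a short time the Duhamel integral is at most half of it.
\<close>

lemma local_existence: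
  fixes \<phi> :: "real ^ 'n \<Rightarrow> real"
  assumes \<theta>: "0 < \<theta>" "\<theta> \<le> 2" and \<rho>: "0 < \<rho>" and r: "real CARD('n) / \<theta> < r"
    and ev: "eventually (\<lambda>u. deriv f u * F u \<le> r + 1) at_top"
    and \<phi>m: "\<phi> \<in> borel_measurable borel" and \<phi>0: "\<And>x. 0 \<le> \<phi> x"
    and ul: "(SUP y. \<integral>\<^sup>+x\<in>ball y \<rho>. ennreal (tail_int_neg_powr f r (\<phi> x)) \<partial>lborel) < \<infinity>"
  shows "has_local_solution \<theta> f \<phi>"
proof -
  note \<phi>m [measurable]
  have r0: "0 < r" using r \<theta> by (meson divide_nonneg_pos le_less_trans of_nat_0_le_iff)
  define \<beta> where "\<beta> = real CARD('n) / (\<theta> * r)"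
  have \<beta>: "0 < \<beta>" "\<beta> < 1" using \<theta> r r0 by (auto simp: \<beta>_def field_simps)
  obtain A where A: "0 < A" and kconv: "\<And>(\<psi> :: real ^ 'n \<Rightarrow> ennreal) t x. 0 < t \<Longrightarrow> \<psi> \<in> borel_measurable borel \<Longrightarrow>
    (\<integral>\<^sup>+y. ennreal (frac_heat_kernel \<theta> (x - y) t) * \<psi> y \<partial>lborel) \<le> ennreal A * profile_conv \<theta> t \<psi> x"
    by (rule frac_heat_kernel_conv_le_profile_conv[OF \<theta>, where 'n = 'n], rule that)
  obtain C5 where C5: "0 < C5" and comp: "\<And>a b (\<psi> :: real ^ 'n \<Rightarrow> ennreal) x. 0 < a \<Longrightarrow> 0 < b \<Longrightarrow> \<psi> \<in> borel_measurable borel \<Longrightarrow>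
     profile_conv \<theta> a (profile_conv \<theta> b \<psi>) x \<le> ennreal C5 * profile_conv \<theta> (a + b) \<psi> x"
    by (rule profile_conv_comp_le[OF \<theta>(1), where 'a = "real ^ 'n"], rule that)
  obtain K \<Lambda> G where K: "0 < K" and \<Lambda>2: "2 * A \<le> \<Lambda>" and G: "0 \<le> G"
    and Wfin: "\<And>x t. 0 < t \<Longrightarrow> t \<le> 1 \<Longrightarrow> profile_conv \<theta> t (\<lambda>y. ennreal (\<phi> y + K)) x < \<infinity>"
    and source: "\<And>x t. 0 < t \<Longrightarrow> t \<le> 1 \<Longrightarrow> ennreal (f (enn2real (ennreal \<Lambda> * profile_conv \<theta> t (\<lambda>y. ennreal (\<phi> y + K)) x)))
      \<le> ennreal (G * \<Lambda> * t powr (- (real CARD('n) / (\<theta> * r)))) * profile_conv \<theta> t (\<lambda>y. ennreal (\<phi> y + K)) x"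
    by (rule source_profile_conv_le[OF \<theta>(1) \<rho> r0 ev \<phi>m \<phi>0 ul, where L = "2 * A"], rule that)
  note source = source[folded \<beta>_def]
  have \<Lambda>: "0 < \<Lambda>" "2 * A \<le> \<Lambda>" using A \<Lambda>2 by linarith+
  define W where "W x t = profile_conv \<theta> t (\<lambda>y. ennreal (\<phi> y + K)) x" for x t
  \<comment> \<open>The time for which the Duhamel integral is at most half of the supersolution.\<close>
  have "- real DIM(real) < - \<beta>" using \<beta> by simp
  then obtain C7 where C7: "0 \<le> C7" and tint: "\<And>R. 0 < R \<Longrightarrow> (\<integral>\<^sup>+s\<in>{s::real. s \<noteq> 0 \<and> norm s < R}. ennreal (norm s powr (- \<beta>)) \<partial>lborel) \<le> ennreal (C7 * R powr (real DIM(real) + (- \<beta>)))"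
    using nn_integral_norm_powr_ball[where 'a = real] by blast
  define Q where "Q = A * (G * \<Lambda>) * C5"
  have Q: "0 \<le> Q" using A G \<Lambda> C5 by (simp add: Q_def)
  define T where "T = min 1 ((\<Lambda> / 2 / (Q * C7 + 1)) powr (1 / (1 - \<beta>)))"
  have QC: "0 < Q * C7 + 1" using Q C7 by (simp add: add_nonneg_pos)
  have T: "0 < T" "T \<le> 1" using \<Lambda> QC by (simp_all add: T_def)
  have Tsmall: "Q * (C7 * t powr (1 - \<beta>)) \<le> \<Lambda> / 2" if "0 < t" "t < T" for t
  proof -
    have "t powr (1 - \<beta>) \<le> ((\<Lambda> / 2 / (Q * C7 + 1)) powr (1 / (1 - \<beta>))) powr (1 - \<beta>)"
      using that \<beta> by (intro powr_mono2) (auto simp: T_def)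
    also have "\<dots> = \<Lambda> / 2 / (Q * C7 + 1)" using \<beta> \<Lambda> QC by (simp add: powr_powr)
    finally have "(Q * C7 + 1) * t powr (1 - \<beta>) \<le> \<Lambda> / 2" using QC by (simp only: pos_le_divide_eq mult.commute)
    moreover have "Q * C7 * t powr (1 - \<beta>) \<le> (Q * C7 + 1) * t powr (1 - \<beta>)" by (intro mult_right_mono) auto
    ultimately show ?thesis by (simp only: mult.assoc)
  qed
  have Wm [measurable]: "(\<lambda>y. W y s) \<in> borel_measurable borel" for s
    unfolding W_def profile_conv_def by measurable
  show ?thesis
  proof (rule solution_below_supersolution[of \<phi> T \<theta> "\<lambda>x t. ennreal \<Lambda> * W x t"])
    show "\<phi> \<in> borel_measurable lborel" by simp
    show "0 < T" by (rule T)
    fix x :: "real ^ 'n" and t :: real assume t: "0 < t" "t < T"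
    then have t1: "t \<le> 1" using T by simp
    show "ennreal \<Lambda> * W x t < \<infinity>" using Wfin[OF t(1) t1, of x] by (simp add: W_def ennreal_mult_less_top)
    have lin: "(\<integral>\<^sup>+y. ennreal (frac_heat_kernel \<theta> (x - y) t) * ennreal (\<phi> y) \<partial>lborel) \<le> ennreal (\<Lambda> / 2) * W x t"
    proof -
      have "(\<integral>\<^sup>+y. ennreal (frac_heat_kernel \<theta> (x - y) t) * ennreal (\<phi> y) \<partial>lborel) \<le> ennreal A * profile_conv \<theta> t (\<lambda>y. ennreal (\<phi> y)) x"
        by (rule kconv[OF t(1)]) measurable
      also have "\<dots> \<le> ennreal (\<Lambda> / 2) * W x t"
        unfolding W_def profile_conv_def
        using \<Lambda> K by (intro mult_mono nn_integral_mono mult_left_mono ennreal_leI) auto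
      finally show ?thesis .
    qed
    let ?I = "\<lambda>s. \<integral>\<^sup>+y. ennreal (frac_heat_kernel \<theta> (x - y) (t - s)) * ennreal (f (enn2real (ennreal \<Lambda> * W y s))) \<partial>lborel"
    have react: "?I s * indicator {0<..<t} s
        \<le> ennreal Q * W x t * (ennreal (norm s powr (- \<beta>)) * indicator {s. s \<noteq> 0 \<and> norm s < t} s)" for s
    proof (cases "s \<in> {0<..<t}")
      case True
      then have s: "0 < s" "s \<le> 1" "0 < t - s" using t1 by auto
      have fm: "(\<lambda>y. ennreal (f (enn2real (ennreal \<Lambda> * W y s)))) \<in> borel_measurable borel"
        by (rule measurable_compose[OF _ source_measurable]) measurable
      have "?I s
          \<le> ennreal A * profile_conv \<theta> (t - s) (\<lambda>y. ennreal (f (enn2real (ennreal \<Lambda> * W y s)))) x"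
        by (rule kconv[OF s(3) fm])
      also have "\<dots> \<le> ennreal A * profile_conv \<theta> (t - s) (\<lambda>y. ennreal (G * \<Lambda> * s powr (- \<beta>)) * W y s) x"
        unfolding profile_conv_def[of \<theta> "t - s"] using source[OF s(1,2)] by (intro mult_left_mono nn_integral_mono) (simp_all add: W_def)
      also have "\<dots> \<le> ennreal A * (ennreal (G * \<Lambda> * s powr (- \<beta>)) * (ennreal C5 * W x t))"
      proof (rule mult_left_mono)
        have "profile_conv \<theta> (t - s) (\<lambda>y. ennreal (G * \<Lambda> * s powr (- \<beta>)) * W y s) x
            = (\<integral>\<^sup>+y. ennreal (G * \<Lambda> * s powr (- \<beta>)) * (ennreal (stable_profile \<theta> (t - s) (x - y)) * W y s) \<partial>lborel)"
          unfolding profile_conv_def[of \<theta> "t - s"] by (simp only: mult_ac)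
        also have "\<dots> = ennreal (G * \<Lambda> * s powr (- \<beta>)) * profile_conv \<theta> (t - s) (\<lambda>y. W y s) x"
          unfolding profile_conv_def[of \<theta> "t - s"] by (rule nn_integral_cmult) measurable
        also have "\<dots> \<le> ennreal (G * \<Lambda> * s powr (- \<beta>)) * (ennreal C5 * W x t)"
        proof (rule mult_left_mono)
          have "(\<lambda>y. W y s) = profile_conv \<theta> s (\<lambda>y. ennreal (\<phi> y + K))" by (simp add: W_def fun_eq_iff)
          then show "profile_conv \<theta> (t - s) (\<lambda>y. W y s) x \<le> ennreal C5 * W x t"
            using comp[OF s(3) s(1), of "\<lambda>y. ennreal (\<phi> y + K)" x] by (simp add: W_def)
        qed simp
        finally show "profile_conv \<theta> (t - s) (\<lambda>y. ennreal (G * \<Lambda> * s powr (- \<beta>)) * W y s) x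
            \<le> ennreal (G * \<Lambda> * s powr (- \<beta>)) * (ennreal C5 * W x t)" .
      qed simp
      also have "\<dots> = ennreal Q * W x t * ennreal (s powr (- \<beta>))"
      proof -
        have "ennreal Q = ennreal A * ennreal (G * \<Lambda>) * ennreal C5"
          using A G \<Lambda> C5 unfolding Q_def by (simp only: ennreal_mult' mult_nonneg_nonneg less_imp_le)
        moreover have "ennreal (G * \<Lambda> * s powr (- \<beta>)) = ennreal (G * \<Lambda>) * ennreal (s powr (- \<beta>))"
          using G \<Lambda> by (intro ennreal_mult') auto
        ultimately show ?thesis by (simp only: mult_ac)
      qed
      finally have "?I s
          \<le> ennreal Q * W x t * ennreal (s powr (- \<beta>))" .
      moreover have "norm s = s" "indicator {s. s \<noteq> 0 \<and> norm s < t} s = (1 :: ennreal)" "indicator {0<..<t} s = (1 :: ennreal)"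
        using True by auto
      ultimately show ?thesis by (simp only: mult_1_right)
    qed simp
    have "(\<integral>\<^sup>+s\<in>{0<..<t}. ?I s \<partial>lborel)
        \<le> (\<integral>\<^sup>+(s::real). ennreal Q * W x t * (ennreal (norm s powr (- \<beta>)) * indicator {s. s \<noteq> 0 \<and> norm s < t} s) \<partial>lborel)"
      by (rule nn_integral_mono, rule react)
    also have "\<dots> = ennreal Q * W x t * (\<integral>\<^sup>+s\<in>{s::real. s \<noteq> 0 \<and> norm s < t}. ennreal (norm s powr (- \<beta>)) \<partial>lborel)"
      by (rule nn_integral_cmult) measurable
    also have "\<dots> \<le> ennreal Q * W x t * ennreal (C7 * t powr (real DIM(real) + (- \<beta>)))"
      by (rule mult_left_mono[OF tint[OF t(1)] zero_le])
    also have "\<dots> = ennreal (Q * (C7 * t powr (1 - \<beta>))) * W x t"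
    proof -
      have "real DIM(real) + (- \<beta>) = 1 - \<beta>" by simp
      moreover have "ennreal (Q * (C7 * t powr (1 - \<beta>))) = ennreal Q * ennreal (C7 * t powr (1 - \<beta>))"
        by (rule ennreal_mult'[OF Q])
      ultimately show ?thesis by (simp only: mult_ac)
    qed
    also have "\<dots> \<le> ennreal (\<Lambda> / 2) * W x t" by (rule mult_right_mono[OF ennreal_leI[OF Tsmall[OF t]] zero_le])
    finally have "duhamel \<theta> \<phi> (\<lambda>x t. ennreal \<Lambda> * W x t) x t \<le> ennreal (\<Lambda> / 2) * W x t + ennreal (\<Lambda> / 2) * W x t"
      unfolding duhamel_def by (rule add_mono[OF lin])
    also have "\<dots> = ennreal \<Lambda> * W x t"
    proof -
      have "ennreal (\<Lambda> / 2) + ennreal (\<Lambda> / 2) = ennreal \<Lambda>"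
        by (subst ennreal_plus[symmetric]) (use \<Lambda>(1) in simp_all)
      then show ?thesis unfolding distrib_right[symmetric] by simp
    qed
    finally show "duhamel \<theta> \<phi> (\<lambda>x t. ennreal \<Lambda> * W x t) x t \<le> ennreal \<Lambda> * W x t" .
  qed
qed

lemma has_local_solution_cong_AE:
  fixes \<phi> \<phi>' :: "real ^ 'n \<Rightarrow> real"
  assumes "AE x in lebesgue. \<phi> x = \<phi>' x"
  shows "has_local_solution \<theta> f \<phi> \<longleftrightarrow> has_local_solution \<theta> f \<phi>'"
proof -
  have "frac_heat_semigroup \<theta> t (\<lambda>y. ennreal (\<phi> y)) = frac_heat_semigroup \<theta> t (\<lambda>y. ennreal (\<phi>' y))" for t
    unfolding frac_heat_semigroup_def using assms by (intro ext nn_integral_cong_AE) auto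
  then show ?thesis unfolding has_local_solution_def integral_solution_def by simp
qed

lemma local_existence_lebesgue:
  fixes \<phi> :: "real ^ 'n \<Rightarrow> real"
  assumes \<theta>: "0 < \<theta>" "\<theta> \<le> 2" and \<rho>: "0 < \<rho>" and r: "real CARD('n) / \<theta> < r"
    and ev: "eventually (\<lambda>u. deriv f u * F u \<le> r + 1) at_top"
    and \<phi>m: "\<phi> \<in> borel_measurable lebesgue" and \<phi>0: "\<forall>x. 0 \<le> \<phi> x"
    and ul: "(\<lambda>x. tail_int_neg_powr f r (\<phi> x)) \<in> L1_ul \<rho>"
  shows "has_local_solution \<theta> f \<phi>"
proof -
  obtain \<phi>1 where \<phi>1[measurable]: "\<phi>1 \<in> borel_measurable lborel" and ae1: "AE x in lborel. \<phi> x = \<phi>1 x"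
    using completion_ex_borel_measurable_real[OF \<phi>m] by auto
  define \<phi>' where "\<phi>' x = max (\<phi>1 x) 0" for x
  have "AE x in lborel. \<phi> x = \<phi>' x"
    using ae1
  proof eventually_elim
    case (elim x)
    then show ?case using \<phi>0[rule_format, of x] by (simp add: \<phi>'_def)
  qed
  then have ae: "AE x in lebesgue. \<phi> x = \<phi>' x" by (rule AE_completion)
  have "has_local_solution \<theta> f \<phi>'"
  proof (rule local_existence[OF \<theta> \<rho> r ev])
    show "\<phi>' \<in> borel_measurable borel" using \<phi>1 unfolding \<phi>'_def by simp
    show "0 \<le> \<phi>' x" for x by (simp add: \<phi>'_def)
    have eq: "(\<integral>\<^sup>+x\<in>ball y \<rho>. ennreal (tail_int_neg_powr f r (\<phi>' x)) \<partial>lborel) = (\<integral>\<^sup>+x\<in>ball y \<rho>. ennreal \<bar>tail_int_neg_powr f r (\<phi> x)\<bar> \<partial>lebesgue)" for y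
    proof (subst nn_integral_completion[of lborel, symmetric], rule nn_integral_cong_AE)
      show "AE x in lebesgue. ennreal (tail_int_neg_powr f r (\<phi>' x)) * indicator (ball y \<rho>) x = ennreal \<bar>tail_int_neg_powr f r (\<phi> x)\<bar> * indicator (ball y \<rho>) x"
        using ae
      proof eventually_elim
        case (elim x)
        have "0 \<le> tail_int_neg_powr f r v" for v unfolding tail_int_neg_powr_def by simp
        then show ?case unfolding elim by (simp only: abs_of_nonneg)
      qed
    qed
    show "(SUP y. \<integral>\<^sup>+x\<in>ball y \<rho>. ennreal (tail_int_neg_powr f r (\<phi>' x)) \<partial>lborel) < \<infinity>"
      using ul unfolding eq L1_ul_def by simp
  qed
  then show ?thesis using has_local_solution_cong_AE[OF ae] by simp
qed

end

theorem theorem1p4: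
  fixes f :: "real \<Rightarrow> real" and \<theta> \<rho> q :: real
  assumes "0 < \<theta>" and "\<theta> \<le> 2" and "0 < \<rho>"
    and "f C1_differentiable_on {0<..}" and "continuous_on {0..} f"
    and "\<forall>u>0. 0 < f u"
    and "\<forall>u\<ge>0. \<forall>D. (f has_real_derivative D) (at u within {0..}) \<longrightarrow> 0 \<le> D"
    and "eventually (\<lambda>u. tail_int f u < \<infinity>) at_top"
    and "((\<lambda>u. deriv f u * enn2real (tail_int f u)) \<longlongrightarrow> q) at_top"
    and "1 < q"
  shows
    "(\<forall>r (\<phi> :: real ^ 'n \<Rightarrow> real).
        real CARD('n) / \<theta> < r \<and> q - 1 < r \<and>
        \<phi> \<in> borel_measurable lebesgue \<and> (\<forall>x. 0 \<le> \<phi> x) \<and>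
        (\<lambda>x. tail_int_neg_powr f r (\<phi> x)) \<in> L1_ul \<rho> \<longrightarrow>
        has_local_solution \<theta> f \<phi>) \<and>
     (\<forall>r (\<phi> :: real ^ 'n \<Rightarrow> real).
        real CARD('n) / \<theta> < r \<and> q - 1 \<le> r \<and>
        eventually (\<lambda>u. deriv f u * enn2real (tail_int f u) \<le> q) at_top \<and>
        \<phi> \<in> borel_measurable lebesgue \<and> (\<forall>x. 0 \<le> \<phi> x) \<and>
        (\<lambda>x. tail_int_neg_powr f r (\<phi> x)) \<in> L1_ul \<rho> \<longrightarrow>
        has_local_solution \<theta> f \<phi>) \<and>
     (convex_on {0..} f \<longrightarrow>
        (\<forall>r. 0 < r \<and> r < real CARD('n) / \<theta> \<longrightarrow>
          (\<exists>\<phi> :: real ^ 'n \<Rightarrow> real.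
             \<phi> \<in> borel_measurable lebesgue \<and> (\<forall>x. 0 \<le> \<phi> x) \<and>
             (\<lambda>x. tail_int_neg_powr f r (\<phi> x)) \<in> L1_ul \<rho> \<and>
             \<not> has_local_solution \<theta> f \<phi>)))"
proof -
  interpret regular_source f q
    by unfold_locales (use assms in auto)
  have exist: "has_local_solution \<theta> f \<phi>"
    if "real CARD('n) / \<theta> < r" and ev: "eventually (\<lambda>u. deriv f u * enn2real (tail_int f u) \<le> r + 1) at_top"
      and "\<phi> \<in> borel_measurable lebesgue" "\<forall>x. 0 \<le> \<phi> x" "(\<lambda>x. tail_int_neg_powr f r (\<phi> x)) \<in> L1_ul \<rho>"
    for r and \<phi> :: "real ^ 'n \<Rightarrow> real"
    by (rule local_existence_lebesgue[OF assms(1-3) that(1) ev[folded F_def] that(3-5)])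
  show ?thesis
  proof (intro conjI allI impI)
    fix r and \<phi> :: "real ^ 'n \<Rightarrow> real"
    assume *: "real CARD('n) / \<theta> < r \<and> q - 1 < r \<and> \<phi> \<in> borel_measurable lebesgue \<and> (\<forall>x. 0 \<le> \<phi> x) \<and>
      (\<lambda>x. tail_int_neg_powr f r (\<phi> x)) \<in> L1_ul \<rho>"
    then have "q < r + 1" by simp
    then have "eventually (\<lambda>u. deriv f u * enn2real (tail_int f u) < r + 1) at_top"
      by (rule order_tendstoD(2)[OF assms(9)])
    then have "eventually (\<lambda>u. deriv f u * enn2real (tail_int f u) \<le> r + 1) at_top"
      by eventually_elim simp
    then show "has_local_solution \<theta> f \<phi>" using * by (intro exist) auto
  next
    fix r and \<phi> :: "real ^ 'n \<Rightarrow> real"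
    assume *: "real CARD('n) / \<theta> < r \<and> q - 1 \<le> r \<and>
      eventually (\<lambda>u. deriv f u * enn2real (tail_int f u) \<le> q) at_top \<and>
      \<phi> \<in> borel_measurable lebesgue \<and> (\<forall>x. 0 \<le> \<phi> x) \<and> (\<lambda>x. tail_int_neg_powr f r (\<phi> x)) \<in> L1_ul \<rho>"
    then have "eventually (\<lambda>u. deriv f u * enn2real (tail_int f u) \<le> q) at_top" "q \<le> r + 1" by auto
    then have "eventually (\<lambda>u. deriv f u * enn2real (tail_int f u) \<le> r + 1) at_top"
      by (auto elim!: eventually_mono)
    then show "has_local_solution \<theta> f \<phi>" using * by (intro exist) auto
  next
    fix r assume r: "0 < r \<and> r < real CARD('n) / \<theta>"
    \<comment> \<open>An exponent above \<open>\<theta>\<close> makes the datum too singular, one below \<open>N / r\<close> keeps it admissible.\<close>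
    define X where "X = real CARD('n) / r"
    define \<alpha> where "\<alpha> = (\<theta> + X) / 2"
    have "\<theta> < X" using r assms(1) by (simp add: X_def field_simps)
    then have \<alpha>: "\<theta> < \<alpha>" "\<alpha> < X" unfolding \<alpha>_def by simp_all
    have \<alpha>r: "0 < \<alpha>" "\<alpha> * r < real CARD('n)"
      using \<alpha> r assms(1) unfolding X_def by (simp_all add: pos_less_divide_eq)
    have inv0: "0 \<le> F_inv \<tau>" for \<tau> using F_inv[of \<tau>] by (cases "0 < \<tau> \<and> \<tau> \<le> F 1") (auto simp: F_inv_def)
    show "\<exists>\<phi> :: real ^ 'n \<Rightarrow> real. \<phi> \<in> borel_measurable lebesgue \<and> (\<forall>x. 0 \<le> \<phi> x) \<and>
        (\<lambda>x. tail_int_neg_powr f r (\<phi> x)) \<in> L1_ul \<rho> \<and> \<not> has_local_solution \<theta> f \<phi>"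
    proof (intro exI[of _ "\<lambda>x. F_inv (norm x powr \<alpha>)"] conjI allI inv0)
      show "(\<lambda>x :: real ^ 'n. F_inv (norm x powr \<alpha>)) \<in> borel_measurable lebesgue"
        by (rule measurable_completion) measurable
      show "(\<lambda>x :: real ^ 'n. tail_int_neg_powr f r (F_inv (norm x powr \<alpha>))) \<in> L1_ul \<rho>"
        using r by (intro singular_datum_L1_ul \<alpha>r assms(3)) simp
      show "\<not> has_local_solution \<theta> f (\<lambda>x :: real ^ 'n. F_inv (norm x powr \<alpha>))"
        by (rule singular_datum_no_local_solution[OF assms(1) \<alpha>(1)])
    qed
  qed
qed

end
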